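(* Let $T$ be a complete first-order theory which is 2-dependent, $\mathfrak{C}$ a $\bar\kappa$-saturated model of $T$ ($\bar\kappa$ strongly inaccessible, $\bar\kappa>|T|$). Let $p_*(x)$ be a type over $A_*\subseteq\mathfrak{C}$, $|A_*|<\bar\kappa$, such that functions $(x,y)\mapsto xy$, $x\mapsto x^{-1}$ and an element $e_G$, definable over $A_*$, give $G=p_*(\mathfrak{C})$ a group structure. Let $\kappa=(\beth_2(|T|+|p_*|))^+$, or just $\kappa=((|T|+|p_*|)^{\aleph_0})^+ +\beth_2^+$ (where $\beth_2=2^{2^{\aleph_0}}$). Then $G$ has $\kappa$-based bounded subgroups: for every $\kappa$-saturated $M\prec\mathfrak{C}$ with $A_*\subseteq M$ and every finite tuple $\bar b$ from $\mathfrak{C}$, there is $r\in\mathbf R_{M\cup\bar b}$ of cardinality $<\kappa$ such that $q_M\cup r\vdash q_{M\cup\bar b}$.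
   Context: $T$ is 2-independent if there are a formula $\varphi(\bar x,\bar y,\bar z)$ and tuples $\bar b_n,\bar c_m$ ($n,m<\omega$) in a model of $T$ such that $\langle\varphi(\bar x,\bar b_n,\bar c_m):n,m<\omega\rangle$ is independent (for every $u\subseteq\omega\times\omega$ the set $\{\varphi(\bar x,\bar b_n,\bar c_m)^{\mathrm{if}((n,m)\in u)}:n,m<\omega\}$ is consistent, $\varphi^{\mathrm{if}(\text{true})}=\varphi$, $\varphi^{\mathrm{if}(\text{false})}=\neg\varphi$); $T$ is 2-dependent if it is not 2-independent. For $B\subseteq\mathfrak{C}$: $\mathbf R_B$ is the set of 1-types $q(x)$ over $B$ such that $G_q:=\{a\in G:a\text{ realizes }q\}=(p_*\cup q)(\mathfrak{C})$ is a subgroup of $G$ of index $<\bar\kappa$; $q_B=\bigcup\{q:q\in\mathbf R_B\}$; $G_B=q_B(\mathfrak{C})\cap G$.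
   Formalization: The models $M\prec\mathfrak{C}$ are assumed small, $|M|<\bar\kappa$ (the usual monster-model convention); without this the claim fails, e.g. for a hyperplane $M$ of an $\mathbb{F}_2$-vector space $\mathfrak{C}$ of dimension $\bar\kappa$ and $b\notin M$. *)

theory Defs
  imports "HOL-Algebra.Coset"
begin

unbundle cardinal_syntax

section \<open>First-order logic with parameters\<close>

record ('f, 'r) lang =
  funs :: "'f set"
  rels :: "'r set"
  farity :: "'f \<Rightarrow> nat"
  rarity :: "'r \<Rightarrow> nat"

text \<open>
  A formula over \<open>B\<close> is a formula of the language expanded by constants naming the elements
  of \<open>B\<close>; \<open>Par c\<close> is the constant naming \<open>c\<close>. The formulas of the language itself are those
  over the empty set.
\<close>

datatype ('f, 'a) trm = Var nat | Par 'a | Fn 'f "('f, 'a) trm list"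

datatype ('f, 'r, 'a) fm =
    Eq "('f, 'a) trm" "('f, 'a) trm"
  | Rel 'r "('f, 'a) trm list"
  | Neg "('f, 'r, 'a) fm"
  | Conj "('f, 'r, 'a) fm" "('f, 'r, 'a) fm"
  | Ex nat "('f, 'r, 'a) fm"

fun fv_trm :: "('f, 'a) trm \<Rightarrow> nat set" where
  "fv_trm (Var i) = {i}"
| "fv_trm (Par c) = {}"
| "fv_trm (Fn f ts) = (\<Union>t\<in>set ts. fv_trm t)"

primrec fv :: "('f, 'r, 'a) fm \<Rightarrow> nat set" where
  "fv (Eq s t) = fv_trm s \<union> fv_trm t"
| "fv (Rel R ts) = (\<Union>t\<in>set ts. fv_trm t)"
| "fv (Neg \<phi>) = fv \<phi>"
| "fv (Conj \<phi> \<psi>) = fv \<phi> \<union> fv \<psi>"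
| "fv (Ex i \<phi>) = fv \<phi> - {i}"

fun wf_trm :: "('f, 'r) lang \<Rightarrow> 'a set \<Rightarrow> ('f, 'a) trm \<Rightarrow> bool" where
  "wf_trm L B (Var i) \<longleftrightarrow> True"
| "wf_trm L B (Par c) \<longleftrightarrow> c \<in> B"
| "wf_trm L B (Fn f ts) \<longleftrightarrow>
     f \<in> funs L \<and> length ts = farity L f \<and> (\<forall>t\<in>set ts. wf_trm L B t)"

primrec wf_fm :: "('f, 'r) lang \<Rightarrow> 'a set \<Rightarrow> ('f, 'r, 'a) fm \<Rightarrow> bool" where
  "wf_fm L B (Eq s t) \<longleftrightarrow> wf_trm L B s \<and> wf_trm L B t"
| "wf_fm L B (Rel R ts) \<longleftrightarrow>
     R \<in> rels L \<and> length ts = rarity L R \<and> (\<forall>t\<in>set ts. wf_trm L B t)"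
| "wf_fm L B (Neg \<phi>) \<longleftrightarrow> wf_fm L B \<phi>"
| "wf_fm L B (Conj \<phi> \<psi>) \<longleftrightarrow> wf_fm L B \<phi> \<and> wf_fm L B \<psi>"
| "wf_fm L B (Ex i \<phi>) \<longleftrightarrow> wf_fm L B \<phi>"

definition forms :: "('f, 'r) lang \<Rightarrow> 'a set \<Rightarrow> nat \<Rightarrow> ('f, 'r, 'a) fm set" where
  "forms L B k = {\<phi>. wf_fm L B \<phi> \<and> fv \<phi> \<subseteq> {..<k}}"

record ('f, 'r, 'a) struct =
  dom :: "'a set"
  fint :: "'f \<Rightarrow> 'a list \<Rightarrow> 'a"
  rint :: "'r \<Rightarrow> 'a list \<Rightarrow> bool"

definition is_struct :: "('f, 'r) lang \<Rightarrow> ('f, 'r, 'a) struct \<Rightarrow> bool" where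
  "is_struct L N \<longleftrightarrow> dom N \<noteq> {} \<and>
     (\<forall>f\<in>funs L. \<forall>as. length as = farity L f \<and> set as \<subseteq> dom N \<longrightarrow> fint N f as \<in> dom N)"

fun eval :: "('f, 'r, 'a) struct \<Rightarrow> (nat \<Rightarrow> 'a) \<Rightarrow> ('f, 'a) trm \<Rightarrow> 'a" where
  "eval N e (Var i) = e i"
| "eval N e (Par c) = c"
| "eval N e (Fn f ts) = fint N f (map (eval N e) ts)"

primrec sat :: "('f, 'r, 'a) struct \<Rightarrow> (nat \<Rightarrow> 'a) \<Rightarrow> ('f, 'r, 'a) fm \<Rightarrow> bool" where
  "sat N e (Eq s t) \<longleftrightarrow> eval N e s = eval N e t"
| "sat N e (Rel R ts) \<longleftrightarrow> rint N R (map (eval N e) ts)"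
| "sat N e (Neg \<phi>) \<longleftrightarrow> \<not> sat N e \<phi>"
| "sat N e (Conj \<phi> \<psi>) \<longleftrightarrow> sat N e \<phi> \<and> sat N e \<psi>"
| "sat N e (Ex i \<phi>) \<longleftrightarrow> (\<exists>a\<in>dom N. sat N (e(i := a)) \<phi>)"

text \<open>
  Satisfaction of a formula in \<open>forms L B (length as)\<close> by the tuple \<open>as\<close>; the values of
  \<open>(!) as\<close> beyond the length of \<open>as\<close> are irrelevant for such a formula.
\<close>

definition sats :: "('f, 'r, 'a) struct \<Rightarrow> 'a list \<Rightarrow> ('f, 'r, 'a) fm \<Rightarrow> bool" where
  "sats N as \<phi> \<longleftrightarrow> sat N ((!) as) \<phi>"

section \<open>Theories, types and saturation\<close>

definition model :: "('f, 'r) lang \<Rightarrow> ('f, 'r, 'a) fm set \<Rightarrow> ('f, 'r, 'a) struct \<Rightarrow> bool" where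
  "model L T N \<longleftrightarrow> is_struct L N \<and> (\<forall>\<phi>\<in>T. sats N [] \<phi>)"

text \<open>
  A complete theory decides every sentence by membership, i.e. it is deductively closed. Hence
  the cardinal \<open>|T|\<close> is the number of sentences of the language, as usual.
\<close>

definition complete_theory :: "('f, 'r) lang \<Rightarrow> ('f, 'r, 'a) fm set \<Rightarrow> bool" where
  "complete_theory L T \<longleftrightarrow>
     T \<subseteq> forms L {} 0 \<and> (\<exists>N. model L T N) \<and> (\<forall>\<phi>\<in>forms L {} 0. \<phi> \<in> T \<or> Neg \<phi> \<in> T)"

definition elem_sub ::
  "('f, 'r) lang \<Rightarrow> ('f, 'r, 'a) struct \<Rightarrow> ('f, 'r, 'a) struct \<Rightarrow> bool" where
  "elem_sub L M N \<longleftrightarrow> is_struct L M \<and> is_struct L N \<and> dom M \<subseteq> dom N \<and>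
     (\<forall>k. \<forall>\<phi>\<in>forms L {} k. \<forall>as. length as = k \<and> set as \<subseteq> dom M \<longrightarrow>
        (sats M as \<phi> \<longleftrightarrow> sats N as \<phi>))"

text \<open>
  Consistency of a set of formulas with parameters in \<open>N\<close> and free variables among the first
  \<open>k\<close>, relative to the theory of \<open>N\<close> with names for its elements.
\<close>

definition consistent_in :: "('f, 'r, 'a) struct \<Rightarrow> nat \<Rightarrow> ('f, 'r, 'a) fm set \<Rightarrow> bool" where
  "consistent_in N k \<Gamma> \<longleftrightarrow>
     (\<forall>F. finite F \<and> F \<subseteq> \<Gamma> \<longrightarrow>
        (\<exists>as. length as = k \<and> set as \<subseteq> dom N \<and> (\<forall>\<phi>\<in>F. sats N as \<phi>)))"

text \<open>Types are not assumed to be complete.\<close>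

definition one_type ::
  "('f, 'r) lang \<Rightarrow> ('f, 'r, 'a) struct \<Rightarrow> 'a set \<Rightarrow> ('f, 'r, 'a) fm set \<Rightarrow> bool" where
  "one_type L N B q \<longleftrightarrow> q \<subseteq> forms L B 1 \<and> consistent_in N 1 q"

definition realz :: "('f, 'r, 'a) struct \<Rightarrow> ('f, 'r, 'a) fm set \<Rightarrow> 'a set" where
  "realz N q = {a \<in> dom N. \<forall>\<phi>\<in>q. sats N [a] \<phi>}"

text \<open>
  \<open>p \<turnstile> q\<close> for sets of formulas in one variable with parameters in \<open>N\<close>: modulo the theory of
  \<open>N\<close> with names for its elements, each member of \<open>q\<close> follows from finitely many members of \<open>p\<close>.
\<close>

definition entails ::
  "('f, 'r, 'a) struct \<Rightarrow> ('f, 'r, 'a) fm set \<Rightarrow> ('f, 'r, 'a) fm set \<Rightarrow> bool" where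
  "entails N p q \<longleftrightarrow>
     (\<forall>\<psi>\<in>q. \<exists>F. finite F \<and> F \<subseteq> p \<and> (\<forall>a\<in>realz N F. sats N [a] \<psi>))"

definition saturated ::
  "('f, 'r) lang \<Rightarrow> 'k rel \<Rightarrow> ('f, 'r, 'a) struct \<Rightarrow> bool" where
  "saturated L \<kappa> N \<longleftrightarrow>
     (\<forall>B q. B \<subseteq> dom N \<and> |B| <o \<kappa> \<and> one_type L N B q \<longrightarrow> realz N q \<noteq> {})"

definition strongly_inaccessible :: "'k rel \<Rightarrow> bool" where
  "strongly_inaccessible \<kappa> \<longleftrightarrow> Card_order \<kappa> \<and> natLeq <o \<kappa> \<and> regularCard \<kappa> \<and>
     (\<forall>X \<subseteq> Field \<kappa>. |X| <o \<kappa> \<longrightarrow> |Pow X| <o \<kappa>)"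

section \<open>2-dependence\<close>

fun inst_trm :: "(nat \<Rightarrow> 'a option) \<Rightarrow> ('f, 'a) trm \<Rightarrow> ('f, 'a) trm" where
  "inst_trm \<sigma> (Var i) = (case \<sigma> i of None \<Rightarrow> Var i | Some c \<Rightarrow> Par c)"
| "inst_trm \<sigma> (Par c) = Par c"
| "inst_trm \<sigma> (Fn f ts) = Fn f (map (inst_trm \<sigma>) ts)"

primrec inst :: "(nat \<Rightarrow> 'a option) \<Rightarrow> ('f, 'r, 'a) fm \<Rightarrow> ('f, 'r, 'a) fm" where
  "inst \<sigma> (Eq s t) = Eq (inst_trm \<sigma> s) (inst_trm \<sigma> t)"
| "inst \<sigma> (Rel R ts) = Rel R (map (inst_trm \<sigma>) ts)"
| "inst \<sigma> (Neg \<phi>) = Neg (inst \<sigma> \<phi>)"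
| "inst \<sigma> (Conj \<phi> \<psi>) = Conj (inst \<sigma> \<phi>) (inst \<sigma> \<psi>)"
| "inst \<sigma> (Ex i \<phi>) = Ex i (inst (\<sigma>(i := None)) \<phi>)"

text \<open>
  \<open>plug k cs \<phi>\<close> is \<open>\<phi>(x\<^sub>0, \<dots>, x\<^sub>k\<^sub>-\<^sub>1, cs)\<close>: the parameters \<open>cs\<close> are substituted for the
  variables from index \<open>k\<close> on.
\<close>

definition plug :: "nat \<Rightarrow> 'a list \<Rightarrow> ('f, 'r, 'a) fm \<Rightarrow> ('f, 'r, 'a) fm" where
  "plug k cs = inst (\<lambda>i. if k \<le> i \<and> i < k + length cs then Some (cs ! (i - k)) else None)"

definition fm_if :: "bool \<Rightarrow> ('f, 'r, 'a) fm \<Rightarrow> ('f, 'r, 'a) fm" where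
  "fm_if t \<phi> = (if t then \<phi> else Neg \<phi>)"

text \<open>
  The models considered have their universe inside the type \<open>'a\<close>. This is no restriction if,
  as below, \<open>'a\<close> carries a model of \<open>T\<close> saturated beyond \<open>\<aleph>\<^sub>0\<close>: such a model realizes every
  countable configuration of tuples occurring in some model of \<open>T\<close>.
\<close>

definition two_independent :: "('f, 'r) lang \<Rightarrow> ('f, 'r, 'a) fm set \<Rightarrow> bool" where
  "two_independent L T \<longleftrightarrow>
     (\<exists>(N :: ('f, 'r, 'a) struct) k l m \<phi> (b :: nat \<Rightarrow> 'a list) (c :: nat \<Rightarrow> 'a list).
        model L T N \<and> \<phi> \<in> forms L {} (k + l + m) \<and>
        (\<forall>i. length (b i) = l \<and> set (b i) \<subseteq> dom N) \<and>
        (\<forall>j. length (c j) = m \<and> set (c j) \<subseteq> dom N) \<and>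
        (\<forall>u :: (nat \<times> nat) set.
           consistent_in N k {fm_if ((i, j) \<in> u) (plug k (b i @ c j) \<phi>) | i j. True}))"

definition two_dependent :: "('f, 'r) lang \<Rightarrow> ('f, 'r, 'a) fm set \<Rightarrow> bool" where
  "two_dependent L T \<longleftrightarrow> \<not> two_independent L T"

section \<open>Type-definable groups and bounded subgroups\<close>

text \<open>
  The universe of the group \<open>G\<close> is the set of realizations of \<open>p\<close> in \<open>N\<close>, and its operations
  are the restrictions to \<open>G\<close> of (possibly partial) functions definable over \<open>A\<close>.
\<close>

definition type_definable_group ::
  "('f, 'r) lang \<Rightarrow> ('f, 'r, 'a) struct \<Rightarrow> 'a set \<Rightarrow> ('f, 'r, 'a) fm set \<Rightarrow> 'a monoid \<Rightarrow> bool"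
  where
  "type_definable_group L N A p G \<longleftrightarrow>
     one_type L N A p \<and> group G \<and> carrier G = realz N p \<and>
     (\<exists>\<mu>\<in>forms L A 3. \<forall>x\<in>carrier G. \<forall>y\<in>carrier G. \<forall>z\<in>dom N.
        sats N [x, y, z] \<mu> \<longleftrightarrow> z = x \<otimes>\<^bsub>G\<^esub> y) \<and>
     (\<exists>\<iota>\<in>forms L A 2. \<forall>x\<in>carrier G. \<forall>y\<in>dom N. sats N [x, y] \<iota> \<longleftrightarrow> y = inv\<^bsub>G\<^esub> x) \<and>
     (\<exists>\<epsilon>\<in>forms L A 1. \<forall>x\<in>dom N. sats N [x] \<epsilon> \<longleftrightarrow> x = \<one>\<^bsub>G\<^esub>)"

definition G_of :: "('f, 'r, 'a) struct \<Rightarrow> 'a monoid \<Rightarrow> ('f, 'r, 'a) fm set \<Rightarrow> 'a set" where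
  "G_of N G q = {a \<in> carrier G. \<forall>\<phi>\<in>q. sats N [a] \<phi>}"

definition R_set ::
  "('f, 'r) lang \<Rightarrow> 'k rel \<Rightarrow> ('f, 'r, 'a) struct \<Rightarrow> 'a monoid \<Rightarrow> 'a set \<Rightarrow>
     ('f, 'r, 'a) fm set set" where
  "R_set L \<kappa>bar N G B = {q. one_type L N B q \<and> subgroup (G_of N G q) G \<and>
     |rcosets\<^bsub>G\<^esub> (G_of N G q)| <o \<kappa>bar}"

definition q_set ::
  "('f, 'r) lang \<Rightarrow> 'k rel \<Rightarrow> ('f, 'r, 'a) struct \<Rightarrow> 'a monoid \<Rightarrow> 'a set \<Rightarrow>
     ('f, 'r, 'a) fm set" where
  "q_set L \<kappa>bar N G B = \<Union> (R_set L \<kappa>bar N G B)"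

text \<open>
  As usual inside a \<open>\<kappa>bar\<close>-saturated monster model, the elementary submodels \<open>M\<close> of \<open>N\<close> that
  are considered are small, i.e. of cardinality below \<open>\<kappa>bar\<close>. For larger \<open>M\<close> the set
  \<open>R_set\<close> would contain types with \<open>\<kappa>bar\<close> parameters, to which saturation does not apply.
\<close>

definition has_based_bounded_subgroups ::
  "('f, 'r) lang \<Rightarrow> 'kb rel \<Rightarrow> ('f, 'r, 'a) struct \<Rightarrow> 'a set \<Rightarrow> 'a monoid \<Rightarrow> 'k rel \<Rightarrow> bool"
  where
  "has_based_bounded_subgroups L \<kappa>bar N A G \<kappa> \<longleftrightarrow>
     (\<forall>M bs. elem_sub L M N \<and> |dom M| <o \<kappa>bar \<and> saturated L \<kappa> M \<and> A \<subseteq> dom M \<and>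
        set bs \<subseteq> dom N \<longrightarrow>
        (\<exists>r\<in>R_set L \<kappa>bar N G (dom M \<union> set bs). |r| <o \<kappa> \<and>
           entails N (q_set L \<kappa>bar N G (dom M) \<union> r) (q_set L \<kappa>bar N G (dom M \<union> set bs))))"

end

theory Submission
  imports Defs "HOL-Library.Ramsey"
begin

text \<open>
  Every formula of a bounded type-definable subgroup starts a chain of formulas \<open>\<psi>\<^sub>n\<close> with
  \<open>\<psi>\<^sub>n\<^sub>+\<^sub>1 \<psi>\<^sub>n\<^sub>+\<^sub>1\<inverse> \<subseteq> \<psi>\<^sub>n\<close> such that finitely many translates of each \<open>\<psi>\<^sub>n\<close> cover \<open>G\<close>. There are at
  most \<open>(|T| + |p|)\<^sup>\<aleph>\<^sup>0\<close> shapes of chains over \<open>M \<union> bs\<close>. If for every shape the intersection of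
  finitely many chain groups with \<open>G\<^sub>M\<close> satisfies all first formulas of that shape, the union of
  these chains is the type sought. Otherwise some shape has an infinite sequence of chain groups
  \<open>H(c\<^sub>j, bs)\<close> with \<open>a\<^sub>i \<in> G\<^sub>M\<close> in \<open>H(c\<^sub>j, bs)\<close> for \<open>j < i\<close>, but outside the first formula of
  \<open>H(c\<^sub>i, bs)\<close>. By Ramsey's theorem, quotients of the \<open>a\<^sub>i\<close> also lie almost in the later groups.
  Saturation of \<open>M\<close> yields copies \<open>b\<^sub>m, a\<^sub>m\<^sub>i \<in> M\<close> of \<open>bs, a\<^sub>i\<close> over the previous ones. Since the groups
  \<open>H(c\<^sub>j, b\<^sub>l)\<close> are bounded and defined over \<open>M\<close>, they contain \<open>a\<^sub>i\<close> and hence \<open>a\<^sub>m\<^sub>i\<close> for \<open>m > l\<close>;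
  for \<open>m < l\<close> one passes to quotients of elements in the same classes over \<open>bs\<close>. Products of the
  resulting elements realize every pattern on a finite array, so \<open>T\<close> is 2-independent.
\<close>

section \<open>Syntax\<close>

text \<open>A type over \<open>M\<close> may have as many parameters as \<open>M\<close> has
  elements, while \<open>M\<close> realizes only types over fewer than \<open>\<kappa>\<close>
  parameters. A chain preserves boundedness and approximate closure under quotients with countably
  many parameters, so countably many chains can be held fixed while \<open>bs\<close> is copied into
  \<open>M\<close>. In the array, copies of \<open>bs\<close> give the rows and the
  \<open>c\<^sub>j\<close> the columns; the formula is level 5 of a chain. Passing to quotients
  twice turns failure of level 0 into failure of level 2, and cancelling the other factors around
  one bad factor costs three more levels. Membership is needed at level
  \<open>5 + 2 * (n * n)\<close>, since a pattern is a product of at most \<open>n * n\<close>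
  factors at two levels each. As \<open>G\<close> is only type-definable, neither closure under
  quotients nor covering of \<open>G\<close> is a single sentence about the parameters. Both are
  carried along partial elementary maps by pulling elements back inside the saturated
  \<open>N\<close>. Bounds on the number of classes that depend on the level, but not on the chain,
  turn classes into finitely many colours.\<close>

abbreviation pmap :: "('a \<Rightarrow> 'b) \<Rightarrow> ('f, 'r, 'a) fm \<Rightarrow> ('f, 'r, 'b) fm" where
  "pmap g \<equiv> map_fm (\<lambda>x. x) (\<lambda>x. x) g"

abbreviation pars :: "('f, 'r, 'a) fm \<Rightarrow> 'a set" where
  "pars \<equiv> set3_fm"

lemma finite_fv_trm [simp]: "finite (fv_trm t)"
  by (induction t) auto

lemma finite_fv [simp]: "finite (fv \<phi>)"
  by (induction \<phi>) auto

lemma finite_set2_trm [simp]: "finite (set2_trm t)"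
  by (induction t) auto

lemma finite_pars [simp]: "finite (pars \<phi>)"
  by (induction \<phi>) auto

lemma eval_cong: "(\<And>i. i \<in> fv_trm t \<Longrightarrow> e i = e' i) \<Longrightarrow> eval N e t = eval N e' t"
proof (induction t)
  case (Fn f ts)
  then have "map (eval N e) ts = map (eval N e') ts" by (auto intro!: map_cong)
  then show ?case by (simp only: eval.simps)
qed auto

lemma sat_cong: "(\<And>i. i \<in> fv \<phi> \<Longrightarrow> e i = e' i) \<Longrightarrow> sat N e \<phi> = sat N e' \<phi>"
proof (induction \<phi> arbitrary: e e')
  case (Eq s t)
  then show ?case using eval_cong[of s e e' N] eval_cong[of t e e' N] by auto
next
  case (Rel R ts)
  then have "map (eval N e) ts = map (eval N e') ts"
    by (intro map_cong refl eval_cong) auto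
  then show ?case by (simp only: sat.simps)
next
  case (Neg \<phi>)
  show ?case using Neg.IH[of e e'] Neg.prems by auto
next
  case (Conj \<phi>1 \<phi>2)
  show ?case using Conj.IH(1)[of e e'] Conj.IH(2)[of e e'] Conj.prems by auto
next
  case (Ex i \<phi>)
  have "sat N (e(i := a)) \<phi> = sat N (e'(i := a)) \<phi>" for a
    by (rule Ex.IH) (use Ex.prems in auto)
  then show ?case by simp
qed

lemma sat_sats:
  assumes "fv \<phi> \<subseteq> {..<length as}" "\<And>i. i < length as \<Longrightarrow> e i = as ! i"
  shows "sat N e \<phi> = sats N as \<phi>"
  unfolding sats_def by (rule sat_cong) (use assms in auto)

lemma sat_sentence: "fv \<phi> = {} \<Longrightarrow> sat N e \<phi> = sats N [] \<phi>"
  by (rule sat_sats) auto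

lemma sat_sats1: "fv \<phi> \<subseteq> {..<1} \<Longrightarrow> sat N e \<phi> = sats N [e 0] \<phi>"
  by (rule sat_sats) auto

lemma wf_trm_iff: "wf_trm L B t \<longleftrightarrow> wf_trm L UNIV t \<and> set2_trm t \<subseteq> B"
  by (induction t) auto

lemma wf_fm_iff: "wf_fm L B \<phi> \<longleftrightarrow> wf_fm L UNIV \<phi> \<and> pars \<phi> \<subseteq> B"
proof (induction \<phi>)
  case (Eq s t)
  show ?case using wf_trm_iff[of L B s] wf_trm_iff[of L B t] by auto
next
  case (Rel R ts)
  show ?case using wf_trm_iff[of L B] by auto
qed auto

lemma wf_fm_mono: "wf_fm L B \<phi> \<Longrightarrow> B \<subseteq> B' \<Longrightarrow> wf_fm L B' \<phi>"
  using wf_fm_iff[of L B \<phi>] wf_fm_iff[of L B' \<phi>] by blast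

lemma forms_mono: "\<phi> \<in> forms L B k \<Longrightarrow> B \<subseteq> B' \<Longrightarrow> k \<le> k' \<Longrightarrow> \<phi> \<in> forms L B' k'"
  unfolding forms_def using wf_fm_mono[of L B \<phi> B'] order_trans[of "fv \<phi>" "{..<k}" "{..<k'}"] by auto

lemma pars_forms: "\<phi> \<in> forms L B k \<Longrightarrow> pars \<phi> \<subseteq> B"
  unfolding forms_def using wf_fm_iff[of L B \<phi>] by blast

lemma forms_restrict: "\<phi> \<in> forms L B k \<Longrightarrow> pars \<phi> \<subseteq> B' \<Longrightarrow> \<phi> \<in> forms L B' k"
  unfolding forms_def using wf_fm_iff[of L B \<phi>] wf_fm_iff[of L B' \<phi>] by blast

lemma fv_map_trm [simp]: "fv_trm (map_trm (\<lambda>x. x) g t) = fv_trm t"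
  by (induction t) auto

lemma fv_pmap [simp]: "fv (pmap g \<phi>) = fv \<phi>"
  by (induction \<phi>) auto

lemma wf_map_trm: "wf_trm L B t \<Longrightarrow> wf_trm L (g ` B) (map_trm (\<lambda>x. x) g t)"
  by (induction t) auto

lemma wf_pmap: "wf_fm L B \<phi> \<Longrightarrow> wf_fm L (g ` B) (pmap g \<phi>)"
  by (induction \<phi>) (auto intro: wf_map_trm)

lemma forms_pmap: "\<phi> \<in> forms L B k \<Longrightarrow> pmap g \<phi> \<in> forms L (g ` B) k"
  unfolding forms_def using wf_pmap by auto

lemma pmap_cong: "(\<And>c. c \<in> pars \<phi> \<Longrightarrow> g c = h c) \<Longrightarrow> pmap g \<phi> = pmap h \<phi>"
  by (rule fm.map_cong) auto

lemma pmap_pmap: "pmap g (pmap h \<phi>) = pmap (\<lambda>c. g (h c)) \<phi>"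
  by (simp add: fm.map_comp o_def)

lemma pmap_id: "(\<And>c. c \<in> pars \<phi> \<Longrightarrow> g c = c) \<Longrightarrow> pmap g \<phi> = \<phi>"
  using pmap_cong[of \<phi> g "\<lambda>c. c"] by (simp add: fm.map_ident)

section \<open>Replacing parameters by terms, without renaming of bound variables\<close>

primrec bv :: "('f, 'r, 'a) fm \<Rightarrow> nat set" where
  "bv (Eq s t) = {}"
| "bv (Rel R ts) = {}"
| "bv (Neg \<phi>) = bv \<phi>"
| "bv (Conj \<phi> \<psi>) = bv \<phi> \<union> bv \<psi>"
| "bv (Ex i \<phi>) = insert i (bv \<phi>)"

lemma finite_bv [simp]: "finite (bv \<phi>)"
  by (induction \<phi>) auto

text \<open>The opposite direction to \<open>inst\<close>: parameters become terms, mostly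
  variables. It is needed because \<open>elem_sub\<close> and \<open>two_independent\<close> speak
  of formulas over the empty set. The type of the parameters may change, so that formulas with
  numbers as parameters become formulas of the language.\<close>

primrec psubst_trm :: "('b \<Rightarrow> ('f, 'a) trm) \<Rightarrow> ('f, 'b) trm \<Rightarrow> ('f, 'a) trm" where
  "psubst_trm \<tau> (Var i) = Var i"
| "psubst_trm \<tau> (Par c) = \<tau> c"
| "psubst_trm \<tau> (Fn f ts) = Fn f (map (psubst_trm \<tau>) ts)"

primrec psubst :: "('b \<Rightarrow> ('f, 'a) trm) \<Rightarrow> ('f, 'r, 'b) fm \<Rightarrow> ('f, 'r, 'a) fm" where
  "psubst \<tau> (Eq s t) = Eq (psubst_trm \<tau> s) (psubst_trm \<tau> t)"
| "psubst \<tau> (Rel R ts) = Rel R (map (psubst_trm \<tau>) ts)"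
| "psubst \<tau> (Neg \<phi>) = Neg (psubst \<tau> \<phi>)"
| "psubst \<tau> (Conj \<phi> \<psi>) = Conj (psubst \<tau> \<phi>) (psubst \<tau> \<psi>)"
| "psubst \<tau> (Ex i \<phi>) = Ex i (psubst \<tau> \<phi>)"

lemma eval_psubst_trm:
  "(\<And>c. c \<in> set2_trm t \<Longrightarrow> eval N e (\<tau> c) = g c) \<Longrightarrow>
    eval N e (psubst_trm \<tau> t) = eval N e (map_trm (\<lambda>x. x) g t)"
proof (induction t)
  case (Fn f ts)
  then have "map (eval N e \<circ> psubst_trm \<tau>) ts = map (eval N e \<circ> map_trm (\<lambda>x. x) g) ts"
    by (intro map_cong refl) auto
  then show ?case by (simp del: map_eq_conv)
qed auto

text \<open>The second assumption excludes variable capture.\<close>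

lemma sat_psubst:
  assumes "\<And>c. c \<in> pars \<phi> \<Longrightarrow> eval N e (\<tau> c) = g c"
    and "\<And>c. c \<in> pars \<phi> \<Longrightarrow> fv_trm (\<tau> c) \<inter> bv \<phi> = {}"
  shows "sat N e (psubst \<tau> \<phi>) = sat N e (pmap g \<phi>)"
  using assms
proof (induction \<phi> arbitrary: e)
  case (Eq s t)
  then show ?case using eval_psubst_trm[of s N e \<tau> g] eval_psubst_trm[of t N e \<tau> g] by auto
next
  case (Rel R ts)
  then have "map (eval N e \<circ> psubst_trm \<tau>) ts = map (eval N e \<circ> map_trm (\<lambda>x. x) g) ts"
    by (intro map_cong refl) (auto intro!: eval_psubst_trm)
  then show ?case by (simp del: map_eq_conv)
next
  case (Neg \<phi>)
  show ?case using Neg.IH[of e] Neg.prems by auto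
next
  case (Conj \<phi>1 \<phi>2)
  have "sat N e (psubst \<tau> \<phi>1) = sat N e (pmap g \<phi>1)"
    by (rule Conj.IH(1)) (use Conj.prems in \<open>simp_all add: Int_Un_distrib\<close>)
  moreover have "sat N e (psubst \<tau> \<phi>2) = sat N e (pmap g \<phi>2)"
    by (rule Conj.IH(2)) (use Conj.prems in \<open>simp_all add: Int_Un_distrib\<close>)
  ultimately show ?case by simp
next
  case (Ex i \<phi>)
  have "sat N (e(i := a)) (psubst \<tau> \<phi>) = sat N (e(i := a)) (pmap g \<phi>)" for a
  proof (rule Ex.IH)
    fix c assume c: "c \<in> pars \<phi>"
    have "eval N (e(i := a)) (\<tau> c) = eval N e (\<tau> c)"
      by (rule eval_cong) (use Ex.prems(2)[of c] c in auto)
    then show "eval N (e(i := a)) (\<tau> c) = g c" using Ex.prems(1)[of c] c by simp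
    show "fv_trm (\<tau> c) \<inter> bv \<phi> = {}" using Ex.prems(2)[of c] c by auto
  qed
  then show ?case by simp
qed

lemma fv_psubst_trm: "fv_trm (psubst_trm \<tau> t) \<subseteq> fv_trm t \<union> (\<Union>c\<in>set2_trm t. fv_trm (\<tau> c))"
  by (induction t) fastforce+

lemma fv_psubst: "fv (psubst \<tau> \<phi>) \<subseteq> fv \<phi> \<union> (\<Union>c\<in>pars \<phi>. fv_trm (\<tau> c))"
proof (induction \<phi>)
  case (Eq s t)
  show ?case using fv_psubst_trm[of \<tau> s] fv_psubst_trm[of \<tau> t] by auto
next
  case (Rel R ts)
  show ?case using fv_psubst_trm[of \<tau>] by fastforce
qed auto

lemma wf_psubst_trm:
  "wf_trm L UNIV t \<Longrightarrow> (\<And>c. c \<in> set2_trm t \<Longrightarrow> wf_trm L B (\<tau> c)) \<Longrightarrow> wf_trm L B (psubst_trm \<tau> t)"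
  by (induction t) auto

lemma wf_psubst:
  "wf_fm L UNIV \<phi> \<Longrightarrow> (\<And>c. c \<in> pars \<phi> \<Longrightarrow> wf_trm L B (\<tau> c)) \<Longrightarrow> wf_fm L B (psubst \<tau> \<phi>)"
  by (induction \<phi>) (auto intro: wf_psubst_trm)

section \<open>Instantiating variables by parameters\<close>

lemma eval_inst_trm:
  "eval N e (inst_trm \<sigma> t) = eval N (\<lambda>i. case \<sigma> i of None \<Rightarrow> e i | Some c \<Rightarrow> c) t"
proof (induction t)
  case (Fn f ts)
  then have "map (eval N e \<circ> inst_trm \<sigma>) ts =
      map (eval N (\<lambda>i. case \<sigma> i of None \<Rightarrow> e i | Some c \<Rightarrow> c)) ts"
    by (intro map_cong refl) auto
  then show ?case by (simp del: map_eq_conv)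
qed (auto split: option.splits)

lemma sat_inst:
  "sat N e (inst \<sigma> \<phi>) = sat N (\<lambda>i. case \<sigma> i of None \<Rightarrow> e i | Some c \<Rightarrow> c) \<phi>"
proof (induction \<phi> arbitrary: e \<sigma>)
  case (Ex i \<phi>)
  have "(\<lambda>j. case (\<sigma>(i := None)) j of None \<Rightarrow> (e(i := a)) j | Some c \<Rightarrow> c) =
      (\<lambda>j. case \<sigma> j of None \<Rightarrow> e j | Some c \<Rightarrow> c)(i := a)" for a
    by (auto simp: fun_eq_iff split: option.splits)
  then show ?case using Ex.IH by simp
qed (auto simp: eval_inst_trm o_def)

lemma wf_inst_trm: "wf_trm L B t \<Longrightarrow> ran \<sigma> \<subseteq> B \<Longrightarrow> wf_trm L B (inst_trm \<sigma> t)"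
  by (induction t) (auto split: option.splits simp: ran_def)

lemma wf_inst: "wf_fm L B \<phi> \<Longrightarrow> ran \<sigma> \<subseteq> B \<Longrightarrow> wf_fm L B (inst \<sigma> \<phi>)"
proof (induction \<phi> arbitrary: \<sigma>)
  case (Ex i \<phi>)
  have "ran (\<sigma>(i := None)) \<subseteq> B" using Ex.prems by (auto simp: ran_def)
  then show ?case using Ex by simp
qed (auto intro: wf_inst_trm)

lemma fv_inst_trm: "fv_trm (inst_trm \<sigma> t) = {i\<in>fv_trm t. \<sigma> i = None}"
  by (induction t) (auto split: option.splits)

lemma fv_inst: "fv (inst \<sigma> \<phi>) = {i\<in>fv \<phi>. \<sigma> i = None}"
  by (induction \<phi> arbitrary: \<sigma>) (auto simp: fv_inst_trm)

lemma map_inst_trm: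
  "map_trm (\<lambda>x. x) g (inst_trm \<sigma> t) = inst_trm (\<lambda>i. map_option g (\<sigma> i)) (map_trm (\<lambda>x. x) g t)"
  by (induction t) (auto split: option.splits)

lemma pmap_inst: "pmap g (inst \<sigma> \<phi>) = inst (\<lambda>i. map_option g (\<sigma> i)) (pmap g \<phi>)"
proof (induction \<phi> arbitrary: \<sigma>)
  case (Ex i \<phi>)
  have "(\<lambda>j. map_option g ((\<sigma>(i := None)) j)) = (\<lambda>j. map_option g (\<sigma> j))(i := None)"
    by (auto simp: fun_eq_iff)
  then show ?case using Ex.IH by simp
qed (auto simp: map_inst_trm)

text \<open>The empty conjunction has to be a sentence, so that \<open>conjs\<close> adds no free
  variables; hence the quantifier around the equation.\<close>

primrec conjs :: "('f, 'r, 'a) fm list \<Rightarrow> ('f, 'r, 'a) fm" where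
  "conjs [] = Neg (Ex 0 (Neg (Eq (Var 0) (Var 0))))"
| "conjs (\<phi> # \<phi>s) = Conj \<phi> (conjs \<phi>s)"

lemma sat_conjs [simp]: "sat N e (conjs \<phi>s) \<longleftrightarrow> (\<forall>\<phi>\<in>set \<phi>s. sat N e \<phi>)"
  by (induction \<phi>s) auto

lemma sats_conjs [simp]: "sats N as (conjs \<phi>s) \<longleftrightarrow> (\<forall>\<phi>\<in>set \<phi>s. sats N as \<phi>)"
  by (simp add: sats_def)

lemma fv_conjs: "fv (conjs \<phi>s) = (\<Union>\<phi>\<in>set \<phi>s. fv \<phi>)"
  by (induction \<phi>s) auto

lemma wf_conjs [simp]: "wf_fm L B (conjs \<phi>s) \<longleftrightarrow> (\<forall>\<phi>\<in>set \<phi>s. wf_fm L B \<phi>)"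
  by (induction \<phi>s) auto

lemma forms_conjs: "set \<phi>s \<subseteq> forms L B k \<Longrightarrow> conjs \<phi>s \<in> forms L B k"
  by (fastforce simp: forms_def fv_conjs)

lemma pmap_conjs [simp]: "pmap g (conjs \<phi>s) = conjs (map (pmap g) \<phi>s)"
  by (induction \<phi>s) auto

lemma sats_Neg [simp]: "sats N as (Neg \<phi>) \<longleftrightarrow> \<not> sats N as \<phi>"
  by (simp add: sats_def)

lemma forms_Neg [simp]: "Neg \<phi> \<in> forms L B k \<longleftrightarrow> \<phi> \<in> forms L B k"
  by (simp add: forms_def)

primrec exs :: "nat list \<Rightarrow> ('f, 'r, 'a) fm \<Rightarrow> ('f, 'r, 'a) fm" where
  "exs [] \<phi> = \<phi>"
| "exs (i # is) \<phi> = Ex i (exs is \<phi>)"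

lemma fv_exs [simp]: "fv (exs is \<phi>) = fv \<phi> - set is"
  by (induction "is") auto

lemma wf_exs [simp]: "wf_fm L B (exs is \<phi>) = wf_fm L B \<phi>"
  by (induction "is") auto

text \<open>Quantifying over one assignment that may differ on the whole list makes the order of the
  quantifiers and repetitions in the list irrelevant.\<close>

lemma sat_exs:
  assumes "range e \<subseteq> dom N"
  shows "sat N e (exs is \<phi>) \<longleftrightarrow>
    (\<exists>e'. range e' \<subseteq> dom N \<and> (\<forall>i. i \<notin> set is \<longrightarrow> e' i = e i) \<and> sat N e' \<phi>)"
  using assms
proof (induction "is" arbitrary: e)
  case Nil
  have "(\<forall>i. e' i = e i) \<longleftrightarrow> e' = e" for e' by auto
  with Nil show ?case by auto
next
  case (Cons j js)
  have *: "range (e(j := a)) \<subseteq> dom N" if "a \<in> dom N" for a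
    using that Cons.prems by auto
  show ?case (is "?l \<longleftrightarrow> ?r")
  proof
    assume ?l
    then obtain a where a: "a \<in> dom N" "sat N (e(j := a)) (exs js \<phi>)" by auto
    from Cons.IH[OF *[OF a(1)]] a(2) obtain e' where "range e' \<subseteq> dom N"
      "\<forall>i. i \<notin> set js \<longrightarrow> e' i = (e(j := a)) i" "sat N e' \<phi>" by blast
    then show ?r by (intro exI[of _ e']) auto
  next
    assume ?r
    then obtain e' where e': "range e' \<subseteq> dom N" "\<forall>i. i \<notin> set (j # js) \<longrightarrow> e' i = e i"
      "sat N e' \<phi>" by blast
    have a: "e' j \<in> dom N" using e'(1) by auto
    have "sat N (e(j := e' j)) (exs js \<phi>)"
      unfolding Cons.IH[OF *[OF a]] using e' by (intro exI[of _ e']) auto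
    then show ?l using a by auto
  qed
qed

lemma fresh_variable: "\<exists>v::nat. (\<forall>i\<in>fv \<phi>. i < v) \<and> (\<forall>i\<in>bv \<phi>. i < v)"
  using finite_nat_set_iff_bounded[of "fv \<phi> \<union> bv \<phi>"] by auto

section \<open>Definable predicates\<close>

text \<open>Composite conditions are handled as predicates on assignments; their formulas then come
  from closure properties. Only assignments into \<open>dom N\<close> count, because
  \<open>Ex\<close> ranges over \<open>dom N\<close>.\<close>

definition definable ::
  "('f, 'r) lang \<Rightarrow> ('f, 'r, 'a) struct \<Rightarrow> 'a set \<Rightarrow> ((nat \<Rightarrow> 'a) \<Rightarrow> bool) \<Rightarrow> bool" where
  "definable L N B P \<longleftrightarrow>
     (\<exists>\<phi>. wf_fm L B \<phi> \<and> (\<forall>e. range e \<subseteq> dom N \<longrightarrow> (P e \<longleftrightarrow> sat N e \<phi>)))"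

lemma definable_cong:
  assumes "definable L N B P" "\<And>e. range e \<subseteq> dom N \<Longrightarrow> P e \<longleftrightarrow> Q e"
  shows "definable L N B Q"
  using assms unfolding definable_def by metis

lemma definable_sat: "wf_fm L B \<phi> \<Longrightarrow> definable L N B (\<lambda>e. sat N e \<phi>)"
  unfolding definable_def by blast

lemma definable_conj:
  assumes "definable L N B P" "definable L N B Q"
  shows "definable L N B (\<lambda>e. P e \<and> Q e)"
proof -
  obtain \<phi> \<psi> where "wf_fm L B \<phi>" "\<And>e. range e \<subseteq> dom N \<Longrightarrow> P e \<longleftrightarrow> sat N e \<phi>"
    "wf_fm L B \<psi>" "\<And>e. range e \<subseteq> dom N \<Longrightarrow> Q e \<longleftrightarrow> sat N e \<psi>"
    using assms unfolding definable_def by blast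
  then show ?thesis unfolding definable_def by (intro exI[of _ "Conj \<phi> \<psi>"]) simp
qed

lemma definable_neg:
  assumes "definable L N B P"
  shows "definable L N B (\<lambda>e. \<not> P e)"
proof -
  obtain \<phi> where "wf_fm L B \<phi>" "\<And>e. range e \<subseteq> dom N \<Longrightarrow> P e \<longleftrightarrow> sat N e \<phi>"
    using assms unfolding definable_def by blast
  then show ?thesis unfolding definable_def by (intro exI[of _ "Neg \<phi>"]) simp
qed

lemma definable_Ball:
  assumes "finite I" "\<And>i. i \<in> I \<Longrightarrow> definable L N B (P i)"
  shows "definable L N B (\<lambda>e. \<forall>i\<in>I. P i e)"
  using assms
proof (induction I rule: finite_induct)
  case empty
  show ?case by (rule definable_cong[OF definable_sat[of _ _ "conjs []"]]) simp_all
next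
  case (insert j I)
  show ?case
    by (rule definable_cong[OF definable_conj[of _ _ _ "P j" "\<lambda>e. \<forall>i\<in>I. P i e"]])
      (use insert in simp_all)
qed

lemma definable_exs:
  assumes "definable L N B P" "finite S"
  shows "definable L N B (\<lambda>e. \<exists>e'. range e' \<subseteq> dom N \<and> (\<forall>i. i \<notin> S \<longrightarrow> e' i = e i) \<and> P e')"
proof -
  obtain \<phi> where \<phi>: "wf_fm L B \<phi>" "\<And>e. range e \<subseteq> dom N \<Longrightarrow> P e \<longleftrightarrow> sat N e \<phi>"
    using assms unfolding definable_def by blast
  obtain js where js: "set js = S" using finite_list assms(2) by blast
  show ?thesis
    by (rule definable_cong[OF definable_sat[of _ _ "exs js \<phi>"]])
      (use \<phi> js sat_exs[of _ N js \<phi>] in auto)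
qed

text \<open>The positions in \<open>js\<close> may overlap the indices below \<open>?n\<close>,
  where \<open>\<phi>\<close> reads its arguments, so binding variable \<open>t\<close> directly to
  \<open>js ! t\<close> could overwrite a value still to be read. \<open>F2\<close> therefore copies
  the values to a fresh block from \<open>v\<close> on, and \<open>F1\<close> copies this block to
  the first \<open>?n\<close> variables.\<close>

lemma definable_sats:
  assumes "\<phi> \<in> forms L B (length js)"
  shows "definable L N B (\<lambda>e. sats N (map e js) \<phi>)"
proof -
  let ?n = "length js"
  have wf: "wf_fm L B \<phi>" and fv: "fv \<phi> \<subseteq> {..<?n}" using assms by (auto simp: forms_def)
  obtain v where v: "\<forall>i\<in>set js \<union> {..<?n}. i < (v::nat)"
    using finite_nat_set_iff_bounded[of "set js \<union> {..<?n}"] by auto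
  then have vn: "?n \<le> v" by (metis UnCI lessThan_iff linorder_not_le order_less_irrefl)
  have vj: "js ! t < v" if "t < ?n" for t using v that by auto
  define F1 where
    "F1 = exs [0..<?n] (Conj (conjs (map (\<lambda>t. Eq (Var t) (Var (v + t))) [0..<?n])) \<phi>)"
  define F2 where
    "F2 = exs [v..<v+?n] (Conj (conjs (map (\<lambda>t. Eq (Var (v + t)) (Var (js ! t))) [0..<?n])) F1)"
  have F1: "sat N e F1 \<longleftrightarrow> sats N (map (\<lambda>t. e (v + t)) [0..<?n]) \<phi>" if e: "range e \<subseteq> dom N" for e
  proof
    assume "sat N e F1"
    then obtain e' where e': "\<forall>i. i \<notin> {..<?n} \<longrightarrow> e' i = e i"
      "\<forall>t<?n. e' t = e' (v + t)" "sat N e' \<phi>"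
      unfolding F1_def sat_exs[OF e] by (auto simp: atLeast0LessThan)
    have "e' t = e (v + t)" if "t < ?n" for t using e' vn that by auto
    then show "sats N (map (\<lambda>t. e (v + t)) [0..<?n]) \<phi>"
      using e'(3) fv by (subst sat_sats[symmetric, where e = e']) auto
  next
    assume *: "sats N (map (\<lambda>t. e (v + t)) [0..<?n]) \<phi>"
    define e' where "e' = (\<lambda>i. if i < ?n then e (v + i) else e i)"
    have "sat N e' \<phi>" using * fv by (subst sat_sats[where as = "map (\<lambda>t. e (v + t)) [0..<?n]"])
        (auto simp: e'_def)
    moreover have "range e' \<subseteq> dom N" using e by (auto simp: e'_def)
    ultimately show "sat N e F1" unfolding F1_def sat_exs[OF e]
      by (intro exI[of _ e']) (use vn in \<open>auto simp: e'_def\<close>)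
  qed
  have F2: "sat N e F2 \<longleftrightarrow> sats N (map e js) \<phi>" if e: "range e \<subseteq> dom N" for e
  proof
    assume "sat N e F2"
    then obtain e' where e': "range e' \<subseteq> dom N" "\<forall>i. i \<notin> {v..<v+?n} \<longrightarrow> e' i = e i"
      "\<forall>t<?n. e' (v + t) = e' (js ! t)" "sat N e' F1"
      unfolding F2_def sat_exs[OF e] by (auto simp: atLeast0LessThan)
    have "e' (v + t) = e (js ! t)" if "t < ?n" for t using e' vj[OF that] that by auto
    then have "map (\<lambda>t. e' (v + t)) [0..<?n] = map e js" by (intro nth_equalityI) auto
    then show "sats N (map e js) \<phi>" using e'(4) F1[OF e'(1)] by simp
  next
    assume *: "sats N (map e js) \<phi>"
    define e' where "e' = (\<lambda>i. if v \<le> i \<and> i < v + ?n then e (js ! (i - v)) else e i)"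
    have e': "range e' \<subseteq> dom N" using e by (auto simp: e'_def)
    have "map (\<lambda>t. e' (v + t)) [0..<?n] = map e js"
      by (intro nth_equalityI) (auto simp: e'_def)
    then have "sat N e' F1" using * F1[OF e'] by simp
    moreover have "e' (js ! t) = e (js ! t)" if "t < ?n" for t
      using vj[OF that] by (simp add: e'_def)
    ultimately show "sat N e F2" unfolding F2_def sat_exs[OF e]
      by (intro exI[of _ e'] conjI) (use e' in \<open>auto simp: e'_def\<close>)
  qed
  have "wf_fm L B F2" using wf by (auto simp: F1_def F2_def)
  then show ?thesis using F2 unfolding definable_def by blast
qed

text \<open>The defining formula may have free variables from \<open>k\<close> on. They can be
  quantified existentially, since by \<open>loc\<close> their values do not influence the
  predicate.\<close>

lemma definable_forms:
  assumes "definable L N B P" "dom N \<noteq> {}"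
    and loc: "\<And>e e'. \<lbrakk>range e \<subseteq> dom N; range e' \<subseteq> dom N; \<forall>i<k. e i = e' i\<rbrakk> \<Longrightarrow> P e \<longleftrightarrow> P e'"
  shows "\<exists>\<phi>\<in>forms L B k. \<forall>e. range e \<subseteq> dom N \<longrightarrow> (sat N e \<phi> \<longleftrightarrow> P e)"
proof -
  obtain \<phi> where \<phi>: "wf_fm L B \<phi>" "\<And>e. range e \<subseteq> dom N \<Longrightarrow> P e \<longleftrightarrow> sat N e \<phi>"
    using assms unfolding definable_def by blast
  obtain js where js: "set js = fv \<phi> - {..<k}" using finite_list[of "fv \<phi> - {..<k}"] by auto
  have "exs js \<phi> \<in> forms L B k" using \<phi> js by (auto simp: forms_def)
  moreover have "sat N e (exs js \<phi>) \<longleftrightarrow> P e" if r: "range e \<subseteq> dom N" for e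
  proof
    assume "sat N e (exs js \<phi>)"
    then obtain e' where e': "range e' \<subseteq> dom N" "\<forall>i. i \<notin> set js \<longrightarrow> e' i = e i" "sat N e' \<phi>"
      unfolding sat_exs[OF r] by blast
    then have "P e'" "\<forall>i<k. e' i = e i" using \<phi>(2) js by auto
    then show "P e" using loc[OF e'(1) r] by simp
  next
    assume "P e"
    then show "sat N e (exs js \<phi>)"
      unfolding sat_exs[OF r] using \<phi>(2)[OF r] r by (intro exI[of _ e]) auto
  qed
  ultimately show ?thesis by blast
qed

lemma definable_forms1:
  assumes "definable L N B P" "dom N \<noteq> {}"
    and "\<And>e e'. \<lbrakk>range e \<subseteq> dom N; range e' \<subseteq> dom N; e 0 = e' 0\<rbrakk> \<Longrightarrow> P e \<longleftrightarrow> P e'"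
  shows "\<exists>\<phi>\<in>forms L B 1. \<forall>a\<in>dom N. sats N [a] \<phi> \<longleftrightarrow> P (\<lambda>_. a)"
proof -
  have "\<exists>\<phi>\<in>forms L B 1. \<forall>e. range e \<subseteq> dom N \<longrightarrow> (sat N e \<phi> \<longleftrightarrow> P e)"
    by (rule definable_forms[OF assms(1,2)]) (rule assms(3), auto)
  then obtain \<phi> where \<phi>: "\<phi> \<in> forms L B 1" "\<And>e. range e \<subseteq> dom N \<Longrightarrow> sat N e \<phi> \<longleftrightarrow> P e"
    by blast
  have "sats N [a] \<phi> \<longleftrightarrow> P (\<lambda>_. a)" if a: "a \<in> dom N" for a
    using sat_sats1[of \<phi> N "\<lambda>_. a"] \<phi>(2)[of "\<lambda>_. a"] \<phi>(1) a by (auto simp: forms_def)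
  then show ?thesis using \<phi>(1) by blast
qed

section \<open>Elementary maps\<close>

lemma sats_plug:
  assumes "length xs = k" "fv \<phi> \<subseteq> {..<k + length cs}"
  shows "sats N xs (plug k cs \<phi>) = sats N (xs @ cs) \<phi>"
  unfolding sats_def plug_def sat_inst
  by (rule sat_cong) (use assms in \<open>auto simp: nth_append\<close>)

lemma forms_plug:
  assumes "\<phi> \<in> forms L B (k + length cs)" "set cs \<subseteq> B"
  shows "plug k cs \<phi> \<in> forms L B k"
  using assms unfolding forms_def plug_def
  by (fastforce simp: fv_inst ran_def intro!: wf_inst split: if_splits)

lemma pmap_plug: "pmap f (plug k cs \<phi>) = plug k (map f cs) (pmap f \<phi>)"
  unfolding plug_def pmap_inst by (rule arg_cong2[where f = inst]) (auto simp: fun_eq_iff)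

text \<open>Parameters are traded for additional free variables, whose values are the parameters
  themselves; this brings the formula into the scope of \<open>elem_sub\<close>.\<close>

lemma elem_sub_params:
  assumes "elem_sub L M N" "\<phi> \<in> forms L (dom M) (length as)" "set as \<subseteq> dom M"
  shows "sats M as \<phi> = sats N as \<phi>"
proof -
  obtain d where d: "d \<in> dom M" using assms(1) by (auto simp: elem_sub_def is_struct_def)
  have \<phi>: "wf_fm L UNIV \<phi>" "pars \<phi> \<subseteq> dom M" "fv \<phi> \<subseteq> {..<length as}"
    using assms(2) wf_fm_iff[of L "dom M" \<phi>] by (auto simp: forms_def)
  obtain cs where cs: "set cs = pars \<phi>" using finite_list[of "pars \<phi>"] by auto
  have "\<forall>c\<in>pars \<phi>. \<exists>i<length cs. cs ! i = c" using cs by (metis in_set_conv_nth)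
  then obtain ix where ix: "\<And>c. c \<in> pars \<phi> \<Longrightarrow> ix c < length cs \<and> cs ! ix c = c" by metis
  obtain v where v: "\<And>i. i \<in> bv \<phi> \<Longrightarrow> i < v" using fresh_variable by blast
  define w where "w = v + length as"
  \<comment> \<open>The \<open>v\<close> copies of \<open>d\<close> are padding: they move the
    variables for the parameters to indices from \<open>w\<close> on, above all bound
    variables.\<close>
  define ts where "ts = as @ replicate v d @ cs"
  define \<psi> :: "('a, 'b, 'c) fm" where "\<psi> = psubst (\<lambda>c. Var (w + ix c)) \<phi>"
  have "\<psi> \<in> forms L {} (length ts)"
    unfolding forms_def \<psi>_def
    using fv_psubst[of "\<lambda>c. Var (w + ix c)" \<phi>] \<phi> ix
    by (force intro!: wf_psubst simp: ts_def w_def)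
  moreover have "set ts \<subseteq> dom M" using assms(3) d cs \<phi> by (auto simp: ts_def)
  ultimately have "sats M ts \<psi> = sats N ts \<psi>" using assms(1) unfolding elem_sub_def by blast
  moreover have "sats N' ts \<psi> = sats N' as \<phi>" for N' :: "('a, 'b, 'c) struct"
  proof -
    have "sats N' ts \<psi> = sat N' ((!) ts) (pmap (\<lambda>c. c) \<phi>)"
      unfolding sats_def \<psi>_def
    proof (rule sat_psubst)
      fix c assume c: "c \<in> pars \<phi>"
      show "eval N' ((!) ts) (Var (w + ix c)) = c"
        using ix[OF c] by (simp add: ts_def w_def nth_append)
      show "fv_trm (Var (w + ix c)) \<inter> bv \<phi> = {}" by (auto simp: w_def dest!: v)
    qed
    also have "\<dots> = sats N' as \<phi>"
      by (simp add: fm.map_ident, rule sat_sats) (use \<phi> in \<open>auto simp: ts_def nth_append\<close>)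
    finally show ?thesis .
  qed
  ultimately show ?thesis by simp
qed

text \<open>Sentences with parameters in \<open>D\<close> suffice, because the entries of a tuple
  from \<open>D\<close> can be plugged in as parameters. Outside \<open>D\<close> the function is
  arbitrary.\<close>

definition elem_map ::
  "('f, 'r) lang \<Rightarrow> ('f, 'r, 'a) struct \<Rightarrow> 'a set \<Rightarrow> ('a \<Rightarrow> 'a) \<Rightarrow> bool" where
  "elem_map L N D f \<longleftrightarrow> D \<subseteq> dom N \<and> f ` D \<subseteq> dom N \<and>
     (\<forall>\<phi>\<in>forms L D 0. sats N [] \<phi> \<longleftrightarrow> sats N [] (pmap f \<phi>))"

lemma elem_map_sats:
  assumes "elem_map L N D f" "\<phi> \<in> forms L D (length as)" "set as \<subseteq> D"
  shows "sats N as \<phi> \<longleftrightarrow> sats N (map f as) (pmap f \<phi>)"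
proof -
  have fv: "fv \<phi> \<subseteq> {..<length as}" using assms(2) by (simp add: forms_def)
  have "sats N as \<phi> = sats N [] (plug 0 as \<phi>)"
    using sats_plug[of "[]" 0 \<phi> as N] fv by simp
  also have "\<dots> = sats N [] (pmap f (plug 0 as \<phi>))"
    using assms(1) forms_plug[of \<phi> L D 0 as] assms(2,3) unfolding elem_map_def by simp
  also have "\<dots> = sats N (map f as) (pmap f \<phi>)"
    using sats_plug[of "[]" 0 "pmap f \<phi>" "map f as" N] fv by (simp add: pmap_plug)
  finally show ?thesis .
qed

lemma elem_map_id: "D \<subseteq> dom N \<Longrightarrow> elem_map L N D (\<lambda>x. x)"
  by (simp add: elem_map_def fm.map_ident)

lemma elem_map_inj: "elem_map L N D f \<Longrightarrow> inj_on f D"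
proof (rule inj_onI)
  fix x y assume f: "elem_map L N D f" and xy: "x \<in> D" "y \<in> D" "f x = f y"
  have "sats N [] (Eq (Par x) (Par y)) \<longleftrightarrow> sats N [] (pmap f (Eq (Par x) (Par y)))"
    using f xy unfolding elem_map_def by (force simp: forms_def)
  then show "x = y" using xy by (simp add: sats_def)
qed

lemma elem_map_inv:
  assumes "elem_map L N D f"
  shows "elem_map L N (f ` D) (inv_into D f)"
proof -
  let ?h = "inv_into D f"
  have h: "?h ` f ` D \<subseteq> D" by (auto intro: inv_into_into)
  have "sats N [] \<phi> \<longleftrightarrow> sats N [] (pmap ?h \<phi>)" if \<phi>: "\<phi> \<in> forms L (f ` D) 0" for \<phi>
  proof -
    have "pmap ?h \<phi> \<in> forms L D 0" using forms_mono[OF forms_pmap[OF \<phi>, of ?h] h] by simp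
    moreover have "pmap f (pmap ?h \<phi>) = \<phi>"
      unfolding pmap_pmap using pars_forms[OF \<phi>] by (intro pmap_id) (auto simp: f_inv_into_f)
    ultimately show ?thesis using assms unfolding elem_map_def by metis
  qed
  then show ?thesis using assms h unfolding elem_map_def by blast
qed

lemma saturated_realize:
  assumes "saturated L \<kappa> N" "B \<subseteq> dom N" "|B| <o \<kappa>" "q \<subseteq> forms L B 1"
    and "\<And>F. finite F \<Longrightarrow> F \<subseteq> q \<Longrightarrow> \<exists>a\<in>dom N. \<forall>\<phi>\<in>F. sats N [a] \<phi>"
  shows "\<exists>a\<in>dom N. \<forall>\<phi>\<in>q. sats N [a] \<phi>"
proof -
  have "\<exists>as. length as = 1 \<and> set as \<subseteq> dom N \<and> (\<forall>\<phi>\<in>F. sats N as \<phi>)"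
    if F: "finite F" "F \<subseteq> q" for F
  proof -
    obtain a where "a \<in> dom N" "\<forall>\<phi>\<in>F. sats N [a] \<phi>" using assms(5)[OF F] by blast
    then show ?thesis by (intro exI[of _ "[a]"]) auto
  qed
  then have "one_type L N B q" using assms(4) unfolding one_type_def consistent_in_def by blast
  then show ?thesis using assms unfolding saturated_def realz_def by blast
qed

lemma card_Un_finite:
  assumes "Card_order \<kappa>" "natLeq \<le>o \<kappa>" "|D| <o \<kappa>" "finite E"
  shows "|D \<union> E| <o \<kappa>"
proof -
  have inf: "infinite (Field \<kappa>)"
    using assms(1,2) by (metis cinfinite_def cinfinite_mono natLeq_cinfinite)
  have "|E| <o \<kappa>"
    using assms(2,4) finite_iff_ordLess_natLeq ordLess_ordLeq_trans by blast
  then show ?thesis using card_of_Un_ordLess_infinite_Field[OF inf assms(1,3)] by blast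
qed

text \<open>The image under \<open>f\<close> of the type of \<open>a\<close> over \<open>D\<close>
  is finitely satisfiable in \<open>M\<close>: a finite part of the type amounts to one existential
  sentence over \<open>D\<close>, which \<open>f\<close> preserves and \<open>M\<close> inherits
  from \<open>N\<close>. A realization in \<open>M\<close> is a possible value at
  \<open>a\<close>.\<close>

lemma elem_map_ext:
  fixes N :: "('f, 'r, 'a) struct"
  assumes sub: "elem_sub L M N" and satM: "saturated L \<kappa> M"
    and f: "elem_map L N D f" "f ` D \<subseteq> dom M" and D: "|D| <o \<kappa>" and a: "a \<in> dom N"
  shows "\<exists>g. elem_map L N (insert a D) g \<and> (\<forall>x\<in>D. g x = f x) \<and> g ` insert a D \<subseteq> dom M"
proof (cases "a \<in> D")
  case True
  then show ?thesis using f by (intro exI[of _ f]) (auto simp: insert_absorb)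
next
  case aD: False
  have subM: "dom M \<subseteq> dom N" using sub by (simp add: elem_sub_def)
  define q where "q = {pmap f \<phi> | \<phi>. \<phi> \<in> forms L D 1 \<and> sats N [a] \<phi>}"
  have qf: "q \<subseteq> forms L (f ` D) 1" unfolding q_def using forms_pmap by blast
  have card: "|f ` D| <o \<kappa>" using card_of_image[of f D] D ordLeq_ordLess_trans by blast
  have "\<exists>d\<in>dom M. \<forall>\<phi>\<in>q. sats M [d] \<phi>"
  proof (rule saturated_realize[OF satM f(2) card qf])
    fix F assume F: "finite F" "F \<subseteq> q"
    have "\<forall>\<psi>\<in>F. \<exists>\<phi>. \<phi> \<in> forms L D 1 \<and> sats N [a] \<phi> \<and> pmap f \<phi> = \<psi>"
      using F(2) by (auto simp: q_def)
    then obtain \<Phi> where \<Phi>: "\<And>\<psi>. \<psi> \<in> F \<Longrightarrow>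
        \<Phi> \<psi> \<in> forms L D 1 \<and> sats N [a] (\<Phi> \<psi>) \<and> pmap f (\<Phi> \<psi>) = \<psi>" by metis
    obtain \<psi>s where \<psi>s: "set \<psi>s = F" using F(1) finite_list by blast
    define \<theta> where "\<theta> = conjs (map \<Phi> \<psi>s)"
    have \<theta>: "\<theta> \<in> forms L D 1" unfolding \<theta>_def by (rule forms_conjs) (use \<Phi> \<psi>s in auto)
    have ex: "sats N' [] (Ex 0 \<theta>') \<longleftrightarrow> (\<exists>x\<in>dom N'. sats N' [x] \<theta>')"
      if "\<theta>' \<in> forms L B 1" for N' \<theta>' B
    proof -
      have fv: "fv \<theta>' \<subseteq> {..<1}" using that by (simp add: forms_def)
      show ?thesis unfolding sats_def[of N' "[]"] sat.simps using sat_sats1[OF fv] by simp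
    qed
    have "sats N [] (Ex 0 \<theta>)"
      unfolding ex[OF \<theta>] using a \<Phi> \<psi>s by (auto simp: \<theta>_def)
    moreover have "Ex 0 \<theta> \<in> forms L D 0" using \<theta> by (auto simp: forms_def)
    ultimately have "sats N [] (Ex 0 (pmap f \<theta>))" using f unfolding elem_map_def by auto
    moreover have "pmap f \<theta> \<in> forms L (dom M) 1"
      using forms_mono[OF forms_pmap[OF \<theta>] f(2)] by simp
    moreover from this have "Ex 0 (pmap f \<theta>) \<in> forms L (dom M) 0" by (auto simp: forms_def)
    ultimately have "sats M [] (Ex 0 (pmap f \<theta>))"
      using elem_sub_params[OF sub, of "Ex 0 (pmap f \<theta>)" "[]"] by simp
    then obtain x where "x \<in> dom M" "sats M [x] (pmap f \<theta>)"
      using ex[OF \<open>pmap f \<theta> \<in> _\<close>] by blast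
    then show "\<exists>a\<in>dom M. \<forall>\<phi>\<in>F. sats M [a] \<phi>"
      using \<Phi> \<psi>s by (auto simp: \<theta>_def intro!: bexI[of _ x])
  qed
  then obtain d where d: "d \<in> dom M" and dq: "\<And>\<phi>. \<phi> \<in> q \<Longrightarrow> sats M [d] \<phi>" by blast
  have tp: "sats N [d] (pmap f \<phi>)" if "\<phi> \<in> forms L D 1" "sats N [a] \<phi>" for \<phi>
  proof -
    have "pmap f \<phi> \<in> q" using that by (auto simp: q_def)
    moreover have "pmap f \<phi> \<in> forms L (dom M) 1"
      using forms_mono[OF forms_pmap[OF that(1)] f(2)] by simp
    ultimately show ?thesis using dq elem_sub_params[OF sub, of "pmap f \<phi>" "[d]"] d by simp
  qed
  define g where "g = f(a := d)"
  have gD: "g ` insert a D \<subseteq> dom M" using f(2) d aD by (auto simp: g_def)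
  have imp: "sats N [] (pmap g \<phi>)" if \<phi>: "\<phi> \<in> forms L (insert a D) 0" and s: "sats N [] \<phi>" for \<phi>
  proof -
    obtain v0 where v0: "\<And>i. i \<in> bv \<phi> \<Longrightarrow> i < v0" using fresh_variable by blast
    define v where "v = Suc v0"
    define \<tau> :: "'a \<Rightarrow> ('f, 'a) trm" where "\<tau> = (\<lambda>c. if c = a then Var v else Par c)"
    \<comment> \<open>Variable 0 put in place of \<open>a\<close> could be captured inside
      \<open>\<phi>\<close>. Instead \<open>v\<close>, which lies above all bound variables and
      differs from 0 by the \<open>Suc\<close>, replaces \<open>a\<close> and is equated with
      variable 0 outside.\<close>
    define \<phi>1 where "\<phi>1 = Ex v (Conj (Eq (Var 0) (Var v)) (psubst \<tau> \<phi>))"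
    have \<phi>': "wf_fm L UNIV \<phi>" "fv \<phi> = {}" "pars \<phi> \<subseteq> insert a D"
      using \<phi> wf_fm_iff[of L "insert a D" \<phi>] by (auto simp: forms_def)
    have fvp: "fv (psubst \<tau> \<phi>) \<subseteq> {v}" using fv_psubst[of \<tau> \<phi>] \<phi>'(2) by (auto simp: \<tau>_def split: if_splits)
    have "wf_fm L D (psubst \<tau> \<phi>)" by (rule wf_psubst) (use \<phi>' in \<open>auto simp: \<tau>_def\<close>)
    then have f1: "\<phi>1 \<in> forms L D 1" using fvp by (auto simp: \<phi>1_def forms_def)
    have key: "sats N [x] (pmap h \<phi>1) \<longleftrightarrow> sats N [] (pmap (h(a := x)) \<phi>)"
      if x: "x \<in> dom N" for x h
    proof -
      have pm: "pmap h (psubst \<tau> \<phi>) = psubst (\<lambda>c. if c = a then Var v else Par (h c)) \<phi>"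
      proof -
        have "map_trm (\<lambda>x. x) h (psubst_trm \<tau> t) = psubst_trm (\<lambda>c. if c = a then Var v else Par (h c)) t"
          for t by (induction t) (auto simp: \<tau>_def)
        then show ?thesis by (induction \<phi>) auto
      qed
      have "sats N [x] (pmap h \<phi>1) \<longleftrightarrow> sat N (((!) [x])(v := x)) (pmap h (psubst \<tau> \<phi>))"
        using x by (auto simp: sats_def \<phi>1_def v_def)
      also have "\<dots> \<longleftrightarrow> sat N (((!) [x])(v := x)) (pmap (h(a := x)) \<phi>)"
        unfolding pm
      proof (rule sat_psubst)
        fix c
        show "fv_trm (if c = a then Var v else Par (h c)) \<inter> bv \<phi> = {}"
          by (auto simp: v_def dest!: v0)
      qed auto
      also have "\<dots> \<longleftrightarrow> sats N [] (pmap (h(a := x)) \<phi>)"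
        by (rule sat_sentence) (simp add: \<phi>')
      finally show ?thesis .
    qed
    have "sats N [a] \<phi>1"
      using s unfolding key[OF a, of "\<lambda>x. x", unfolded fm.map_ident]
      by (subst pmap_id) auto
    then have "sats N [d] (pmap f \<phi>1)" using tp f1 by blast
    then show ?thesis using key[of d f] d subM by (auto simp: g_def)
  qed
  have "sats N [] \<phi> \<longleftrightarrow> sats N [] (pmap g \<phi>)" if \<phi>: "\<phi> \<in> forms L (insert a D) 0" for \<phi>
    using imp[of \<phi>] imp[of "Neg \<phi>"] \<phi> by auto
  then have "elem_map L N (insert a D) g"
    using f gD a subM unfolding elem_map_def by auto
  then show ?thesis using gD aD by (intro exI[of _ g]) (auto simp: g_def)
qed

lemma elem_map_ext_finite:
  assumes "elem_sub L M N" "saturated L \<kappa> M" "Card_order \<kappa>" "natLeq \<le>o \<kappa>"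
    and "elem_map L N D f" "f ` D \<subseteq> dom M" "|D| <o \<kappa>" and "finite E" "E \<subseteq> dom N"
  shows "\<exists>g. elem_map L N (D \<union> E) g \<and> (\<forall>x\<in>D. g x = f x) \<and> g ` (D \<union> E) \<subseteq> dom M"
  using assms(8,9)
proof (induction E rule: finite_induct)
  case empty
  then show ?case using assms by (intro exI[of _ f]) auto
next
  case (insert a E)
  then obtain g where g: "elem_map L N (D \<union> E) g" "\<forall>x\<in>D. g x = f x" "g ` (D \<union> E) \<subseteq> dom M" by auto
  have "|D \<union> E| <o \<kappa>" using card_Un_finite assms insert by blast
  from elem_map_ext[OF assms(1,2) g(1,3) this, of a] insert.prems g(2) obtain h where
    "elem_map L N (insert a (D \<union> E)) h" "\<forall>x\<in>D \<union> E. h x = g x" "h ` insert a (D \<union> E) \<subseteq> dom M"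
    by auto
  then show ?case using g(2) by (intro exI[of _ h]) auto
qed

section \<open>Bounded subgroups\<close>

text \<open>Here \<open>A\<close> is a set over which \<open>p\<close> and the group operations are
  defined. A partial elementary map fixing \<open>A\<close> pointwise respects \<open>G\<close> and
  its operations. The set is finally instantiated with the parameters that actually occur, so that
  it has fewer than \<open>\<kappa>\<close> elements.\<close>

locale definable_group = group G for G :: "'a monoid" (structure) +
  fixes L :: "('f, 'r) lang" and N :: "('f, 'r, 'a) struct" and \<kappa>b :: "'kb rel"
    and A :: "'a set" and p :: "('f, 'r, 'a) fm set"
    and \<mu> \<iota> \<epsilon> :: "('f, 'r, 'a) fm"
  assumes is_struct: "is_struct L N"
    and saturated: "saturated L \<kappa>b N"
    and inaccessible: "strongly_inaccessible \<kappa>b"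
    and A: "A \<subseteq> dom N" "|A| <o \<kappa>b"
    and p: "p \<subseteq> forms L A 1"
    and carrier: "carrier G = realz N p"
    and \<mu>: "\<mu> \<in> forms L A 3"
      "\<And>x y z. \<lbrakk>x \<in> carrier G; y \<in> carrier G; z \<in> dom N\<rbrakk> \<Longrightarrow>
         sats N [x, y, z] \<mu> \<longleftrightarrow> z = x \<otimes> y"
    and \<iota>: "\<iota> \<in> forms L A 2"
      "\<And>x y. \<lbrakk>x \<in> carrier G; y \<in> dom N\<rbrakk> \<Longrightarrow> sats N [x, y] \<iota> \<longleftrightarrow> y = inv x"
    and \<epsilon>: "\<epsilon> \<in> forms L A 1" "\<And>x. x \<in> dom N \<Longrightarrow> sats N [x] \<epsilon> \<longleftrightarrow> x = \<one>"
begin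

lemma card_order: "Card_order \<kappa>b" and natLeq_le: "natLeq \<le>o \<kappa>b" and natLeq_less: "natLeq <o \<kappa>b"
  using inaccessible by (auto simp: strongly_inaccessible_def ordLess_imp_ordLeq)

lemma dom_nonempty: "dom N \<noteq> {}"
  using is_struct by (simp add: is_struct_def)

lemma elem_sub_refl: "elem_sub L N N"
  using is_struct by (simp add: elem_sub_def)

lemma carrier_dom: "x \<in> carrier G \<Longrightarrow> x \<in> dom N"
  by (simp add: carrier realz_def)

section \<open>Traces of formulas on the group, and their behaviour under elementary maps\<close>

definition W :: "('f, 'r, 'a) fm \<Rightarrow> 'a set" where
  "W \<phi> = {x \<in> carrier G. sats N [x] \<phi>}"

lemma W_carrier: "x \<in> W \<phi> \<Longrightarrow> x \<in> carrier G"
  by (simp add: W_def)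

lemma G_of_W: "G_of N G q = {x \<in> carrier G. \<forall>\<phi>\<in>q. x \<in> W \<phi>}"
  by (auto simp: G_of_def W_def)

lemma extend:
  assumes "elem_map L N D f" "|D| <o \<kappa>b" "finite E" "E \<subseteq> dom N"
  obtains g where "elem_map L N (D \<union> E) g" "\<And>x. x \<in> D \<Longrightarrow> g x = f x"
proof -
  have "f ` D \<subseteq> dom N" using assms(1) by (simp add: elem_map_def)
  from elem_map_ext_finite[OF elem_sub_refl saturated card_order natLeq_le assms(1) this assms(2-4)]
  show ?thesis using that by blast
qed

lemma elem_map_W:
  assumes f: "elem_map L N D f" "A \<subseteq> D" "\<And>a. a \<in> A \<Longrightarrow> f a = a"
    and x: "x \<in> D"
  shows "x \<in> carrier G \<longleftrightarrow> f x \<in> carrier G"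
    and "\<phi> \<in> forms L D 1 \<Longrightarrow> x \<in> W \<phi> \<longleftrightarrow> f x \<in> W (pmap f \<phi>)"
proof -
  have s: "sats N [x] \<phi> \<longleftrightarrow> sats N [f x] (pmap f \<phi>)" if "\<phi> \<in> forms L D 1" for \<phi>
    using elem_map_sats[OF f(1), of \<phi> "[x]"] x that by simp
  have "sats N [x] \<phi> \<longleftrightarrow> sats N [f x] \<phi>" if "\<phi> \<in> p" for \<phi>
  proof -
    have \<phi>: "\<phi> \<in> forms L A 1" using that p by auto
    have "pmap f \<phi> = \<phi>" using pars_forms[OF \<phi>] f(3) by (intro pmap_id) auto
    then show ?thesis using s forms_mono[OF \<phi> f(2)] by simp
  qed
  moreover have "x \<in> dom N" "f x \<in> dom N" using f(1) x by (auto simp: elem_map_def)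
  ultimately show c: "x \<in> carrier G \<longleftrightarrow> f x \<in> carrier G"
    by (simp add: carrier realz_def)
  show "x \<in> W \<phi> \<longleftrightarrow> f x \<in> W (pmap f \<phi>)" if "\<phi> \<in> forms L D 1"
    using c s[OF that] by (simp add: W_def)
qed

lemma elem_map_mult:
  assumes f: "elem_map L N D f" "A \<subseteq> D" "\<And>a. a \<in> A \<Longrightarrow> f a = a"
    and x: "x \<in> D" "x \<in> carrier G"
  shows "y \<in> D \<Longrightarrow> y \<in> carrier G \<Longrightarrow> x \<otimes> y \<in> D \<Longrightarrow> f (x \<otimes> y) = f x \<otimes> f y"
    and "inv x \<in> D \<Longrightarrow> f (inv x) = inv (f x)"
    and "\<one> \<in> D \<Longrightarrow> f \<one> = \<one>"
proof -
  have fixed: "pmap f \<phi> = \<phi>" if "\<phi> \<in> forms L A k" for \<phi> k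
    using pars_forms[OF that] f(3) by (intro pmap_id) auto
  have fx: "f x \<in> carrier G" using elem_map_W(1)[OF f x(1)] x(2) by simp
  have fD: "f z \<in> dom N" if "z \<in> D" for z using that f(1) by (auto simp: elem_map_def)
  show "f (x \<otimes> y) = f x \<otimes> f y" if y: "y \<in> D" "y \<in> carrier G" "x \<otimes> y \<in> D"
  proof -
    have fy: "f y \<in> carrier G" using elem_map_W(1)[OF f y(1)] y(2) by simp
    have "sats N [x, y, x \<otimes> y] \<mu>" using \<mu>(2) x y carrier_dom by simp
    then have "sats N [f x, f y, f (x \<otimes> y)] \<mu>"
      using elem_map_sats[OF f(1), of \<mu> "[x, y, x \<otimes> y]"] x y forms_mono[OF \<mu>(1) f(2)] fixed[OF \<mu>(1)]
      by (simp add: numeral_3_eq_3)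
    then show ?thesis using \<mu>(2)[OF fx fy fD[OF y(3)]] by simp
  qed
  show "f (inv x) = inv (f x)" if y: "inv x \<in> D"
  proof -
    have "sats N [x, inv x] \<iota>" using \<iota>(2) x carrier_dom by simp
    then have "sats N [f x, f (inv x)] \<iota>"
      using elem_map_sats[OF f(1), of \<iota> "[x, inv x]"] x y forms_mono[OF \<iota>(1) f(2)] fixed[OF \<iota>(1)]
      by (simp add: numeral_2_eq_2)
    then show ?thesis using \<iota>(2)[OF fx fD[OF y]] by simp
  qed
  show "f \<one> = \<one>" if y: "\<one> \<in> D"
  proof -
    have "sats N [\<one>] \<epsilon>" using \<epsilon>(2) carrier_dom by simp
    then have "sats N [f \<one>] \<epsilon>"
      using elem_map_sats[OF f(1), of \<epsilon> "[\<one>]"] y forms_mono[OF \<epsilon>(1) f(2)] fixed[OF \<epsilon>(1)] by simp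
    then show ?thesis using \<epsilon>(2)[OF fD[OF y]] by simp
  qed
qed

text \<open>The quotient need not belong to \<open>D\<close>. It is adjoined to the domain by
  \<open>extend\<close>, and the extension computes it correctly because the operations are
  definable over the fixed set \<open>A\<close>.\<close>

lemma elem_map_quotient:
  assumes f: "elem_map L N D f" "A \<subseteq> D" "\<And>a. a \<in> A \<Longrightarrow> f a = a" and D: "|D| <o \<kappa>b"
    and x: "x \<in> D" "x \<in> carrier G" and y: "y \<in> D" "y \<in> carrier G" and \<phi>: "\<phi> \<in> forms L D 1"
  shows "x \<otimes> inv y \<in> W \<phi> \<longleftrightarrow> f x \<otimes> inv (f y) \<in> W (pmap f \<phi>)"
proof -
  have E: "{inv y, x \<otimes> inv y} \<subseteq> dom N" using x y carrier_dom by simp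
  obtain g where g: "elem_map L N (D \<union> {inv y, x \<otimes> inv y}) g" "\<And>x. x \<in> D \<Longrightarrow> g x = f x"
    using extend[OF f(1) D _ E] by blast
  let ?D = "D \<union> {inv y, x \<otimes> inv y}"
  have gA: "A \<subseteq> ?D" "\<And>a. a \<in> A \<Longrightarrow> g a = a" using f g by auto
  note m = elem_map_mult[OF g(1) gA] elem_map_W[OF g(1) gA]
  have "g (x \<otimes> inv y) = f x \<otimes> inv (f y)"
    using m(1)[of x "inv y"] m(2)[of y] x y g(2) by simp
  moreover have "pmap g \<phi> = pmap f \<phi>" using pars_forms[OF \<phi>] g(2) by (intro pmap_cong) auto
  ultimately show ?thesis using m(5)[of "x \<otimes> inv y" \<phi>] forms_mono[OF \<phi>, of ?D 1] by auto
qed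

section \<open>Compactness arguments for bounded subgroups\<close>

lemma quotient_formula:
  assumes \<phi>: "\<phi> \<in> forms L B 1" and B: "A \<subseteq> B"
  shows "\<exists>\<chi>\<in>forms L B 2. \<forall>x\<in>carrier G. \<forall>y\<in>carrier G. sats N [x, y] \<chi> \<longleftrightarrow> x \<otimes> inv y \<in> W \<phi>"
proof -
  \<comment> \<open>Position 2 holds the inverse of the value at 1, and position 3 the product of
    the values at 0 and 2. For values in \<open>G\<close> the formulas \<open>\<iota>\<close> and
    \<open>\<mu>\<close> force this.\<close>
  define P where "P = (\<lambda>e :: nat \<Rightarrow> 'a. \<exists>e'. range e' \<subseteq> dom N \<and> (\<forall>i. i \<notin> {2, 3} \<longrightarrow> e' i = e i) \<and>
      sats N (map e' [1, 2]) \<iota> \<and> sats N (map e' [0, 2, 3]) \<mu> \<and> sats N (map e' [3]) \<phi>)"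
  have \<iota>': "\<iota> \<in> forms L B (length [1::nat, 2])" using forms_mono[OF \<iota>(1) B] by simp
  have \<mu>': "\<mu> \<in> forms L B (length [0::nat, 2, 3])" using forms_mono[OF \<mu>(1) B] by simp
  have "definable L N B P"
    unfolding P_def
    using definable_exs[OF definable_conj[OF definable_sats[OF \<iota>']
        definable_conj[OF definable_sats[OF \<mu>'] definable_sats[of \<phi> _ _ "[3]"]]], of "{2, 3}"] \<phi>
    by simp
  moreover have "P e \<longleftrightarrow> P e'" if "range e \<subseteq> dom N" "range e' \<subseteq> dom N" "\<forall>i<2. e i = e' i" for e e'
  proof -
    have "P e2" if "P e1" "range e2 \<subseteq> dom N" "\<forall>i<2. e1 i = e2 i" for e1 e2
    proof -
      obtain e' where e': "range e' \<subseteq> dom N" "\<forall>i. i \<notin> {2, 3} \<longrightarrow> e' i = e1 i"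
        "sats N (map e' [1, 2]) \<iota>" "sats N (map e' [0, 2, 3]) \<mu>" "sats N (map e' [3]) \<phi>"
        using \<open>P e1\<close> unfolding P_def by blast
      define e'' where "e'' = e2 (2 := e' 2, 3 := e' 3)"
      have "range e'' \<subseteq> dom N" using e'(1) that(2) by (auto simp: e''_def)
      moreover have "e'' 0 = e' 0" "e'' 1 = e' 1" using e'(2) that(3) by (auto simp: e''_def)
      ultimately show ?thesis unfolding P_def
        using e' by (intro exI[of _ e'']) (auto simp: e''_def)
    qed
    from this[of e e'] this[of e' e] show ?thesis using that by auto
  qed
  ultimately obtain \<chi> where \<chi>: "\<chi> \<in> forms L B 2"
    "\<And>e. range e \<subseteq> dom N \<Longrightarrow> sat N e \<chi> \<longleftrightarrow> P e"
    using definable_forms[of L N B P 2] dom_nonempty by blast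
  have "sats N [x, y] \<chi> \<longleftrightarrow> x \<otimes> inv y \<in> W \<phi>" if xy: "x \<in> carrier G" "y \<in> carrier G" for x y
  proof -
    define e where "e = (\<lambda>i::nat. if i = 0 then x else y)"
    have e: "range e \<subseteq> dom N" using xy carrier_dom by (auto simp: e_def)
    have "sats N [x, y] \<chi> \<longleftrightarrow> sat N e \<chi>"
        using \<chi>(1) by (intro sat_sats[symmetric])
        (auto simp: forms_def e_def less_Suc_eq numeral_2_eq_2)
    also have "\<dots> \<longleftrightarrow> P e" by (rule \<chi>(2)[OF e])
    also have "\<dots> \<longleftrightarrow> x \<otimes> inv y \<in> W \<phi>"
    proof
      assume "P e"
      then obtain e' where e': "range e' \<subseteq> dom N" "\<forall>i. i \<notin> {2, 3} \<longrightarrow> e' i = e i"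
        "sats N (map e' [1, 2]) \<iota>" "sats N (map e' [0, 2, 3]) \<mu>" "sats N (map e' [3]) \<phi>"
        unfolding P_def by blast
      have d: "e' i \<in> dom N" for i using e'(1) by auto
      have "e' 0 = x" "e' 1 = y" using e'(2) by (auto simp: e_def)
      then have "e' 2 = inv y" "e' 3 = x \<otimes> inv y"
        using e'(3,4) \<iota>(2)[OF xy(2) d[of 2]] \<mu>(2)[OF xy(1) _ d[of 3], of "e' 2"] xy by auto
      then show "x \<otimes> inv y \<in> W \<phi>" using e'(5) xy by (simp add: W_def)
    next
      assume *: "x \<otimes> inv y \<in> W \<phi>"
      define e' where "e' = e (2 := inv y, 3 := x \<otimes> inv y)"
      have "range e' \<subseteq> dom N" using e xy carrier_dom by (auto simp: e'_def)
      moreover have "e' 0 = x" "e' 1 = y" "e' 2 = inv y" "e' 3 = x \<otimes> inv y"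
        by (auto simp: e'_def e_def)
      ultimately show "P e" unfolding P_def
        using * xy carrier_dom \<iota>(2) \<mu>(2) by (intro exI[of _ e']) (auto simp: e'_def W_def)
    qed
    finally show ?thesis .
  qed
  then show ?thesis using \<chi>(1) by blast
qed

text \<open>The sets covering \<open>G\<close> are the right translates of \<open>W \<phi>\<close>
  by the \<open>g t\<close>. Their number is kept explicit because it later bounds a number of
  colours.\<close>

definition covered :: "('f, 'r, 'a) fm \<Rightarrow> nat \<Rightarrow> bool" where
  "covered \<phi> k \<longleftrightarrow>
     (\<exists>g. (\<forall>t<k. g t \<in> carrier G) \<and> (\<forall>x\<in>carrier G. \<exists>t<k. x \<otimes> inv (g t) \<in> W \<phi>))"

lemma W_quotient_exists:
  assumes B: "A \<subseteq> B" "B \<subseteq> dom N" "|B| <o \<kappa>b" and q: "q \<subseteq> forms L B 1"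
    and sub: "subgroup (G_of N G q) G" and \<phi>: "\<phi> \<in> forms L B 1" "G_of N G q \<subseteq> W \<phi>"
  shows "\<exists>\<psi>\<in>forms L B 1. G_of N G q \<subseteq> W \<psi> \<and> (\<forall>x\<in>W \<psi>. \<forall>y\<in>W \<psi>. x \<otimes> inv y \<in> W \<phi>)"
proof (rule ccontr)
  let ?H = "G_of N G q"
  define \<Theta> where "\<Theta> = {\<theta> \<in> forms L B 1. ?H \<subseteq> W \<theta>}"
  assume "\<not> ?thesis"
  then have neg: "\<exists>x\<in>W \<theta>. \<exists>y\<in>W \<theta>. x \<otimes> inv y \<notin> W \<phi>" if "\<theta> \<in> \<Theta>" for \<theta>
    using that unfolding \<Theta>_def by blast
  have Hc: "?H \<subseteq> carrier G" by (auto simp: G_of_def)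
  have \<Theta>q: "q \<subseteq> \<Theta>" using q by (auto simp: \<Theta>_def G_of_W)
  have \<Theta>p: "p \<subseteq> \<Theta>"
    using p forms_mono[of _ L A 1 B 1] B(1) Hc by (auto simp: \<Theta>_def W_def carrier realz_def)
  have \<Theta>H: "x \<in> ?H" if "x \<in> dom N" "\<And>\<theta>. \<theta> \<in> \<Theta> \<Longrightarrow> sats N [x] \<theta>" for x
    using that \<Theta>q \<Theta>p by (auto simp: G_of_def carrier realz_def)
  have \<Theta>conj: "\<exists>\<theta>\<in>\<Theta>. \<forall>x. sats N [x] \<theta> \<longleftrightarrow> (\<forall>\<theta>'\<in>F. sats N [x] \<theta>')" if F: "finite F" "F \<subseteq> \<Theta>" for F
  proof -
    obtain Fs where Fs: "set Fs = F" using finite_list[OF F(1)] by blast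
    have "conjs Fs \<in> \<Theta>"
      using F(2) Fs Hc forms_conjs[of Fs L B 1] by (auto simp: \<Theta>_def W_def)
    then show ?thesis using Fs by (intro bexI[of _ "conjs Fs"]) auto
  qed
  obtain \<chi> where \<chi>: "\<chi> \<in> forms L B 2"
    "\<And>x y. \<lbrakk>x \<in> carrier G; y \<in> carrier G\<rbrakk> \<Longrightarrow> sats N [x, y] \<chi> \<longleftrightarrow> x \<otimes> inv y \<in> W \<phi>"
    using quotient_formula[OF \<phi>(1) B(1)] by blast
  \<comment> \<open>The projection to the second coordinate: \<open>y\<close> has a partner within
    \<open>\<theta>\<close> whose quotient with it is bad. It is definable over \<open>B\<close>, so
    \<open>y\<close> can be chosen before \<open>x\<close>.\<close>
  define P where "P = (\<lambda>\<theta> y. sats N [y] \<theta> \<and> (\<exists>x\<in>dom N. sats N [x] \<theta> \<and> \<not> sats N [x, y] \<chi>))"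
  have "\<exists>\<gamma>\<in>forms L B 1. \<forall>y\<in>dom N. sats N [y] \<gamma> \<longleftrightarrow> P \<theta> y" if \<theta>: "\<theta> \<in> \<Theta>" for \<theta>
  proof -
    have \<theta>f: "\<theta> \<in> forms L B 1" using \<theta> by (simp add: \<Theta>_def)
    have d1: "definable L N B (\<lambda>e. sats N (map e [1]) \<theta>)"
      by (rule definable_sats) (use \<theta>f in simp)
    have d2: "definable L N B (\<lambda>e. \<not> sats N (map e [1, 0]) \<chi>)"
      by (rule definable_neg, rule definable_sats) (use \<chi>(1) in \<open>simp add: numeral_2_eq_2\<close>)
    have d3: "definable L N B (\<lambda>e. sats N (map e [0]) \<theta>)"
      by (rule definable_sats) (use \<theta>f in simp)
    have "definable L N B (\<lambda>e. P \<theta> (e 0))"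
    proof (rule definable_cong[OF definable_conj[OF d3 definable_exs[OF definable_conj[OF d1 d2], of "{1}"]]])
      fix e :: "nat \<Rightarrow> 'a" assume e: "range e \<subseteq> dom N"
      have "(\<exists>e'. range e' \<subseteq> dom N \<and> (\<forall>i. i \<notin> {1} \<longrightarrow> e' i = e i) \<and>
          sats N (map e' [1]) \<theta> \<and> \<not> sats N (map e' [1, 0]) \<chi>) \<longleftrightarrow>
        (\<exists>x\<in>dom N. sats N [x] \<theta> \<and> \<not> sats N [x, e 0] \<chi>)" (is "?l \<longleftrightarrow> ?r")
      proof
        assume ?l
        then obtain e' where "range e' \<subseteq> dom N" "\<forall>i. i \<notin> {1} \<longrightarrow> e' i = e i"
          "sats N (map e' [1]) \<theta>" "\<not> sats N (map e' [1, 0]) \<chi>" by blast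
        then show ?r by (intro bexI[of _ "e' 1"]) auto
      next
        assume ?r
        then obtain x where "x \<in> dom N" "sats N [x] \<theta>" "\<not> sats N [x, e 0] \<chi>" by blast
        then show ?l using e by (intro exI[of _ "e(1 := x)"]) auto
      qed
      then show "(sats N (map e [0]) \<theta> \<and> (\<exists>e'. range e' \<subseteq> dom N \<and> (\<forall>i. i \<notin> {1} \<longrightarrow> e' i = e i) \<and>
          sats N (map e' [1]) \<theta> \<and> \<not> sats N (map e' [1, 0]) \<chi>)) \<longleftrightarrow> P \<theta> (e 0)"
        by (simp add: P_def)
    qed simp
    then have "\<exists>\<gamma>\<in>forms L B 1. \<forall>y\<in>dom N. sats N [y] \<gamma> \<longleftrightarrow> P \<theta> ((\<lambda>_. y) (0::nat))"
      by (rule definable_forms1) (use dom_nonempty in auto)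
    then show ?thesis by simp
  qed
  then obtain \<gamma> where \<gamma>: "\<And>\<theta>. \<theta> \<in> \<Theta> \<Longrightarrow> \<gamma> \<theta> \<in> forms L B 1"
    "\<And>\<theta> y. \<lbrakk>\<theta> \<in> \<Theta>; y \<in> dom N\<rbrakk> \<Longrightarrow> sats N [y] (\<gamma> \<theta>) \<longleftrightarrow> P \<theta> y" by metis
  have "\<exists>y\<in>dom N. \<forall>\<theta>\<in>\<gamma> ` \<Theta>. sats N [y] \<theta>"
  proof (rule saturated_realize[OF saturated B(2,3)])
    show "\<gamma> ` \<Theta> \<subseteq> forms L B 1" using \<gamma>(1) by auto
    fix F assume "finite F" "F \<subseteq> \<gamma> ` \<Theta>"
    then obtain F' where F': "finite F'" "F' \<subseteq> \<Theta>" "F = \<gamma> ` F'" using finite_subset_image by metis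
    obtain \<theta> where \<theta>: "\<theta> \<in> \<Theta>" "\<forall>x. sats N [x] \<theta> \<longleftrightarrow> (\<forall>\<theta>'\<in>F'. sats N [x] \<theta>')"
      using \<Theta>conj[OF F'(1,2)] by blast
    obtain x y where xy: "x \<in> W \<theta>" "y \<in> W \<theta>" "x \<otimes> inv y \<notin> W \<phi>" using neg[OF \<theta>(1)] by blast
    have "y \<in> dom N" using xy carrier_dom by (auto simp: W_def)
    moreover have "P \<theta>' y" if "\<theta>' \<in> F'" for \<theta>'
      unfolding P_def using xy \<theta>(2) that \<chi>(2)[of x y] carrier_dom by (auto simp: W_def)
    ultimately show "\<exists>a\<in>dom N. \<forall>\<phi>\<in>F. sats N [a] \<phi>"
      using \<gamma>(2) F' by (intro bexI[of _ y]) auto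
  qed
  then obtain y where y: "y \<in> dom N" "\<And>\<theta>. \<theta> \<in> \<Theta> \<Longrightarrow> P \<theta> y" using \<gamma>(2) by auto
  have yH: "y \<in> ?H" by (rule \<Theta>H[OF y(1)]) (use y(2) in \<open>auto simp: P_def\<close>)
  let ?\<delta> = "Neg (plug 1 [y] \<chi>)"
  have sat\<delta>: "sats N [x] (plug 1 [y] \<chi>) = sats N [x, y] \<chi>" for x
    using sats_plug[of "[x]" 1 \<chi> "[y]" N] \<chi>(1) by (auto simp: forms_def numeral_2_eq_2)
  have "\<exists>x\<in>dom N. \<forall>\<theta>\<in>insert ?\<delta> \<Theta>. sats N [x] \<theta>"
  proof (rule saturated_realize[OF saturated])
    show "B \<union> {y} \<subseteq> dom N" using B y by auto
    show "|B \<union> {y}| <o \<kappa>b" by (rule card_Un_finite[OF card_order natLeq_le B(3)]) simp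
    have "\<chi> \<in> forms L (B \<union> {y}) (1 + length [y])"
      using forms_mono[OF \<chi>(1), of "B \<union> {y}" 2] by (auto simp: numeral_2_eq_2)
    then have "plug 1 [y] \<chi> \<in> forms L (B \<union> {y}) 1" by (rule forms_plug) simp
    moreover have "\<Theta> \<subseteq> forms L (B \<union> {y}) 1" using forms_mono[of _ L B 1 "B \<union> {y}" 1] by (auto simp: \<Theta>_def)
    ultimately show "insert ?\<delta> \<Theta> \<subseteq> forms L (B \<union> {y}) 1" by simp
    fix F assume F: "finite F" "F \<subseteq> insert ?\<delta> \<Theta>"
    obtain \<theta> where \<theta>: "\<theta> \<in> \<Theta>" "\<forall>x. sats N [x] \<theta> \<longleftrightarrow> (\<forall>\<theta>'\<in>F - {?\<delta>}. sats N [x] \<theta>')"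
      using \<Theta>conj[of "F - {?\<delta>}"] F by blast
    obtain x where x: "x \<in> dom N" "sats N [x] \<theta>" "\<not> sats N [x, y] \<chi>"
      using y(2)[OF \<theta>(1)] by (auto simp: P_def)
    then show "\<exists>a\<in>dom N. \<forall>\<phi>\<in>F. sats N [a] \<phi>"
      using \<theta>(2) sat\<delta> by (intro bexI[of _ x]) auto
  qed
  then obtain x where x: "x \<in> dom N" "\<And>\<theta>. \<theta> \<in> \<Theta> \<Longrightarrow> sats N [x] \<theta>" "\<not> sats N [x, y] \<chi>"
    using sat\<delta> by auto
  have xH: "x \<in> ?H" by (rule \<Theta>H) (use x in auto)
  have "x \<otimes> inv y \<in> ?H" using sub xH yH by (simp add: subgroup.m_closed subgroup.m_inv_closed)
  then have "x \<otimes> inv y \<in> W \<phi>" using \<phi>(2) by blast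
  then show False using \<chi>(2)[of x y] x(3) xH yH Hc by blast
qed

text \<open>The translates of \<open>W \<phi>\<close> by coset representatives cover
  \<open>G\<close>, and there are fewer than \<open>\<kappa>b\<close> representatives. Hence the
  formulas saying that an element lies in \<open>G\<close> but in none of these translates are not
  realized. By saturation a finite part of them is not realized either, and the representatives in
  it are enough.\<close>

lemma covered_exists:
  assumes B: "A \<subseteq> B" "B \<subseteq> dom N" "|B| <o \<kappa>b" 
    and sub: "subgroup (G_of N G q) G" and ind: "|rcosets (G_of N G q)| <o \<kappa>b"
    and \<phi>: "\<phi> \<in> forms L B 1" "G_of N G q \<subseteq> W \<phi>"
  shows "\<exists>k. covered \<phi> k"
proof -
  let ?H = "G_of N G q"
  define g where "g C = (SOME x. x \<in> C \<and> x \<in> carrier G)" for C :: "'a set"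
  have g: "g C \<in> C \<and> g C \<in> carrier G" if "C \<in> rcosets ?H" for C
  proof -
    have "\<exists>x. x \<in> C \<and> x \<in> carrier G"
      using that rcos_self[OF _ sub] by (auto simp: RCOSETS_def)
    then show ?thesis unfolding g_def by (rule someI_ex)
  qed
  define R where "R = g ` (rcosets ?H)"
  have R: "R \<subseteq> carrier G" "|R| <o \<kappa>b"
    using g ind ordLeq_ordLess_trans[OF card_of_image] by (auto simp: R_def)
  have rep: "\<exists>r\<in>R. x \<otimes> inv r \<in> W \<phi>" if x: "x \<in> carrier G" for x
  proof -
    let ?C = "?H #> x"
    have C: "?C \<in> rcosets ?H" using x sub by (simp add: rcosetsI subgroup.subset)
    have "x \<in> ?H #> g ?C"
      using repr_independence[of "g ?C" ?H x] g[OF C] x sub rcos_self[of x ?H] by simp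
    then have "x \<otimes> inv (g ?C) \<in> ?H"
      using subgroup.rcos_module_imp[OF sub is_group, of "g ?C" x] g[OF C] by simp
    then show ?thesis using C \<phi>(2) by (auto simp: R_def)
  qed
  obtain \<chi> where \<chi>: "\<chi> \<in> forms L B 2"
    "\<And>x y. \<lbrakk>x \<in> carrier G; y \<in> carrier G\<rbrakk> \<Longrightarrow> sats N [x, y] \<chi> \<longleftrightarrow> x \<otimes> inv y \<in> W \<phi>"
    using quotient_formula[OF \<phi>(1) B(1)] by blast
  let ?\<delta> = "\<lambda>r. Neg (plug 1 [r] \<chi>)"
  have sat\<delta>: "sats N [x] (plug 1 [y] \<chi>) = sats N [x, y] \<chi>" for x y
    using sats_plug[of "[x]" 1 \<chi> "[y]" N] \<chi>(1) by (auto simp: forms_def numeral_2_eq_2)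
  have "\<not> (\<exists>x\<in>dom N. \<forall>\<theta>\<in>p \<union> ?\<delta> ` R. sats N [x] \<theta>)"
  proof
    assume "\<exists>x\<in>dom N. \<forall>\<theta>\<in>p \<union> ?\<delta> ` R. sats N [x] \<theta>"
    then obtain x where "x \<in> dom N" and x': "\<forall>\<theta>\<in>p \<union> ?\<delta> ` R. sats N [x] \<theta>" by blast
    then have x: "x \<in> carrier G" by (simp add: carrier realz_def)
    have "\<not> sats N [x, r] \<chi>" if "r \<in> R" for r
      using bspec[OF x', of "?\<delta> r"] that sat\<delta> by simp
    with x show False using rep[OF x] \<chi>(2)[OF x] R(1) by blast
  qed
  moreover have "B \<union> R \<subseteq> dom N" using B R carrier_dom by auto
  moreover have "|B \<union> R| <o \<kappa>b"
    using card_of_Un_ordLess_infinite_Field[OF _ card_order B(3) R(2)] card_order natLeq_le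
    by (metis cinfinite_def cinfinite_mono natLeq_cinfinite)
  moreover have "p \<union> ?\<delta> ` R \<subseteq> forms L (B \<union> R) 1"
  proof -
    have "plug 1 [r] \<chi> \<in> forms L (B \<union> R) 1" if "r \<in> R" for r
      by (rule forms_plug) (use that forms_mono[OF \<chi>(1), of "B \<union> R" 2] in \<open>auto simp: numeral_2_eq_2\<close>)
    moreover have "\<phi> \<in> forms L (B \<union> R) 1" if "\<phi> \<in> p" for \<phi>
      using that p B(1) by (intro forms_mono[of \<phi> L A 1 "B \<union> R" 1]) auto
    ultimately show ?thesis by auto
  qed
  ultimately obtain F where F: "finite F" "F \<subseteq> p \<union> ?\<delta> ` R" "\<not> (\<exists>x\<in>dom N. \<forall>\<theta>\<in>F. sats N [x] \<theta>)"
    using saturated_realize[OF saturated, of "B \<union> R" "p \<union> ?\<delta> ` R"] by metis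
  have "finite (F \<inter> ?\<delta> ` R)" using F(1) by simp
  then obtain R' where R': "finite R'" "R' \<subseteq> R" "F \<inter> ?\<delta> ` R = ?\<delta> ` R'"
    using finite_subset_image[of "F \<inter> ?\<delta> ` R" ?\<delta> R] by auto
  obtain rs where rs: "set rs = R'" using finite_list[OF R'(1)] by blast
  have "\<exists>t<length rs. x \<otimes> inv (rs ! t) \<in> W \<phi>" if x: "x \<in> carrier G" for x
  proof -
    obtain \<theta> where \<theta>: "\<theta> \<in> F" "\<not> sats N [x] \<theta>" using F(3) carrier_dom[OF x] by blast
    have "\<theta> \<notin> p" using \<theta>(2) x by (auto simp: carrier realz_def)
    then have "\<theta> \<in> ?\<delta> ` R'" using \<theta>(1) F(2) R'(3) by blast
    then obtain r where r: "r \<in> R'" "sats N [x, r] \<chi>" using \<theta>(2) sat\<delta> by auto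
    then have "x \<otimes> inv r \<in> W \<phi>" using \<chi>(2)[OF x, of r] R'(2) R(1) by blast
    moreover obtain t where "t < length rs" "rs ! t = r" using r(1) rs by (metis in_set_conv_nth)
    ultimately show ?thesis by blast
  qed
  moreover have "rs ! t \<in> carrier G" if "t < length rs" for t
    using nth_mem[OF that] rs R'(2) R(1) by blast
  ultimately show ?thesis
    unfolding covered_def by (intro exI[of _ "length rs"] exI[of _ "\<lambda>t. rs ! t"]) blast
qed

text \<open>
  The intersection of the sets \<open>W (\<psi> n)\<close> is a bounded subgroup already defined by countably
  many formulas, with a level-wise bound \<open>k\<close> on the number of classes.
\<close>

definition chain :: "'a set \<Rightarrow> (nat \<Rightarrow> ('f, 'r, 'a) fm) \<Rightarrow> (nat \<Rightarrow> nat) \<Rightarrow> bool" where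
  "chain B \<psi> k \<longleftrightarrow>
     (\<forall>n. \<psi> n \<in> forms L B 1 \<and> \<one> \<in> W (\<psi> n) \<and> covered (\<psi> n) (k n) \<and>
        (\<forall>x\<in>W (\<psi> (Suc n)). \<forall>y\<in>W (\<psi> (Suc n)). x \<otimes> inv y \<in> W (\<psi> n)))"

text \<open>All formulas chosen contain the subgroup in their trace. This is the invariant that
  allows the next step and gives the covering of each level.\<close>

lemma chain_exists:
  assumes B: "A \<subseteq> B" "B \<subseteq> dom N" "|B| <o \<kappa>b" and q: "q \<in> R_set L \<kappa>b N G B" and \<phi>: "\<phi> \<in> q"
  shows "\<exists>\<psi> k. chain B \<psi> k \<and> \<psi> 0 = \<phi>"
proof -
  let ?H = "G_of N G q"
  have q': "q \<subseteq> forms L B 1" "subgroup ?H G" "|rcosets ?H| <o \<kappa>b"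
    using q by (auto simp: R_set_def one_type_def)
  define P where "P \<psi> \<longleftrightarrow> \<psi> \<in> forms L B 1 \<and> ?H \<subseteq> W \<psi>" for \<psi>
  have step: "\<exists>\<psi>'. P \<psi>' \<and> (\<forall>x\<in>W \<psi>'. \<forall>y\<in>W \<psi>'. x \<otimes> inv y \<in> W \<psi>)" if "P \<psi>" for \<psi>
    using W_quotient_exists[OF B q'(1,2)] that unfolding P_def by blast
  have P\<phi>: "P \<phi>" using \<phi> q'(1) by (auto simp: P_def G_of_W)
  have "\<exists>\<psi>. \<forall>n. (P (\<psi> n) \<and> (n = 0 \<longrightarrow> \<psi> n = \<phi>)) \<and>
      (\<forall>x\<in>W (\<psi> (Suc n)). \<forall>y\<in>W (\<psi> (Suc n)). x \<otimes> inv y \<in> W (\<psi> n))"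
    by (rule dependent_nat_choice) (use P\<phi> step in auto)
  then obtain \<psi> where \<psi>: "\<psi> 0 = \<phi>" "\<And>n. P (\<psi> n)"
    "\<And>n. \<forall>x\<in>W (\<psi> (Suc n)). \<forall>y\<in>W (\<psi> (Suc n)). x \<otimes> inv y \<in> W (\<psi> n)" by blast
  have "\<exists>k. covered (\<psi> n) k" for n
    using covered_exists[OF B q'(2,3)] \<psi>(2) by (auto simp: P_def)
  then obtain k where k: "\<And>n. covered (\<psi> n) (k n)" by metis
  have "\<one> \<in> W (\<psi> n)" for n
    using \<psi>(2)[of n] subgroup.one_closed[OF q'(2)] by (auto simp: P_def)
  then have "chain B \<psi> k" using \<psi> k by (auto simp: chain_def P_def)
  then show ?thesis using \<psi>(1) by blast
qed

end

section \<open>Cardinal bounds below an inaccessible\<close>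

lemma card_Times_nat:
  assumes "natLeq <o \<kappa>" "|X| <o \<kappa>"
  shows "|X \<times> (UNIV :: nat set)| <o \<kappa>"
proof (cases "finite X")
  case True
  have "|X| \<le>o |UNIV :: nat set|"
    using True by (meson card_of_ordLeq_infinite infinite_UNIV_nat ordLeq_total card_of_Well_order)
  then have "|X \<times> (UNIV :: nat set)| \<le>o |(UNIV :: nat set) \<times> (UNIV :: nat set)|"
    by (rule card_of_Times_mono1)
  also have "|(UNIV :: nat set) \<times> (UNIV :: nat set)| =o |UNIV :: nat set|"
    by (rule card_of_Times_same_infinite) simp
  also have "|UNIV :: nat set| =o natLeq" by (rule card_of_nat)
  finally show ?thesis using assms(1) ordLeq_ordLess_trans by blast
next
  case False
  then have "|X \<times> (UNIV :: nat set)| =o |X|"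
    using infinite_iff_card_of_nat[of X] by (intro card_of_Times_infinite[THEN conjunct1]) auto
  then show ?thesis using assms(2) ordIso_ordLess_trans by blast
qed

lemma inaccessible_Pow:
  assumes "strongly_inaccessible \<kappa>" "|X| <o \<kappa>"
  shows "|Pow X| <o \<kappa>"
proof -
  have co: "Card_order \<kappa>" using assms(1) by (simp add: strongly_inaccessible_def)
  have "|X| \<le>o |Field \<kappa>|"
    using assms(2) card_of_Field_ordIso[OF co] ordLess_imp_ordLeq ordIso_symmetric
      ordLeq_ordIso_trans by blast
  then obtain f where f: "inj_on f X" "f ` X \<subseteq> Field \<kappa>" by (auto simp: card_of_ordLeq[symmetric])
  have "|f ` X| <o \<kappa>" using card_of_image assms(2) ordLeq_ordLess_trans by blast
  then have *: "|Pow (f ` X)| <o \<kappa>" using assms(1) f(2) by (simp add: strongly_inaccessible_def)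
  have "|Pow X| =o |Pow (f ` X)|"
    using bij_betw_Pow[OF bij_betw_imageI[OF f(1) refl]] card_of_ordIso by blast
  then show ?thesis using * ordIso_ordLess_trans by blast
qed

context definable_group
begin

text \<open>Elements with the same class numbers for all formulas of \<open>Q\<close> lie in the
  same coset, since every formula of \<open>Q\<close> is refined by another one. So the index is at
  most the cardinality of the power set of \<open>Q \<times> UNIV\<close>, which is below
  \<open>\<kappa>b\<close> by inaccessibility.\<close>

lemma R_setI:
  assumes Q: "Q \<subseteq> forms L B 1" "|Q| <o \<kappa>b"
    and one: "\<And>\<phi>. \<phi> \<in> Q \<Longrightarrow> \<one> \<in> W \<phi>"
    and quot: "\<And>\<phi>. \<phi> \<in> Q \<Longrightarrow> \<exists>\<psi>\<in>Q. \<forall>x\<in>W \<psi>. \<forall>y\<in>W \<psi>. x \<otimes> inv y \<in> W \<phi>"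
    and cov: "\<And>\<phi>. \<phi> \<in> Q \<Longrightarrow> \<exists>k. covered \<phi> k"
  shows "Q \<in> R_set L \<kappa>b N G B"
proof -
  let ?H = "G_of N G Q"
  have Hq: "x \<otimes> inv y \<in> ?H" if "x \<in> ?H" "y \<in> ?H" for x y
  proof -
    have "x \<otimes> inv y \<in> W \<phi>" if "\<phi> \<in> Q" for \<phi>
      using quot[OF that] \<open>x \<in> ?H\<close> \<open>y \<in> ?H\<close> by (auto simp: G_of_W)
    then show ?thesis using that by (simp add: G_of_W)
  qed
  have H1: "\<one> \<in> ?H" using one by (auto simp: G_of_W)
  have sub: "subgroup ?H G"
  proof (rule subgroupI)
    show "?H \<subseteq> carrier G" by (auto simp: G_of_def)
    show "?H \<noteq> {}" using H1 by blast
    show inv: "inv a \<in> ?H" if "a \<in> ?H" for a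
      using Hq[OF H1 that] that by (auto simp: G_of_def)
    show "a \<otimes> b \<in> ?H" if "a \<in> ?H" "b \<in> ?H" for a b
      using Hq[OF that(1) inv[OF that(2)]] that by (auto simp: G_of_def)
  qed
  have "\<exists>g. \<forall>x\<in>carrier G. \<exists>t::nat. g t \<in> carrier G \<and> x \<otimes> inv (g t) \<in> W \<phi>" if "\<phi> \<in> Q" for \<phi>
    using cov[OF that] unfolding covered_def by blast
  then obtain g where "\<forall>\<phi>\<in>Q. \<forall>x\<in>carrier G. \<exists>t::nat. g \<phi> t \<in> carrier G \<and> x \<otimes> inv (g \<phi> t) \<in> W \<phi>"
    by (metis (no_types, lifting))
  then obtain c :: "('f, 'r, 'a) fm \<Rightarrow> 'a \<Rightarrow> nat"
    where c: "\<And>\<phi> x. \<lbrakk>\<phi> \<in> Q; x \<in> carrier G\<rbrakk> \<Longrightarrow>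
      g \<phi> (c \<phi> x) \<in> carrier G \<and> x \<otimes> inv (g \<phi> (c \<phi> x)) \<in> W \<phi>" by metis
  \<comment> \<open>The graph of the class numbers of \<open>x\<close>, as a subset of
    \<open>Q \<times> UNIV\<close>.\<close>
  define F where "F x = {(\<phi>, c \<phi> x) | \<phi>. \<phi> \<in> Q}" for x
  have key: "x \<otimes> inv y \<in> ?H" if x: "x \<in> carrier G" and y: "y \<in> carrier G" and F: "F x = F y" for x y
  proof -
    have "x \<otimes> inv y \<in> W \<phi>" if \<phi>: "\<phi> \<in> Q" for \<phi>
    proof -
      obtain \<psi> where \<psi>: "\<psi> \<in> Q" "\<And>x y. \<lbrakk>x \<in> W \<psi>; y \<in> W \<psi>\<rbrakk> \<Longrightarrow> x \<otimes> inv y \<in> W \<phi>"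
        using quot[OF \<phi>] by blast
      have "(\<psi>, c \<psi> x) \<in> F y" using \<psi>(1) F by (auto simp: F_def)
      then have eq: "c \<psi> y = c \<psi> x" by (auto simp: F_def)
      \<comment> \<open>The common representative: comparing both elements with it at the finer
        formula \<open>\<psi>\<close> puts their quotient into \<open>W \<phi>\<close>.\<close>
      define z where "z = g \<psi> (c \<psi> x)"
      have z: "z \<in> carrier G" "x \<otimes> inv z \<in> W \<psi>" "y \<otimes> inv z \<in> W \<psi>"
        using c[OF \<psi>(1) x] c[OF \<psi>(1) y] eq by (auto simp: z_def)
      then have "x \<otimes> inv z \<otimes> inv (y \<otimes> inv z) \<in> W \<phi>" using \<psi>(2) by blast
      also have "x \<otimes> inv z \<otimes> inv (y \<otimes> inv z) = x \<otimes> inv y"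
        using x y z(1) by (simp add: inv_mult_group m_assoc inv_solve_left')
      finally show ?thesis .
    qed
    then show ?thesis using x y by (simp add: G_of_W)
  qed
  define r where "r C = (SOME x. x \<in> carrier G \<and> C = ?H #> x)" for C
  have r: "r C \<in> carrier G \<and> C = ?H #> r C" if "C \<in> rcosets ?H" for C
    unfolding r_def by (rule someI_ex) (use that in \<open>auto simp: RCOSETS_def\<close>)
  have "inj_on (\<lambda>C. F (r C)) (rcosets ?H)"
  proof (rule inj_onI)
    fix C D assume C: "C \<in> rcosets ?H" and D: "D \<in> rcosets ?H" and F: "F (r C) = F (r D)"
    have "r C \<otimes> inv (r D) \<in> ?H" using key r[OF C] r[OF D] F by blast
    then have "r C \<in> ?H #> r D"
      using subgroup.rcos_module[OF sub is_group] r[OF C] r[OF D] by blast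
    then have "?H #> r D = ?H #> r C" using repr_independence[OF _ _ sub] r[OF D] by blast
    then show "C = D" using r[OF C] r[OF D] by metis
  qed
  moreover have "(\<lambda>C. F (r C)) ` (rcosets ?H) \<subseteq> Pow (Q \<times> UNIV)" by (auto simp: F_def)
  ultimately have "|rcosets ?H| \<le>o |Pow (Q \<times> (UNIV :: nat set))|"
    unfolding card_of_ordLeq[symmetric] by blast
  also have "|Pow (Q \<times> (UNIV :: nat set))| <o \<kappa>b"
    by (intro inaccessible_Pow inaccessible card_Times_nat natLeq_less Q(2))
  finally have ind: "|rcosets ?H| <o \<kappa>b" .
  have "one_type L N B Q"
    unfolding one_type_def consistent_in_def
  proof (intro conjI allI impI)
    fix F assume "finite F \<and> F \<subseteq> Q"
    then show "\<exists>as. length as = 1 \<and> set as \<subseteq> dom N \<and> (\<forall>\<phi>\<in>F. sats N as \<phi>)"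
      using one carrier_dom by (intro exI[of _ "[\<one>]"]) (auto simp: W_def)
  qed (rule Q(1))
  then show ?thesis using sub ind by (simp add: R_set_def)
qed

section \<open>Arithmetic of chains and their transport along elementary maps\<close>

lemma chain_R_set:
  assumes "chain B \<psi> k"
  shows "range \<psi> \<in> R_set L \<kappa>b N G B"
proof (rule R_setI)
  have "|range \<psi>| \<le>o |UNIV :: nat set|" by (rule card_of_image)
  also have "|UNIV :: nat set| =o natLeq" by (rule card_of_nat)
  also have "natLeq <o \<kappa>b" by (rule natLeq_less)
  finally show "|range \<psi>| <o \<kappa>b" .
qed (use assms in \<open>unfold chain_def, blast+\<close>)

lemma chain_quotient: "chain B \<psi> k \<Longrightarrow> x \<in> W (\<psi> (Suc n)) \<Longrightarrow> y \<in> W (\<psi> (Suc n)) \<Longrightarrow>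
    x \<otimes> inv y \<in> W (\<psi> n)"
  by (auto simp: chain_def)

lemma chain_inv: "chain B \<psi> k \<Longrightarrow> y \<in> W (\<psi> (Suc n)) \<Longrightarrow> inv y \<in> W (\<psi> n)"
  using chain_quotient[of B \<psi> k \<one> n y] W_carrier[of y] by (auto simp: chain_def)

text \<open>The levels decrease because each contains \<open>\<one>\<close>, and dividing by
  \<open>\<one>\<close> goes down one level.\<close>

lemma chain_mono: "chain B \<psi> k \<Longrightarrow> x \<in> W (\<psi> m) \<Longrightarrow> n \<le> m \<Longrightarrow> x \<in> W (\<psi> n)"
proof (induction "m - n" arbitrary: m)
  case (Suc d)
  then obtain m' where m': "m = Suc m'" "n \<le> m'" by (cases m) auto
  have "\<one> \<in> W (\<psi> (Suc m'))" using Suc.prems(1) by (simp add: chain_def)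
  then have "x \<otimes> inv \<one> \<in> W (\<psi> m')"
    using chain_quotient[OF Suc.prems(1)] Suc.prems(2) m'(1) by blast
  then have "x \<in> W (\<psi> m')" using W_carrier[OF Suc.prems(2)] by simp
  moreover have "d = m' - n" using Suc.hyps(2) m' by simp
  ultimately show ?case using Suc.hyps(1) Suc.prems(1) m'(2) by blast
qed auto

text \<open>Inverting \<open>y\<close> costs one level and forming the quotient another one, whence
  the different levels of the two factors.\<close>

lemma chain_mult:
  assumes "chain B \<psi> k" "x \<in> W (\<psi> (Suc n))" "y \<in> W (\<psi> (Suc (Suc n)))"
  shows "x \<otimes> y \<in> W (\<psi> n)"
  using chain_quotient[OF assms(1,2) chain_inv[OF assms(1,3)]] W_carrier[OF assms(3)] by simp

text \<open>The inclusion quantifies over \<open>G\<close>, so it is not one sentence preserved by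
  \<open>f\<close>. Instead \<open>x\<close> and \<open>y\<close> are pulled back by an extension
  \<open>h\<close> of the inverse of \<open>f\<close>, the inclusion is applied there, and the
  quotient is transported forward again.\<close>

lemma quotient_transfer:
  assumes f: "elem_map L N D f" "A \<subseteq> D" "\<And>a. a \<in> A \<Longrightarrow> f a = a" and D: "|D| <o \<kappa>b"
    and \<phi>: "\<phi> \<in> forms L D 1" "\<psi> \<in> forms L D 1"
    and quot: "\<And>x y. \<lbrakk>x \<in> W \<psi>; y \<in> W \<psi>\<rbrakk> \<Longrightarrow> x \<otimes> inv y \<in> W \<phi>"
    and x: "x \<in> W (pmap f \<psi>)" and y: "y \<in> W (pmap f \<psi>)"
  shows "x \<otimes> inv y \<in> W (pmap f \<phi>)"
proof -
  let ?D = "f ` D \<union> {x, y}"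
  have fD: "|f ` D| <o \<kappa>b" using card_of_image D ordLeq_ordLess_trans by blast
  have "{x, y} \<subseteq> dom N" using x y W_carrier carrier_dom by blast
  then obtain h where h: "elem_map L N ?D h" "\<And>x. x \<in> f ` D \<Longrightarrow> h x = inv_into D f x"
    using extend[OF elem_map_inv[OF f(1)] fD, of "{x, y}"] by blast
  have inv: "h (f d) = d" if "d \<in> D" for d
    using that h(2) elem_map_inj[OF f(1)] by (simp add: inv_into_f_f)
  have AD: "A \<subseteq> f ` D" using f(2,3) by force
  have hA: "A \<subseteq> ?D" "\<And>a. a \<in> A \<Longrightarrow> h a = a" using AD inv f(2,3) by (auto, metis subsetD)
  have pm: "pmap h (pmap f \<theta>) = \<theta>" "pmap f \<theta> \<in> forms L ?D 1" if "\<theta> \<in> forms L D 1" for \<theta>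
    using pars_forms[OF that] inv forms_mono[OF forms_pmap[OF that], of f ?D 1]
    by (auto simp: pmap_pmap intro!: pmap_id)
  note e = elem_map_W[OF h(1) hA]
  have "h x \<in> W \<psi>" "h y \<in> W \<psi>"
    using e(2)[of x "pmap f \<psi>"] e(2)[of y "pmap f \<psi>"] pm[OF \<phi>(2)] x y by auto
  then have "h x \<otimes> inv (h y) \<in> W (pmap h (pmap f \<phi>))" using quot pm(1)[OF \<phi>(1)] by simp
  moreover have "|?D| <o \<kappa>b" by (rule card_Un_finite[OF card_order natLeq_le fD]) simp
  ultimately show ?thesis
    using elem_map_quotient[OF h(1) hA, of x y "pmap f \<phi>"] pm(2)[OF \<phi>(1)] x y W_carrier by auto
qed

text \<open>The new representatives are the images of the old ones under an extension
  \<open>f'\<close> of \<open>f\<close>. An arbitrary \<open>x\<close> is pulled back along the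
  inverse of \<open>f'\<close>, where the original cover applies.\<close>

lemma covered_transfer:
  assumes f: "elem_map L N D f" "A \<subseteq> D" "\<And>a. a \<in> A \<Longrightarrow> f a = a" and D: "|D| <o \<kappa>b"
    and \<phi>: "\<phi> \<in> forms L D 1" and cov: "covered \<phi> k"
  shows "covered (pmap f \<phi>) k"
proof -
  obtain g where g: "\<And>t. t < k \<Longrightarrow> g t \<in> carrier G"
    "\<And>x. x \<in> carrier G \<Longrightarrow> \<exists>t<k. x \<otimes> inv (g t) \<in> W \<phi>"
    using cov unfolding covered_def by blast
  let ?E = "g ` {..<k}"
  have "?E \<subseteq> dom N" using g(1) carrier_dom by blast
  then obtain f' where f': "elem_map L N (D \<union> ?E) f'" "\<And>x. x \<in> D \<Longrightarrow> f' x = f x"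
    using extend[OF f(1) D, of ?E] by blast
  have f'A: "A \<subseteq> D \<union> ?E" "\<And>a. a \<in> A \<Longrightarrow> f' a = a" using f(2,3) f'(2) by auto
  have D': "|D \<union> ?E| <o \<kappa>b" by (rule card_Un_finite[OF card_order natLeq_le D]) simp
  have pm: "pmap f \<phi> = pmap f' \<phi>" using pars_forms[OF \<phi>] f'(2) by (intro pmap_cong) auto
  have gt: "f' (g t) \<in> carrier G" if "t < k" for t
    using elem_map_W(1)[OF f'(1) f'A] g(1)[OF that] that by blast
  have "\<exists>t<k. x \<otimes> inv (f' (g t)) \<in> W (pmap f \<phi>)" if x: "x \<in> carrier G" for x
  proof -
    let ?D' = "f' ` (D \<union> ?E)"
    let ?D = "?D' \<union> {x}"
    have fD: "|?D'| <o \<kappa>b" using card_of_image D' ordLeq_ordLess_trans by blast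
    obtain h where h: "elem_map L N ?D h" "\<And>x. x \<in> ?D' \<Longrightarrow> h x = inv_into (D \<union> ?E) f' x"
      using extend[OF elem_map_inv[OF f'(1)] fD, of "{x}"] carrier_dom[OF x] by blast
    have inv: "h (f' d) = d" if "d \<in> D \<union> ?E" for d
      using that h(2) elem_map_inj[OF f'(1)] by (simp add: inv_into_f_f)
    have AD: "A \<subseteq> ?D'" using f'A by force
    have hA: "A \<subseteq> ?D" "\<And>a. a \<in> A \<Longrightarrow> h a = a" using AD inv f'A by (auto, metis subsetD UnCI)
    have "\<phi> \<in> forms L (D \<union> ?E) 1" using forms_mono[OF \<phi>, of "D \<union> ?E" 1] by simp
    then have pm': "pmap h (pmap f' \<phi>) = \<phi>" "pmap f' \<phi> \<in> forms L ?D 1"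
      using pars_forms[OF \<phi>] inv forms_mono[OF forms_pmap, of \<phi> L "D \<union> ?E" 1 f' ?D 1]
      by (auto simp: pmap_pmap intro!: pmap_id)
    have "h x \<in> carrier G" using elem_map_W(1)[OF h(1) hA] x by blast
    then obtain t where t: "t < k" "h x \<otimes> inv (g t) \<in> W \<phi>" using g(2) by blast
    have "h (f' (g t)) = g t" using inv t(1) by blast
    then have "h x \<otimes> inv (h (f' (g t))) \<in> W (pmap h (pmap f' \<phi>))" using t(2) pm'(1) by simp
    moreover have "|?D| <o \<kappa>b" by (rule card_Un_finite[OF card_order natLeq_le fD]) simp
    ultimately have "x \<otimes> inv (f' (g t)) \<in> W (pmap f' \<phi>)"
      using elem_map_quotient[OF h(1) hA, of x "f' (g t)" "pmap f' \<phi>"] pm'(2) x gt t(1) by blast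
    then show ?thesis using t(1) pm by auto
  qed
  then show ?thesis unfolding covered_def using gt by (intro exI[of _ "\<lambda>t. f' (g t)"]) auto
qed

lemma chain_transfer:
  assumes f: "elem_map L N D f" "A \<subseteq> D" "\<And>a. a \<in> A \<Longrightarrow> f a = a" and D: "|D| <o \<kappa>b"
    and ch: "chain B \<psi> k" and pars: "\<And>n. pars (\<psi> n) \<subseteq> D"
  shows "chain (f ` D) (\<lambda>n. pmap f (\<psi> n)) k"
proof -
  have \<psi>: "\<psi> n \<in> forms L D 1" for n
    using ch pars forms_restrict[of "\<psi> n" L B 1 D] by (simp add: chain_def)
  have quot: "x \<otimes> inv y \<in> W (pmap f (\<psi> n))"
    if "x \<in> W (pmap f (\<psi> (Suc n)))" "y \<in> W (pmap f (\<psi> (Suc n)))" for n x y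
    using quotient_transfer[OF f D \<psi> \<psi> chain_quotient[OF ch]] that by blast
  have "\<one> \<in> W (pmap f (\<psi> n))" for n
  proof -
    obtain g where g: "elem_map L N (D \<union> {\<one>}) g" "\<And>x. x \<in> D \<Longrightarrow> g x = f x"
      using extend[OF f(1) D, of "{\<one>}"] carrier_dom by auto
    have gA: "A \<subseteq> D \<union> {\<one>}" "\<And>a. a \<in> A \<Longrightarrow> g a = a" using f g by auto
    have "g \<one> = \<one>" using elem_map_mult(3)[OF g(1) gA, of \<one>] by simp
    moreover have "pmap f (\<psi> n) = pmap g (\<psi> n)"
      using subsetD[OF pars[of n]] g(2) by (intro pmap_cong) simp
    ultimately show ?thesis
      using elem_map_W(2)[OF g(1) gA, of \<one> "\<psi> n"] forms_mono[OF \<psi>, of "D \<union> {\<one>}" 1 n] ch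
      by (auto simp: chain_def)
  qed
  then show ?thesis
    using quot covered_transfer[OF f D \<psi>] forms_pmap[OF \<psi>] ch by (auto simp: chain_def)
qed

end

section \<open>Infinite arrays from finite ones\<close>

text \<open>Saturation produces a value for variable 0, and \<open>plug 1\<close> fills the
  variables after it. When the first \<open>i\<close> variables already have values and the next one
  is sought, that one has to be moved to the front.\<close>

lemma rotate_variables:
  assumes \<phi>: "\<phi> \<in> forms L B (Suc i)" and ne: "dom N \<noteq> {}"
  shows "\<exists>\<psi>\<in>forms L B (Suc i). \<forall>u es. u \<in> dom N \<longrightarrow> set es \<subseteq> dom N \<longrightarrow> length es = i \<longrightarrow>
    (sats N (u # es) \<psi> \<longleftrightarrow> sats N (es @ [u]) \<phi>)"
proof -
  let ?js = "[1..<Suc i] @ [0]"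
  have d: "definable L N B (\<lambda>g. sats N (map g ?js) \<phi>)" by (rule definable_sats) (use \<phi> in \<open>simp del: upt_Suc\<close>)
  have "\<exists>\<psi>\<in>forms L B (Suc i). \<forall>g. range g \<subseteq> dom N \<longrightarrow> (sat N g \<psi> \<longleftrightarrow> sats N (map g ?js) \<phi>)"
  proof (rule definable_forms[OF d ne])
    fix e e' :: "nat \<Rightarrow> 'c" assume "\<forall>j<Suc i. e j = e' j"
    then have "map e ?js = map e' ?js" by auto
    then show "sats N (map e ?js) \<phi> \<longleftrightarrow> sats N (map e' ?js) \<phi>" by presburger
  qed
  then obtain \<psi> where \<psi>: "\<psi> \<in> forms L B (Suc i)"
    "\<And>g. range g \<subseteq> dom N \<Longrightarrow> sat N g \<psi> \<longleftrightarrow> sats N (map g ?js) \<phi>" by blast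
  have "sats N (u # es) \<psi> \<longleftrightarrow> sats N (es @ [u]) \<phi>"
    if u: "u \<in> dom N" "set es \<subseteq> dom N" "length es = i" for u es
  proof -
    define g where "g = (\<lambda>j. if j < Suc i then (u # es) ! j else u)"
    have "g j \<in> dom N" for j
    proof (cases "j < Suc i")
      case True
      then have "(u # es) ! j \<in> set (u # es)" using u(3) by (intro nth_mem) simp
      then show ?thesis using u True by (auto simp: g_def)
    qed (use u in \<open>simp add: g_def\<close>)
    then have g: "range g \<subseteq> dom N" by blast
    have "map g [1..<Suc i] = es"
      using u(3) by (intro nth_equalityI) (auto simp: g_def simp del: upt_Suc)
    then have m: "map g ?js = es @ [u]" by (simp add: g_def del: upt_Suc)
    have "sats N (u # es) \<psi> \<longleftrightarrow> sat N g \<psi>"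
      using \<psi>(1) u(3) by (intro sat_sats[symmetric]) (auto simp: forms_def g_def)
    then show ?thesis using \<psi>(2)[OF g] m by simp
  qed
  then show ?thesis using \<psi>(1) by blast
qed

text \<open>The variables receive their values one after the other, each by saturation over the
  finitely many values chosen before. Every formula has finitely many free variables and is
  therefore decided at some finite stage.\<close>

lemma countable_compactness:
  assumes str: "is_struct L N" and satN: "saturated L \<kappa> N" and \<kappa>: "natLeq <o \<kappa>"
    and wf: "\<And>n. wf_fm L {} (\<phi> n)"
    and dec: "\<And>n e. range e \<subseteq> dom N \<Longrightarrow> sat N e (\<phi> (Suc n)) \<Longrightarrow> sat N e (\<phi> n)"
    and ex: "\<And>n. \<exists>e. range e \<subseteq> dom N \<and> sat N e (\<phi> n)"
  shows "\<exists>e. range e \<subseteq> dom N \<and> (\<forall>n. sat N e (\<phi> n))"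
proof -
  have ne: "dom N \<noteq> {}" using str by (simp add: is_struct_def)
  have dec': "sat N e (\<phi> n)" if "range e \<subseteq> dom N" "sat N e (\<phi> m)" "n \<le> m" for e m n
    using that(3,2) by (induction rule: dec_induct) (use dec that(1) in blast)+
  \<comment> \<open>The invariant: the first \<open>i\<close> values can be completed to a solution
    of each single formula. As the formulas decrease, this covers finite sets of them.\<close>
  define C where "C e i \<longleftrightarrow>
    (\<forall>n. \<exists>e'. range e' \<subseteq> dom N \<and> (\<forall>j<i. e' j = e j) \<and> sat N e' (\<phi> n))" for e i
  have step: "\<exists>u\<in>dom N. C (e(i := u)) (Suc i)" if e: "range e \<subseteq> dom N" and C: "C e i" for e i
  proof -
    define es where "es = map e [0..<i]"
    have es: "set es \<subseteq> dom N" "length es = i" using e by (auto simp: es_def)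
    have js: "\<exists>js. set js = fv (\<phi> n) - {..i}" for n by (simp add: finite_list)
    then obtain js where js: "\<And>n. set (js n) = fv (\<phi> n) - {..i}" by metis
    define \<phi>' where "\<phi>' n = exs (js n) (\<phi> n)" for n
    have \<phi>': "\<phi>' n \<in> forms L {} (Suc i)" for n
      using wf js by (auto simp: \<phi>'_def forms_def)
    have sat\<phi>': "sats N (es @ [u]) (\<phi>' n) \<longleftrightarrow>
        (\<exists>e'. range e' \<subseteq> dom N \<and> (\<forall>j<Suc i. e' j = (e(i := u)) j) \<and> sat N e' (\<phi> n))"
      if u: "u \<in> dom N" for u n
    proof -
      let ?e = "e(i := u)"
      have e': "range ?e \<subseteq> dom N" using e u by auto
      have "sats N (es @ [u]) (\<phi>' n) \<longleftrightarrow> sat N ?e (\<phi>' n)"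
        using \<phi>'[of n] by (intro sat_sats[symmetric])
          (auto simp: forms_def es_def nth_append less_Suc_eq)
      also have "\<dots> \<longleftrightarrow> (\<exists>e'. range e' \<subseteq> dom N \<and> (\<forall>j<Suc i. e' j = ?e j) \<and> sat N e' (\<phi> n))"
        (is "?l \<longleftrightarrow> ?r")
      proof
        assume ?l
        then obtain e1 where "range e1 \<subseteq> dom N" "\<forall>j. j \<notin> set (js n) \<longrightarrow> e1 j = ?e j" "sat N e1 (\<phi> n)"
          unfolding \<phi>'_def sat_exs[OF e'] by blast
        then show ?r using js[of n] by (intro exI[of _ e1]) simp
      next
        assume ?r
        then obtain e1 where e1: "range e1 \<subseteq> dom N" "\<forall>j<Suc i. e1 j = ?e j" "sat N e1 (\<phi> n)" by blast
        define e2 where "e2 j = (if j \<in> set (js n) then e1 j else ?e j)" for j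
        have "sat N e2 (\<phi> n) = sat N e1 (\<phi> n)"
          by (rule sat_cong) (use js e1(2) in \<open>auto simp: e2_def\<close>)
        moreover have "range e2 \<subseteq> dom N" using e1(1) e' by (auto simp: e2_def)
        ultimately show ?l
          unfolding \<phi>'_def sat_exs[OF e'] using e1(3) by (intro exI[of _ e2]) (auto simp: e2_def)
      qed
      finally show ?thesis .
    qed
    have "\<exists>\<psi>\<in>forms L {} (Suc i). \<forall>u es. u \<in> dom N \<longrightarrow> set es \<subseteq> dom N \<longrightarrow> length es = i \<longrightarrow>
      (sats N (u # es) \<psi> \<longleftrightarrow> sats N (es @ [u]) (\<phi>' n))" for n
      by (rule rotate_variables[OF \<phi>' ne])
    then obtain \<psi> where \<psi>: "\<And>n. \<psi> n \<in> forms L {} (Suc i)"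
      "\<And>n u. u \<in> dom N \<Longrightarrow> sats N (u # es) (\<psi> n) \<longleftrightarrow> sats N (es @ [u]) (\<phi>' n)"
      using es by metis
    define \<theta> where "\<theta> n = plug 1 es (\<psi> n)" for n
    have sat\<theta>: "sats N [u] (\<theta> n) \<longleftrightarrow> sats N (es @ [u]) (\<phi>' n)" if "u \<in> dom N" for u n
      using sats_plug[of "[u]" 1 "\<psi> n" es N] \<psi>(1)[of n] \<psi>(2)[OF that, of n] es(2)
      by (auto simp: \<theta>_def forms_def)
    have "\<exists>u\<in>dom N. \<forall>\<phi>\<in>range \<theta>. sats N [u] \<phi>"
    proof (rule saturated_realize[OF satN es(1)])
      have "|set es| <o natLeq" using finite_iff_ordLess_natLeq by blast
      then show "|set es| <o \<kappa>" using \<kappa> ordLess_transitive by blast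
      have "\<psi> n \<in> forms L (set es) (1 + length es)" for n
        using forms_mono[OF \<psi>(1), of "set es" "1 + length es"] es(2) by simp
      then show "range \<theta> \<subseteq> forms L (set es) 1" unfolding \<theta>_def using forms_plug by blast
      fix F assume "finite F" "F \<subseteq> range \<theta>"
      then obtain I where I: "finite I" "F = \<theta> ` I" using finite_subset_image[of F \<theta> UNIV] by auto
      then obtain n where n: "\<forall>m\<in>I. m \<le> n" using finite_nat_set_iff_bounded_le by blast
      obtain e' where e': "range e' \<subseteq> dom N" "\<forall>j<i. e' j = e j" "sat N e' (\<phi> n)"
        using C unfolding C_def by blast
      have d: "e' i \<in> dom N" using e'(1) by auto
      have "sats N (es @ [e' i]) (\<phi>' m)" if "m \<in> I" for m
        unfolding sat\<phi>'[OF d] using e' dec'[OF e'(1,3)] n that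
        by (intro exI[of _ e']) (auto simp: less_Suc_eq)
      then show "\<exists>a\<in>dom N. \<forall>\<phi>\<in>F. sats N [a] \<phi>" using d I(2) sat\<theta>[OF d] by auto
    qed
    then obtain u where "u \<in> dom N" "\<And>n. sats N [u] (\<theta> n)" by blast
    then show ?thesis using sat\<theta> sat\<phi>' unfolding C_def by blast
  qed
  obtain e0 :: "nat \<Rightarrow> _" where e0: "range e0 \<subseteq> dom N" using ex by blast
  have C0: "C e0 0" using ex by (auto simp: C_def)
  have "\<exists>E. \<forall>i. (range (E i) \<subseteq> dom N \<and> C (E i) i) \<and> (\<forall>j. j \<noteq> i \<longrightarrow> E (Suc i) j = E i j)"
  proof (rule dependent_nat_choice)
    show "\<exists>x. range x \<subseteq> dom N \<and> C x 0" using e0 C0 by blast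
    fix x i assume x: "range x \<subseteq> dom N \<and> C x i"
    then obtain u where "u \<in> dom N" "C (x(i := u)) (Suc i)" using step by blast
    then show "\<exists>y. (range y \<subseteq> dom N \<and> C y (Suc i)) \<and> (\<forall>j. j \<noteq> i \<longrightarrow> y j = x j)"
      using x by (intro exI[of _ "x(i := u)"]) auto
  qed
  then obtain E where E: "\<And>i. range (E i) \<subseteq> dom N" "\<And>i. C (E i) i"
    "\<And>i j. j \<noteq> i \<Longrightarrow> E (Suc i) j = E i j" by blast
  \<comment> \<open>The value at \<open>j\<close> is set in the step from \<open>j\<close> to
    \<open>Suc j\<close> and never changed again.\<close>
  define e where "e j = E (Suc j) j" for j
  have "E i j = e j" if "j < i" for i j
    using Suc_leI[OF that] by (induction rule: dec_induct) (auto simp: e_def E(3))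
  then have Ee: "\<And>i j. j < i \<Longrightarrow> E i j = e j" .
  have "sat N e (\<phi> n)" for n
  proof -
    obtain i where i: "\<forall>j\<in>fv (\<phi> n). j < i" using finite_nat_set_iff_bounded finite_fv by blast
    obtain e' where "\<forall>j<i. e' j = E i j" "sat N e' (\<phi> n)" using E(2)[of i] unfolding C_def by blast
    then show ?thesis using sat_cong[of "\<phi> n" e' e N] i Ee by auto
  qed
  moreover have "range e \<subseteq> dom N" using E(1) by (auto simp: e_def)
  ultimately show ?thesis by blast
qed

text \<open>That an array of size \<open>n\<close> realizes all patterns is one formula in variables
  for its entries, as there are finitely many patterns. These formulas decrease with
  \<open>n\<close>, so countable compactness yields one infinite array for all sizes.\<close>

lemma two_independent_finite_arrays:
  fixes N :: "('f, 'r, 'a) struct"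
  assumes mod: "model L T N" and satN: "saturated L \<kappa> N" and \<kappa>: "natLeq <o \<kappa>"
    and \<phi>: "\<phi> \<in> forms L {} (k + l + m)"
    and arr: "\<And>n :: nat. \<exists>b c. (\<forall>i<n. length (b i) = l \<and> set (b i) \<subseteq> dom N) \<and>
      (\<forall>j<n. length (c j) = m \<and> set (c j) \<subseteq> dom N) \<and>
      (\<forall>u. \<exists>as. length as = k \<and> set as \<subseteq> dom N \<and>
        (\<forall>i<n. \<forall>j<n. sats N (as @ b i @ c j) \<phi> \<longleftrightarrow> (i, j) \<in> u))"
  shows "two_independent L T"
proof -
  have str: "is_struct L N" using mod by (simp add: model_def)
  then obtain d where d: "d \<in> dom N" by (auto simp: is_struct_def)
  \<comment> \<open>Variables below \<open>k\<close> hold the tuple realizing a pattern. From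
    \<open>k\<close> on, even offsets hold the entries of the rows and odd offsets those of the
    columns, so the two infinite families do not overlap.\<close>
  define bi where "bi i = map (\<lambda>t. k + 2 * (l * i + t)) [0..<l]" for i
  define ci where "ci j = map (\<lambda>t. k + 2 * (m * j + t) + 1) [0..<m]" for j
  define js where "js i j = [0..<k] @ bi i @ ci j" for i j
  have len: "length (js i j) = k + l + m" for i j by (simp add: js_def bi_def ci_def)
  define P where "P n e \<longleftrightarrow> (\<forall>u\<in>Pow ({..<n} \<times> {..<n}). \<exists>e'. range e' \<subseteq> dom N \<and>
      (\<forall>i. i \<notin> {..<k} \<longrightarrow> e' i = e i) \<and>
      (\<forall>ij\<in>{..<n} \<times> {..<n}. sats N (map e' (js (fst ij) (snd ij))) \<phi> \<longleftrightarrow> ij \<in> u))"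
    for n :: nat and e :: "nat \<Rightarrow> 'a"
  have "definable L N {} (P n)" for n
    unfolding P_def
  proof (intro definable_Ball definable_exs)
    fix u and ij :: "nat \<times> nat"
    have D: "definable L N {} (\<lambda>e. sats N (map e (js (fst ij) (snd ij))) \<phi>)"
      by (rule definable_sats) (simp add: \<phi> len)
    show "definable L N {} (\<lambda>e. sats N (map e (js (fst ij) (snd ij))) \<phi> \<longleftrightarrow> ij \<in> u)"
      using D definable_neg[OF D] by (cases "ij \<in> u") auto
  qed auto
  then obtain \<theta> where \<theta>: "\<And>n. wf_fm L {} (\<theta> n)"
    "\<And>n e. range e \<subseteq> dom N \<Longrightarrow> P n e \<longleftrightarrow> sat N e (\<theta> n)"
    unfolding definable_def by metis
  have "\<exists>e. range e \<subseteq> dom N \<and> (\<forall>n. sat N e (\<theta> n))"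
  proof (rule countable_compactness[OF str satN \<kappa> \<theta>(1)])
    fix n and e :: "nat \<Rightarrow> 'a" assume e: "range e \<subseteq> dom N" and "sat N e (\<theta> (Suc n))"
    then have P: "P (Suc n) e" using \<theta>(2) by blast
    have "P n e"
      unfolding P_def
    proof
      fix u assume u: "u \<in> Pow ({..<n} \<times> {..<n})"
      then have "u \<in> Pow ({..<Suc n} \<times> {..<Suc n})" by auto
      from bspec[OF P[unfolded P_def] this] obtain e' where "range e' \<subseteq> dom N" "\<forall>i. i \<notin> {..<k} \<longrightarrow> e' i = e i"
        "\<forall>ij\<in>{..<Suc n} \<times> {..<Suc n}. sats N (map e' (js (fst ij) (snd ij))) \<phi> \<longleftrightarrow> ij \<in> u"
        by (elim exE conjE)
      then show "\<exists>e'. range e' \<subseteq> dom N \<and> (\<forall>i. i \<notin> {..<k} \<longrightarrow> e' i = e i) \<and>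
          (\<forall>ij\<in>{..<n} \<times> {..<n}. sats N (map e' (js (fst ij) (snd ij))) \<phi> \<longleftrightarrow> ij \<in> u)"
        by (intro exI[of _ e']) auto
    qed
    then show "sat N e (\<theta> n)" using \<theta>(2) e by blast
  next
    fix n :: nat
    obtain b c where bc: "\<forall>i<n. length (b i) = l \<and> set (b i) \<subseteq> dom N"
      "\<forall>j<n. length (c j) = m \<and> set (c j) \<subseteq> dom N"
      "\<forall>u. \<exists>as. length as = k \<and> set as \<subseteq> dom N \<and>
        (\<forall>i<n. \<forall>j<n. sats N (as @ b i @ c j) \<phi> \<longleftrightarrow> (i, j) \<in> u)"
      using arr[of n] by (elim exE conjE)
    \<comment> \<open>Decodes a variable into an array entry. Rows and columns from \<open>n\<close>
      on are unconstrained, so the entries found there may lie outside the universe;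
      \<open>e\<close> replaces such entries by \<open>d\<close>.\<close>
    define f where "f v = (let w = (v - k) div 2 in
        if even (v - k) then b (w div l) ! (w mod l) else c (w div m) ! (w mod m))" for v
    define e where "e v = (if f v \<in> dom N then f v else d)" for v
    have e: "range e \<subseteq> dom N" using d by (auto simp: e_def)
    have eb: "map e (bi i) = b i" if i: "i < n" for i
    proof (rule nth_equalityI)
      fix t assume "t < length (map e (bi i))"
      then have t: "t < l" by (simp add: bi_def)
      then have "f (k + 2 * (l * i + t)) = b i ! t" by (simp add: f_def Let_def)
      moreover have "b i ! t \<in> dom N" using bc(1) i t by (metis nth_mem subsetD)
      ultimately show "map e (bi i) ! t = b i ! t" using t by (simp add: bi_def e_def)
    qed (use bc(1) i in \<open>simp add: bi_def\<close>)
    have ec: "map e (ci i) = c i" if i: "i < n" for i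
    proof (rule nth_equalityI)
      fix t assume "t < length (map e (ci i))"
      then have t: "t < m" by (simp add: ci_def)
      then have "f (k + 2 * (m * i + t) + 1) = c i ! t" by (simp add: f_def Let_def)
      moreover have "c i ! t \<in> dom N" using bc(2) i t by (metis nth_mem subsetD)
      ultimately show "map e (ci i) ! t = c i ! t" using t by (simp add: ci_def e_def)
    qed (use bc(2) i in \<open>simp add: ci_def\<close>)
    have "P n e"
      unfolding P_def
    proof
      fix u assume "u \<in> Pow ({..<n} \<times> {..<n})"
      obtain as where as: "length as = k" "set as \<subseteq> dom N"
        "\<forall>i<n. \<forall>j<n. sats N (as @ b i @ c j) \<phi> \<longleftrightarrow> (i, j) \<in> u" using bc(3) by blast
      define e' where "e' v = (if v < k then as ! v else e v)" for v
      have "as ! v \<in> dom N" if "v < k" for v using as(1,2) nth_mem that by blast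
      then have "range e' \<subseteq> dom N" using e by (auto simp: e'_def)
      moreover have "map e' (js i j) = as @ b i @ c j" if "i < n" "j < n" for i j
      proof -
        have "map e' [0..<k] = as" using as(1) by (intro nth_equalityI) (auto simp: e'_def)
        moreover have "map e' (bi i) = map e (bi i)" "map e' (ci j) = map e (ci j)"
          by (auto simp: bi_def ci_def e'_def)
        ultimately show ?thesis using eb ec that by (simp add: js_def)
      qed
      ultimately show "\<exists>e'. range e' \<subseteq> dom N \<and> (\<forall>i. i \<notin> {..<k} \<longrightarrow> e' i = e i) \<and>
          (\<forall>ij\<in>{..<n} \<times> {..<n}. sats N (map e' (js (fst ij) (snd ij))) \<phi> \<longleftrightarrow> ij \<in> u)"
        using as(3) by (intro exI[of _ e']) (auto simp: e'_def)
    qed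
    then show "\<exists>e. range e \<subseteq> dom N \<and> sat N e (\<theta> n)" using \<theta>(2) e by blast
  qed
  then obtain e where e: "range e \<subseteq> dom N" and e\<theta>: "\<forall>n. sat N e (\<theta> n)" by (elim exE conjE)
  have eP: "P n e" for n using \<theta>(2)[OF e] e\<theta> by simp
  define b where "b i = map e (bi i)" for i
  define c where "c j = map e (ci j)" for j
  have b: "length (b i) = l" "set (b i) \<subseteq> dom N" for i using e by (auto simp: b_def bi_def)
  have c: "length (c j) = m" "set (c j) \<subseteq> dom N" for j using e by (auto simp: c_def ci_def)
  have "consistent_in N k {fm_if ((i, j) \<in> u) (plug k (b i @ c j) \<phi>) | i j. True}" for u
    unfolding consistent_in_def
  proof (intro allI impI)
    fix F assume F: "finite F \<and> F \<subseteq> {fm_if ((i, j) \<in> u) (plug k (b i @ c j) \<phi>) | i j. True}"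
    define g where "g ij = fm_if (ij \<in> u) (plug k (b (fst ij) @ c (snd ij)) \<phi>)" for ij
    have "F \<subseteq> range g"
    proof
      fix x assume "x \<in> F"
      then obtain i j where "x = g (i, j)" using F by (auto simp: g_def)
      then show "x \<in> range g" by simp
    qed
    then obtain I where I: "finite I" "F = g ` I" using finite_subset_image[of F g UNIV] F by auto
    obtain n where n: "\<forall>x\<in>fst ` I \<union> snd ` I. x < n"
      using I(1) finite_nat_set_iff_bounded[of "fst ` I \<union> snd ` I"] by auto
    have "u \<inter> {..<n} \<times> {..<n} \<in> Pow ({..<n} \<times> {..<n})" by simp
    from bspec[OF eP[of n, unfolded P_def] this] obtain e' where e': "range e' \<subseteq> dom N" "\<forall>i. i \<notin> {..<k} \<longrightarrow> e' i = e i"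
      "\<forall>ij\<in>{..<n} \<times> {..<n}. sats N (map e' (js (fst ij) (snd ij))) \<phi> \<longleftrightarrow> ij \<in> u \<inter> {..<n} \<times> {..<n}"
      by (elim exE conjE)
    define as where "as = map e' [0..<k]"
    have "sats N as (g ij)" if ij: "ij \<in> I" for ij
    proof -
      have ijn: "ij \<in> {..<n} \<times> {..<n}" using n ij by (auto simp: mem_Times_iff)
      have "map e' (bi i) = b i" "map e' (ci j) = c j" for i j
        using e'(2) by (auto simp: b_def c_def bi_def ci_def)
      then have "map e' (js (fst ij) (snd ij)) = as @ b (fst ij) @ c (snd ij)"
        by (simp add: js_def as_def)
      moreover have "sats N as (plug k (b (fst ij) @ c (snd ij)) \<phi>) =
          sats N (as @ b (fst ij) @ c (snd ij)) \<phi>"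
        by (rule sats_plug) (use \<phi> b c in \<open>auto simp: as_def forms_def add.assoc\<close>)
      ultimately have "sats N as (plug k (b (fst ij) @ c (snd ij)) \<phi>) \<longleftrightarrow> ij \<in> u"
        using bspec[OF e'(3) ijn] ijn by simp
      then show ?thesis by (simp add: g_def fm_if_def)
    qed
    then show "\<exists>as. length as = k \<and> set as \<subseteq> dom N \<and> (\<forall>\<phi>\<in>F. sats N as \<phi>)"
      using e'(1) I(2) by (intro exI[of _ as]) (auto simp: as_def)
  qed
  then show ?thesis
    unfolding two_independent_def using mod \<phi> b c
    by (intro exI[of _ N] exI[of _ k] exI[of _ l] exI[of _ m] exI[of _ \<phi>] exI[of _ b] exI[of _ c]) auto
qed

section \<open>Products of almost members\<close>

context definable_group
begin

text \<open>Multiplying one more factor from the left costs two levels, by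
  \<open>chain_mult\<close>.\<close>

lemma chain_prod:
  assumes "chain B \<psi> k"
  shows "(\<And>x. x \<in> set xs \<Longrightarrow> x \<in> W (\<psi> (n + 2 * length xs))) \<Longrightarrow> foldr (\<otimes>) xs \<one> \<in> W (\<psi> n)"
proof (induction xs arbitrary: n)
  case Nil
  show ?case using assms by (simp add: chain_def)
next
  case (Cons x xs)
  have "foldr (\<otimes>) xs \<one> \<in> W (\<psi> (n + 2))"
    using Cons.prems by (intro Cons.IH) (simp add: algebra_simps)
  moreover have "x \<in> W (\<psi> (Suc n))"
    using chain_mono[OF assms Cons.prems[of x], of "Suc n"] by simp
  ultimately show ?case using chain_mult[OF assms] by simp
qed

lemma foldr_mult_append:
  "set xs \<subseteq> carrier G \<Longrightarrow> set ys \<subseteq> carrier G \<Longrightarrow>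
    foldr (\<otimes>) xs \<one> \<in> carrier G \<and> foldr (\<otimes>) (xs @ ys) \<one> = foldr (\<otimes>) xs \<one> \<otimes> foldr (\<otimes>) ys \<one>"
proof (induction xs)
  case Nil
  have "foldr (\<otimes>) ys \<one> \<in> carrier G" using Nil(2) by (induction ys) auto
  then show ?case by simp
next
  case (Cons x xs)
  have "foldr (\<otimes>) ys \<one> \<in> carrier G" using Cons.prems(2) by (induction ys) auto
  then show ?case using Cons by (simp add: m_assoc)
qed

text \<open>Were the product in level 5, cancelling \<open>h\<close> would lead to level 4,
  inverting to level 3, and cancelling \<open>g\<close> would put \<open>a\<close> into level
  2.\<close>

lemma chain_outside:
  assumes ch: "chain B \<psi> k" and g: "g \<in> W (\<psi> 5)" and h: "h \<in> W (\<psi> 5)"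
    and a: "a \<in> carrier G" "a \<notin> W (\<psi> 2)"
  shows "g \<otimes> (a \<otimes> h) \<notin> W (\<psi> 5)"
proof
  assume gah: "g \<otimes> (a \<otimes> h) \<in> W (\<psi> 5)"
  note gc = W_carrier[OF g] and hc = W_carrier[OF h]
  have "g \<otimes> (a \<otimes> h) \<otimes> inv h \<in> W (\<psi> 4)"
    using chain_quotient[OF ch, of _ 4] gah h by simp
  then have "g \<otimes> a \<in> W (\<psi> 4)" using gc hc a(1) by (simp add: m_assoc)
  then have "inv (g \<otimes> a) \<in> W (\<psi> 3)" using chain_inv[OF ch, of _ 3] by simp
  moreover have "inv g \<in> W (\<psi> 3)"
    using chain_inv[OF ch, of g 3] chain_mono[OF ch g, of 4] by simp
  ultimately have "inv g \<otimes> inv (inv (g \<otimes> a)) \<in> W (\<psi> 2)"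
    using chain_quotient[OF ch, of _ 2] by simp
  then show False using a gc by (simp add: m_assoc[symmetric])
qed

text \<open>The witness is the product of the \<open>a s\<close> with \<open>s \<in> u\<close>, in
  any fixed order. For \<open>t \<notin> u\<close> all factors lie deep in the chain of
  \<open>t\<close>. For \<open>t \<in> u\<close> exactly one factor is bad, and splitting the
  product around it leads to \<open>chain_outside\<close>; hence membership describes the complement
  of \<open>u\<close>.\<close>

lemma independent_pattern:
  assumes S: "finite S" and ch: "\<And>s. s \<in> S \<Longrightarrow> chain (B s) (\<psi> s) (k s)"
    and a: "\<And>s. s \<in> S \<Longrightarrow> a s \<in> carrier G"
    and in': "\<And>s t. \<lbrakk>s \<in> S; t \<in> S; s \<noteq> t\<rbrakk> \<Longrightarrow> a s \<in> W (\<psi> t (5 + 2 * card S))"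
    and out: "\<And>s. s \<in> S \<Longrightarrow> a s \<notin> W (\<psi> s 2)"
    and u: "u \<subseteq> S"
  shows "\<exists>x\<in>carrier G. \<forall>t\<in>S. x \<in> W (\<psi> t 5) \<longleftrightarrow> t \<notin> u"
proof -
  obtain xs where xs: "set xs = u" "distinct xs"
    using finite_distinct_list[OF finite_subset[OF u S]] by blast
  have prod: "foldr (\<otimes>) (map a ys) \<one> \<in> W (\<psi> t 5)"
    if t: "t \<in> S" "t \<notin> set ys" and ys: "set ys \<subseteq> u" "distinct ys" for t ys
  proof (rule chain_prod[OF ch[OF t(1)]])
    fix x assume "x \<in> set (map a ys)"
    then obtain s where s: "s \<in> set ys" "x = a s" by auto
    have "length ys \<le> card S"
      using ys u S card_mono[of S "set ys"] distinct_card[OF ys(2)] by simp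
    moreover have "x \<in> W (\<psi> t (5 + 2 * card S))" using in'[of s t] s t ys u by auto
    ultimately show "x \<in> W (\<psi> t (5 + 2 * length (map a ys)))"
      using chain_mono[OF ch[OF t(1)]] by simp
  qed
  let ?x = "foldr (\<otimes>) (map a xs) \<one>"
  have ac: "set (map a ys) \<subseteq> carrier G" if "set ys \<subseteq> u" for ys using that u a by auto
  have "?x \<in> carrier G" using foldr_mult_append[OF ac[of xs], of "[]"] xs by simp
  moreover have "?x \<notin> W (\<psi> t 5)" if t: "t \<in> u" for t
  proof -
    obtain ys zs where yz: "xs = ys @ t # zs" using split_list t xs(1) by metis
    have sub: "set ys \<subseteq> u" "set zs \<subseteq> u" using yz xs(1) by auto
    have "?x = foldr (\<otimes>) (map a ys) \<one> \<otimes> (a t \<otimes> foldr (\<otimes>) (map a zs) \<one>)"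
      using foldr_mult_append[OF ac[OF sub(1)], of "map a (t # zs)"] ac[of "t # zs"] sub t yz by simp
    moreover have "t \<notin> set ys" "t \<notin> set zs" "distinct ys" "distinct zs" using xs(2) yz by auto
    ultimately show ?thesis
      using chain_outside[OF ch prod prod a out] sub t u by auto
  qed
  moreover have "?x \<in> W (\<psi> t 5)" if "t \<in> S" "t \<notin> u" for t using prod[of t xs] that xs by simp
  ultimately show ?thesis by blast
qed

end

section \<open>From chains to 2-independence\<close>

locale bounded_base = definable_group G L N \<kappa>b A p \<mu> \<iota> \<epsilon>
  for G :: "'a monoid" (structure) and L :: "('f, 'r) lang" and N :: "('f, 'r, 'a) struct"
    and \<kappa>b :: "'kb rel" and A :: "'a set" and p :: "('f, 'r, 'a) fm set"
    and \<mu> \<iota> \<epsilon> :: "('f, 'r, 'a) fm" +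
  fixes M :: "('f, 'r, 'a) struct" and \<kappa> :: "'k rel" and bs :: "'a list"
  assumes sub: "elem_sub L M N" and satM: "saturated L \<kappa> M"
    and \<kappa>: "Card_order \<kappa>" "natLeq <o \<kappa>" and A\<kappa>: "|A| <o \<kappa>"
    and AM: "A \<subseteq> dom M" and M\<kappa>b: "|dom M| <o \<kappa>b" and bs: "set bs \<subseteq> dom N"
begin

abbreviation B :: "'a set" where "B \<equiv> dom M \<union> set bs"

abbreviation GM :: "'a set" where "GM \<equiv> G_of N G (q_set L \<kappa>b N G (dom M))"

lemma M_dom: "dom M \<subseteq> dom N"
  using sub by (simp add: elem_sub_def)

lemma B_dom: "B \<subseteq> dom N" and AB: "A \<subseteq> B" and card_B: "|B| <o \<kappa>b"
  using M_dom bs AM card_Un_finite[OF card_order natLeq_le M\<kappa>b, of "set bs"] by auto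

lemma GM_carrier: "x \<in> GM \<Longrightarrow> x \<in> carrier G"
  by (simp add: G_of_def)

lemma GM_quotient:
  assumes "x \<in> GM" "y \<in> GM"
  shows "x \<otimes> inv y \<in> GM"
proof -
  have "x \<otimes> inv y \<in> G_of N G q" if q: "q \<in> R_set L \<kappa>b N G (dom M)" for q
  proof -
    have "x \<in> G_of N G q" "y \<in> G_of N G q" using assms q by (auto simp: G_of_def q_set_def)
    then show ?thesis
      using q by (simp add: R_set_def subgroup.m_closed subgroup.m_inv_closed)
  qed
  then show ?thesis using assms by (auto simp: G_of_def q_set_def)
qed

text \<open>A chain over \<open>M\<close> is a bounded subgroup over \<open>M\<close>, so its
  formulas belong to the type defining \<open>GM\<close>. Thus \<open>GM\<close> lies in every group
  obtained by copying the parameters of a chain into \<open>M\<close>.\<close>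

lemma GM_chain:
  assumes "chain D \<psi> k" "D \<subseteq> dom M" "x \<in> GM"
  shows "x \<in> W (\<psi> n)"
proof -
  have "chain (dom M) \<psi> k"
    using assms(1) forms_mono[OF _ assms(2), of _ L 1 1] by (auto simp: chain_def)
  then have "range \<psi> \<subseteq> q_set L \<kappa>b N G (dom M)" using chain_R_set by (auto simp: q_set_def)
  then show ?thesis using assms(3) by (auto simp: G_of_def W_def)
qed

lemma cover_classes:
  assumes "covered \<phi> k"
  obtains g c where "\<And>x. x \<in> carrier G \<Longrightarrow> c x < k \<and> g (c x) \<in> carrier G \<and> x \<otimes> inv (g (c x)) \<in> W \<phi>"
  using assms unfolding covered_def by metis

lemma same_class:
  assumes ch: "chain D \<psi> k" and xyz: "x \<in> carrier G" "y \<in> carrier G" "z \<in> carrier G"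
    and "x \<otimes> inv z \<in> W (\<psi> (Suc n))" "y \<otimes> inv z \<in> W (\<psi> (Suc n))"
  shows "x \<otimes> inv y \<in> W (\<psi> n)"
proof -
  have "x \<otimes> inv z \<otimes> inv (y \<otimes> inv z) \<in> W (\<psi> n)"
    using chain_quotient[OF ch] assms(5,6) by blast
  also have "x \<otimes> inv z \<otimes> inv (y \<otimes> inv z) = x \<otimes> inv y"
    using xyz by (simp add: inv_mult_group m_assoc inv_solve_left')
  finally show ?thesis .
qed

text \<open>Multiplying the quotient by \<open>y\<close> returns \<open>x\<close>, and
  \<open>chain_mult\<close> says at which levels this would put \<open>x\<close> into level
  \<open>n\<close>.\<close>

lemma quotient_outside:
  assumes ch: "chain D \<psi> k" and x: "x \<in> carrier G" "x \<notin> W (\<psi> n)" and y: "y \<in> W (\<psi> (Suc (Suc n)))"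
  shows "x \<otimes> inv y \<notin> W (\<psi> (Suc n))"
proof
  assume "x \<otimes> inv y \<in> W (\<psi> (Suc n))"
  from chain_mult[OF ch this y] show False
    using x W_carrier[OF y] by (simp add: m_assoc)
qed

text \<open>An element is known to lie in the earlier groups, but nothing is known about the later
  ones. Ramsey's theorem gives a subsequence on which all earlier elements have the same class
  modulo a later group, so that their quotients nearly lie in it. The number of colours is
  \<open>k (Suc K)\<close> for all chains alike.\<close>

lemma irredundant_subsequence:
  fixes \<psi> :: "nat \<Rightarrow> nat \<Rightarrow> ('f, 'r, 'a) fm" and K :: nat
  assumes ch: "\<And>i. chain B (\<psi> i) k"
    and a: "\<And>i. a i \<in> GM" "\<And>i j n. j < i \<Longrightarrow> a i \<in> W (\<psi> j n)" "\<And>i. a i \<notin> W (\<psi> i 0)"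
  obtains e :: "nat \<Rightarrow> nat" and a' :: "nat \<Rightarrow> 'a"
  where "\<And>i. a' i \<in> GM" "\<And>i. a' i \<notin> W (\<psi> (e i) 1)"
    "\<And>i j. i \<noteq> j \<Longrightarrow> a' i \<in> W (\<psi> (e j) K)"
proof -
  have ac: "a i \<in> carrier G" for i using a(1) GM_carrier by blast
  have cov: "covered (\<psi> j (Suc K)) (k (Suc K))" for j using ch by (simp add: chain_def)
  have "\<exists>g c. \<forall>x\<in>carrier G. c x < k (Suc K) \<and> g (c x) \<in> carrier G \<and>
      x \<otimes> inv (g (c x)) \<in> W (\<psi> j (Suc K))" for j
    using cover_classes[OF cov[of j]] by metis
  then obtain g c where gc: "\<And>j x. x \<in> carrier G \<Longrightarrow> c j x < k (Suc K) \<and>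
      g j (c j x) \<in> carrier G \<and> x \<otimes> inv (g j (c j x)) \<in> W (\<psi> j (Suc K))" by metis
  \<comment> \<open>The smaller index selects the element and the larger one the group.\<close>
  define f where "f X = c (Max X) (a (Min X))" for X :: "nat set"
  have "\<exists>Y t. Y \<subseteq> UNIV \<and> infinite Y \<and> t < k (Suc K) \<and>
      (\<forall>x\<in>Y. \<forall>y\<in>Y. x \<noteq> y \<longrightarrow> f {x, y} = t)"
    by (rule Ramsey2) (use gc ac in \<open>auto simp: f_def\<close>)
  then obtain Y t where Y: "infinite Y" "\<And>x y. \<lbrakk>x \<in> Y; y \<in> Y; x \<noteq> y\<rbrakk> \<Longrightarrow> f {x, y} = t" by metis
  obtain r :: "nat \<Rightarrow> nat" where r: "strict_mono r" "\<And>n. r n \<in> Y"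
    using infinite_enumerate[OF Y(1)] by blast
  have less: "r i < r j" if "i < j" for i j using r(1) that by (simp add: strict_mono_less)
  have cls: "c (r j) (a (r i)) = t" if "i < j" for i j
    using Y(2)[OF r(2)[of i] r(2)[of j]] less[OF that] by (simp add: f_def)
  \<comment> \<open>Disjoint consecutive pairs: the second element of a pair lies in all levels of
    the group indexed by the first, so the quotient stays outside that group at the price of one
    level.\<close>
  define e where "e i = r (2 * i)" for i
  define a' where "a' i = a (r (2 * i)) \<otimes> inv (a (r (2 * i + 1)))" for i
  show thesis
  proof (rule that[where a' = a' and e = e])
    show "a' i \<in> GM" for i unfolding a'_def by (rule GM_quotient[OF a(1) a(1)])
    show "a' i \<notin> W (\<psi> (e i) 1)" for i
      unfolding a'_def e_def
      using quotient_outside[OF ch ac a(3) a(2)[OF less[of "2 * i" "2 * i + 1"]]] by simp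
    show "a' i \<in> W (\<psi> (e j) K)" if ij: "i \<noteq> j" for i j
    proof (cases "j < i")
      case True
      then show ?thesis unfolding a'_def e_def
        by (intro chain_quotient[OF ch] a(2) less) auto
    next
      case False
      then have "2 * i < 2 * j" "2 * i + 1 < 2 * j" using ij by auto
      then have "c (r (2 * j)) (a (r (2 * i))) = t" "c (r (2 * j)) (a (r (2 * i + 1))) = t"
        using cls by blast+
      then show ?thesis
        using gc[OF ac, of "r (2 * j)" "r (2 * i)"] gc[OF ac, of "r (2 * j)" "r (2 * i + 1)"]
        unfolding a'_def e_def by (intro same_class[OF ch ac ac]) simp_all
    qed
  qed
qed

text \<open>Row \<open>l\<close> comes from the copy of \<open>bs\<close> under \<open>h l\<close>,
  column \<open>j\<close> from the part of \<open>\<psi> j\<close> over \<open>M\<close>, whose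
  relevant parameters in \<open>C\<close> are fixed by all copies. Infinitely many copies are made,
  so that pairs of copies with equal classes can be selected from them.\<close>

lemma finite_array:
  fixes n :: nat and \<psi> :: "nat \<Rightarrow> nat \<Rightarrow> ('f, 'r, 'a) fm"
  assumes ch: "\<And>j. chain B (\<psi> j) k" and C: "finite C" "C \<subseteq> dom M"
    and a: "\<And>i. a i \<in> GM" "\<And>i. a i \<notin> W (\<psi> i 1)"
      "\<And>i j. i \<noteq> j \<Longrightarrow> a i \<in> W (\<psi> j (6 + 2 * (n * n)))"
  obtains h where "\<And>l :: nat. h l ` set bs \<subseteq> dom N" "\<And>l c. c \<in> C \<Longrightarrow> h l c = c"
    "\<And>u. \<exists>x\<in>carrier G. \<forall>l<n. \<forall>j<n. x \<in> W (pmap (h l) (\<psi> j 5)) \<longleftrightarrow> (l, j) \<in> u"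
proof -
  \<comment> \<open>Each factor of a product costs two levels, and a pattern has at most \<open>n\<^sup>2\<close> factors.\<close>
  define K where "K = 5 + 2 * (n * n)"
  \<comment> \<open>Everything all copies must fix. Apart from \<open>A\<close> it is countable,
    since each of the countably many formulas has finitely many parameters; so saturation of
    \<open>M\<close> applies.\<close>
  define D0 where "D0 = A \<union> (C \<union> (\<Union>jm\<in>UNIV. pars (\<psi> (fst jm) (snd jm)) \<inter> dom M))"
  define E where "E = set bs \<union> a ` {..<n}"
  have ac: "a i \<in> carrier G" for i using a(1) GM_carrier by blast
  have E: "finite E" "E \<subseteq> dom N" using bs ac carrier_dom by (auto simp: E_def)
  have \<kappa>le: "natLeq \<le>o \<kappa>" using \<kappa>(2) by (rule ordLess_imp_ordLeq)
  have inf\<kappa>: "Cinfinite \<kappa>" using \<kappa>(1) \<kappa>le natLeq_cinfinite cinfinite_mono by blast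
  have D0: "D0 \<subseteq> dom M" "|D0| <o \<kappa>"
  proof -
    show "D0 \<subseteq> dom M" using AM C by (auto simp: D0_def)
    have fin: "|X| \<le>o natLeq" if "finite X" for X :: "'a set"
      using that finite_iff_ordLess_natLeq ordLess_imp_ordLeq by blast
    have "|UNIV :: (nat \<times> nat) set| =o |UNIV :: nat set|"
      using card_of_Times_same_infinite[of "UNIV :: nat set"] by simp
    then have I: "|UNIV :: (nat \<times> nat) set| \<le>o natLeq"
      using card_of_nat ordIso_transitive ordIso_iff_ordLeq by blast
    have "|C \<union> (\<Union>jm\<in>UNIV. pars (\<psi> (fst jm) (snd jm)) \<inter> dom M)| \<le>o natLeq"
      by (intro Un_Cinfinite_bound UNION_Cinfinite_bound natLeq_Cinfinite I ballI fin) (auto simp: C)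
    then have "|C \<union> (\<Union>jm\<in>UNIV. pars (\<psi> (fst jm) (snd jm)) \<inter> dom M)| <o \<kappa>"
      using \<kappa>(2) ordLeq_ordLess_trans by blast
    then show "|D0| <o \<kappa>" unfolding D0_def by (rule Un_Cinfinite_bound_strict[OF A\<kappa> _ inf\<kappa>])
  qed
  define good where "good D \<longleftrightarrow> D0 \<subseteq> D \<and> D \<subseteq> dom M \<and> |D| <o \<kappa>" for D
  have "\<exists>f. elem_map L N (D \<union> E) f \<and> (\<forall>x\<in>D. f x = x) \<and> f ` (D \<union> E) \<subseteq> dom M" if "good D" for D
    using elem_map_ext_finite[OF sub satM \<kappa>(1) \<kappa>le elem_map_id[of D N L] _ _ E] that M_dom
    by (auto simp: good_def)
  then obtain F where F: "\<And>D. good D \<Longrightarrow> elem_map L N (D \<union> E) (F D)"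
    "\<And>D x. good D \<Longrightarrow> x \<in> D \<Longrightarrow> F D x = x" "\<And>D. good D \<Longrightarrow> F D ` (D \<union> E) \<subseteq> dom M" by metis
  \<comment> \<open>Stage \<open>i\<close> contains the earlier copies of \<open>E\<close>, so each
    new copy is made over all previous ones.\<close>
  define Ds where "Ds = rec_nat D0 (\<lambda>_ D. D \<union> F D ` E)"
  have Ds_Suc: "Ds (Suc i) = Ds i \<union> F (Ds i) ` E" for i by (simp add: Ds_def)
  have goodDs: "good (Ds i)" for i
  proof (induction i)
    case 0
    show ?case using D0 by (simp add: Ds_def good_def)
  next
    case (Suc i)
    then show ?case
      using F(3)[OF Suc] card_Un_finite[OF \<kappa>(1) \<kappa>le, of "Ds i" "F (Ds i) ` E"] E(1)
      by (auto simp: good_def Ds_Suc)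
  qed
  have Ds_mono: "Ds i \<subseteq> Ds j" if "i \<le> j" for i j
    using that by (rule lift_Suc_mono_le[of Ds, rotated]) (auto simp: Ds_Suc)
  define f where "f i = F (Ds i)" for i
  define S where "S i = Ds i \<union> E" for i
  have f: "elem_map L N (S i) (f i)" for i using F(1)[OF goodDs] by (simp add: f_def S_def)
  have f_id: "x \<in> Ds i \<Longrightarrow> f i x = x" for x i using F(2)[OF goodDs] by (simp add: f_def)
  have f_S: "f i ` S i \<subseteq> dom M" for i using F(3)[OF goodDs] by (simp add: f_def S_def)
  have f_Ds: "f i ` S i \<subseteq> Ds j" if "i < j" for i j
    using Ds_mono[OF Suc_leI[OF that]] f_id by (auto simp: S_def Ds_Suc f_def)
  have AD: "A \<subseteq> Ds i" for i using goodDs by (auto simp: good_def D0_def)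
  have AS: "A \<subseteq> S i" and fA: "\<And>x. x \<in> A \<Longrightarrow> f i x = x" for i
    using AD[of i] f_id[of _ i] by (auto simp: S_def)
  have cardS: "|S i| <o \<kappa>b" for i
  proof -
    have "|Ds i| \<le>o |dom M|" using goodDs[of i] by (auto simp: good_def intro: card_of_mono1)
    then have "|Ds i| <o \<kappa>b" using M\<kappa>b ordLeq_ordLess_trans by blast
    then show ?thesis unfolding S_def using E(1) by (intro card_Un_finite card_order natLeq_le)
  qed
  have pS: "pars (\<psi> j m) \<subseteq> S i" for i j m
  proof -
    have "\<psi> j m \<in> forms L B 1" using ch[of j] by (simp add: chain_def)
    then have "pars (\<psi> j m) \<subseteq> B" by (rule pars_forms)
    moreover have "pars (\<psi> j m) \<inter> dom M \<subseteq> Ds i"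
      using goodDs[of i] by (force simp: good_def D0_def)
    ultimately show ?thesis by (auto simp: S_def E_def)
  qed
  define \<Psi> where "\<Psi> i j m = pmap (f i) (\<psi> j m)" for i j m
  have ch\<Psi>: "chain (f i ` S i) (\<Psi> i j) k" for i j
    unfolding \<Psi>_def by (rule chain_transfer[OF f AS fA cardS ch pS])
  have forms\<psi>: "\<psi> j m \<in> forms L (S i) 1" for i j m
    by (rule forms_restrict[of _ L B 1]) (use ch[of j] pS in \<open>simp_all add: chain_def\<close>)
  have aS: "t < n \<Longrightarrow> a t \<in> S i" for t i by (auto simp: S_def E_def)
  define b where "b i t = f i (a t)" for i t
  have bc: "b i t \<in> carrier G" if "t < n" for i t
    using elem_map_W(1)[OF f AS fA aS[OF that]] ac by (simp add: b_def)
  \<comment> \<open>Copied elements lie in the groups of earlier copies: such a group is a chain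
    over \<open>M\<close> and hence contains \<open>a t\<close>, and \<open>f i\<close> fixes its
    parameters, so \<open>b i t\<close> inherits membership.\<close>
  have b_below: "b i t \<in> W (\<Psi> l j m)" if "l < i" "t < n" for i l t j m
  proof -
    have "a t \<in> W (\<Psi> l j m)" by (rule GM_chain[OF ch\<Psi> f_S a(1)])
    moreover have \<Psi>f: "\<Psi> l j m \<in> forms L (Ds i) 1"
      using ch\<Psi>[of l j] forms_mono[OF _ f_Ds[OF that(1)], of _ L 1 1] by (auto simp: chain_def)
    then have "\<Psi> l j m \<in> forms L (S i) 1" using forms_mono[of _ L "Ds i" 1 "S i" 1] by (auto simp: S_def)
    moreover have "pmap (f i) (\<Psi> l j m) = \<Psi> l j m"
      using pars_forms[OF \<Psi>f] f_id by (intro pmap_id) auto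
    ultimately show ?thesis
      using elem_map_W(2)[OF f[of i] AS fA aS[OF that(2)], of "\<Psi> l j m"] by (simp add: b_def)
  qed
  have b_diag: "b i t \<in> W (\<Psi> i j m) \<longleftrightarrow> a t \<in> W (\<psi> j m)" if "t < n" for i t j m
    using elem_map_W(2)[OF f AS fA aS[OF that] forms\<psi>] by (simp add: b_def \<Psi>_def)
  have b_in: "b i t \<in> Ds l" if "i < l" "t < n" for i l t
    using f_Ds[OF that(1)] aS[OF that(2)] by (auto simp: b_def)
  have "covered (\<psi> j (Suc K)) (k (Suc K))" for j using ch by (simp add: chain_def)
  then have "\<exists>g c. \<forall>x\<in>carrier G. c x < k (Suc K) \<and> g (c x) \<in> carrier G \<and>
      x \<otimes> inv (g (c x)) \<in> W (\<psi> j (Suc K))" for j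
    using cover_classes by metis
  then obtain g c where gc: "\<And>j x. x \<in> carrier G \<Longrightarrow> c j x < k (Suc K) \<and>
      g j (c j x) \<in> carrier G \<and> x \<otimes> inv (g j (c j x)) \<in> W (\<psi> j (Suc K))" by metis
  \<comment> \<open>The classes are taken modulo the original chains over \<open>B\<close>, not
    their copies. There are finitely many vectors of classes, so infinitely many copies share
    one.\<close>
  define cl where "cl i = (\<lambda>tj\<in>{..<n} \<times> {..<n}. c (snd tj) (b i (fst tj)))" for i
  have "cl i \<in> PiE ({..<n} \<times> {..<n}) (\<lambda>_. {..<k (Suc K)})" for i
    unfolding cl_def restrict_PiE_iff using gc bc by auto
  then have "range cl \<subseteq> PiE ({..<n} \<times> {..<n}) (\<lambda>_. {..<k (Suc K)})" by blast
  moreover have "finite (PiE ({..<n} \<times> {..<n}) (\<lambda>_. {..<k (Suc K)}))"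
    by (intro finite_PiE) auto
  ultimately have "finite (range cl)" by (rule finite_subset)
  then obtain i0 where "infinite {i\<in>UNIV. cl i = cl i0}"
    using pigeonhole_infinite[of UNIV cl] by auto
  then obtain r :: "nat \<Rightarrow> nat" where r: "strict_mono r" "\<And>i. cl (r i) = cl i0"
    using infinite_enumerate[of "{i\<in>UNIV. cl i = cl i0}"] by auto
  have less: "r i < r j" if "i < j" for i j using r(1) that by (simp add: strict_mono_less)
  have same: "b (r i) t \<otimes> inv (b (r i') t) \<in> W (\<psi> j K)" if "t < n" "j < n" for i i' t j
  proof -
    have "cl (r i) (t, j) = cl (r i') (t, j)" using r(2) by simp
    then have "c j (b (r i) t) = c j (b (r i') t)" using that by (simp add: cl_def)
    then show ?thesis
      using gc[of "b (r i) t" j] gc[of "b (r i') t" j] bc[OF that(1)]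
        same_class[OF ch, of "b (r i) t" "b (r i') t" "g j (c j (b (r i) t))" j K] by simp
  qed
  \<comment> \<open>Copies are used in pairs. The even one supplies the group of row
    \<open>fst s\<close> and the dividend; the odd one comes later, so its elements lie in all
    levels of that group and dividing by them preserves failure. It also balances the classes modulo
    later groups.\<close>
  define d where "d s = b (r (2 * fst s)) (snd s) \<otimes> inv (b (r (2 * fst s + 1)) (snd s))" for s
  define \<Theta> where "\<Theta> s = \<Psi> (r (2 * fst s)) (snd s)" for s
  let ?S = "{..<n} \<times> {..<n}"
  have cardn: "card ?S = n * n" by simp
  have pattern: "\<exists>x\<in>carrier G. \<forall>s\<in>?S. x \<in> W (\<Theta> s 5) \<longleftrightarrow> s \<notin> u" if u: "u \<subseteq> ?S" for u
  proof (rule independent_pattern[OF _ _ _ _ _ u])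
    show "chain (f (r (2 * fst s)) ` S (r (2 * fst s))) (\<Theta> s) k" for s
      unfolding \<Theta>_def by (rule ch\<Psi>)
    show "d s \<in> carrier G" if "s \<in> ?S" for s using that bc by (auto simp: d_def)
    show "d s \<notin> W (\<Theta> s 2)" if s: "s \<in> ?S" for s
    proof -
      obtain m t where mt: "s = (m, t)" "m < n" "t < n" using s by auto
      have "b (r (2 * m)) t \<notin> W (\<Psi> (r (2 * m)) t 1)" using b_diag[OF mt(3)] a(2) by simp
      moreover have "b (r (2 * m + 1)) t \<in> W (\<Psi> (r (2 * m)) t (Suc (Suc 1)))"
        by (rule b_below[OF less mt(3)]) simp
      ultimately show ?thesis
        using quotient_outside[OF ch\<Psi> bc[OF mt(3)]] mt(1) by (simp add: d_def \<Theta>_def numeral_2_eq_2)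
    qed
    show "d s \<in> W (\<Theta> s' (5 + 2 * card ?S))" if s: "s \<in> ?S" "s' \<in> ?S" "s \<noteq> s'" for s s'
    proof -
      obtain m t where mt: "s = (m, t)" "m < n" "t < n" using s by auto
      obtain l j where lj: "s' = (l, j)" "l < n" "j < n" using s by auto
      let ?x = "b (r (2 * m)) t" and ?y = "b (r (2 * m + 1)) t"
      have "?x \<otimes> inv ?y \<in> W (\<Psi> (r (2 * l)) j K)"
      proof (cases "l \<le> m")
        case True
        have y: "?y \<in> W (\<Psi> (r (2 * l)) j (Suc K))"
          by (rule b_below[OF less mt(3)]) (use True in simp)
        have x: "?x \<in> W (\<Psi> (r (2 * l)) j (Suc K))"
        proof (cases "l = m")
          case True
          then have "t \<noteq> j" using s(3) mt lj by simp
          then show ?thesis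
            using True b_diag[OF mt(3)] a(3)[of t j] by (simp add: K_def)
        next
          case False
          then show ?thesis using True by (intro b_below[OF less mt(3)]) simp
        qed
        show ?thesis by (rule chain_quotient[OF ch\<Psi> x y])
      next
        \<comment> \<open>Both elements precede the copy defining row \<open>l\<close>, so
          \<open>f ?i\<close> fixes them. It carries their known membership modulo
          \<open>\<psi> j\<close> to the copied chain.\<close>
        case False
        let ?i = "r (2 * l)"
        have in': "?x \<in> Ds ?i" "?y \<in> Ds ?i"
          using b_in[OF less mt(3)] False by simp_all
        have "?x \<otimes> inv ?y \<in> W (\<psi> j K) \<longleftrightarrow> f ?i ?x \<otimes> inv (f ?i ?y) \<in> W (pmap (f ?i) (\<psi> j K))"
          using in' bc[OF mt(3)]
          by (intro elem_map_quotient[OF f AS fA cardS _ _ _ _ forms\<psi>]) (auto simp: S_def)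
        then show ?thesis using same[OF mt(3) lj(3)] f_id in' by (simp add: \<Psi>_def)
      qed
      then show ?thesis using mt(1) lj(1) cardn by (simp add: d_def \<Theta>_def K_def)
    qed
  qed simp
  show thesis
  proof (rule that[where h = "\<lambda>l. f (r (2 * l))"])
    show "f (r (2 * l)) ` set bs \<subseteq> dom N" for l
      using f_S[of "r (2 * l)"] M_dom by (auto simp: S_def E_def)
    show "f (r (2 * l)) c = c" if "c \<in> C" for l c
      using goodDs[of "r (2 * l)"] that by (intro f_id) (auto simp: good_def D0_def)
    fix u
    show "\<exists>x\<in>carrier G. \<forall>l<n. \<forall>j<n. x \<in> W (pmap (f (r (2 * l))) (\<psi> j 5)) \<longleftrightarrow> (l, j) \<in> u"
      using pattern[of "?S - u"] by (auto simp: \<Theta>_def \<Psi>_def)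
  qed
qed

text \<open>Since all \<open>\<psi> i 5\<close> are instances of one skeleton, replacing its
  numbered parameters by variables gives a single formula for the array. Numbers below
  \<open>length bs\<close> become the row variables and the others the column variables.\<close>

lemma two_independent_sequence:
  fixes \<chi> :: "('f, 'r, nat) fm" and \<psi> :: "nat \<Rightarrow> nat \<Rightarrow> ('f, 'r, 'a) fm"
  assumes mod: "model L T N" and \<chi>: "wf_fm L UNIV \<chi>"
    and ch: "\<And>i. chain B (\<psi> i) k"
    and a: "\<And>i. a i \<in> GM" "\<And>i j n. j < i \<Longrightarrow> a i \<in> W (\<psi> j n)" "\<And>i. a i \<notin> W (\<psi> i 0)"
    and \<psi>5: "\<And>i. \<psi> i 5 = pmap (g i) \<chi>"
    and g: "\<And>i t. t < length bs \<Longrightarrow> g i t = bs ! t" "\<And>i t. length bs \<le> t \<Longrightarrow> g i t \<in> dom M"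
  shows "two_independent L T"
proof -
  let ?l = "length bs"
  obtain v0 where v0: "\<And>i. i \<in> bv \<chi> \<Longrightarrow> i < v0" using fresh_variable by blast
  \<comment> \<open>The object tuple has length \<open>v\<close>, but only variable 0 matters in it.
    The padding places the variables for parameters above the bound variables of the
    skeleton.\<close>
  define v where "v = Suc v0"
  \<comment> \<open>Since \<open>m\<close> exceeds all parameter numbers, the numbers from
    \<open>?l\<close> below \<open>?l + m\<close> include all those naming elements of
    \<open>M\<close>.\<close>
  obtain m where m: "\<forall>t\<in>pars \<chi>. t < m" using finite_nat_set_iff_bounded[of "pars \<chi>"] by auto
  define \<phi> :: "('f, 'r, 'a) fm" where "\<phi> = psubst (\<lambda>t. Var (v + t)) \<chi>"
  have "\<psi> 0 5 \<in> forms L B 1" using ch by (simp add: chain_def)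
  then have fv: "fv \<chi> \<subseteq> {..<1}" using \<psi>5[of 0] by (simp add: forms_def)
  have "fv \<phi> \<subseteq> {..<v + ?l + m}"
  proof -
    have "fv \<phi> \<subseteq> fv \<chi> \<union> (\<Union>c\<in>pars \<chi>. {v + c})"
      unfolding \<phi>_def using fv_psubst[of "\<lambda>t. Var (v + t)" \<chi>] by simp
    moreover have "v + c < v + ?l + m" if "c \<in> pars \<chi>" for c using m that by force
    moreover have "fv \<chi> \<subseteq> {..<v + ?l + m}" using fv by (auto simp: v_def)
    ultimately show ?thesis by auto
  qed
  moreover have "wf_fm L {} \<phi>" unfolding \<phi>_def by (rule wf_psubst[OF \<chi>]) simp
  ultimately have \<phi>: "\<phi> \<in> forms L {} (v + ?l + m)" by (simp add: forms_def)
  show ?thesis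
  proof (rule two_independent_finite_arrays[OF mod saturated natLeq_less \<phi>])
    fix n :: nat
    \<comment> \<open>One level more than the \<open>5 + 2 * (n * n)\<close> needed for products,
      because the array passes to quotients once more.\<close>
    obtain e :: "nat \<Rightarrow> nat" and a' :: "nat \<Rightarrow> 'a" where ea: "\<And>i. a' i \<in> GM" "\<And>i. a' i \<notin> W (\<psi> (e i) 1)"
      "\<And>i j. i \<noteq> j \<Longrightarrow> a' i \<in> W (\<psi> (e j) (6 + 2 * (n * n)))"
      by (rule irredundant_subsequence[where \<psi> = \<psi> and a = a and K = "6 + 2 * (n * n)", OF ch a])
        (assumption, rule that)
    define C where "C = (\<lambda>(j, t). g (e j) t) ` ({..<n} \<times> {?l..<?l + m})"
    have C: "finite C" "C \<subseteq> dom M" using g(2) by (auto simp: C_def)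
    obtain h where h: "\<And>l :: nat. h l ` set bs \<subseteq> dom N" "\<And>l c. c \<in> C \<Longrightarrow> h l c = c"
      "\<And>u. \<exists>x\<in>carrier G. \<forall>l<n. \<forall>j<n. x \<in> W (pmap (h l) (\<psi> (e j) 5)) \<longleftrightarrow> (l, j) \<in> u"
      by (rule finite_array[of "\<lambda>j. \<psi> (e j)" k C a' n, OF ch C ea]) (assumption, rule that)
    define b where "b i = map (h i) bs" for i
    define c where "c j = map (g (e j)) [?l..<?l + m]" for j
    have b: "length (b i) = ?l \<and> set (b i) \<subseteq> dom N" for i using h(1) by (auto simp: b_def)
    have c: "length (c j) = m \<and> set (c j) \<subseteq> dom N" for j
      using g(2) M_dom by (auto simp: c_def)
    have "\<exists>as. length as = v \<and> set as \<subseteq> dom N \<and>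
        (\<forall>i<n. \<forall>j<n. sats N (as @ b i @ c j) \<phi> \<longleftrightarrow> (i, j) \<in> u)" for u
    proof -
      obtain x where x: "x \<in> carrier G"
        "\<And>i j. \<lbrakk>i < n; j < n\<rbrakk> \<Longrightarrow> x \<in> W (pmap (h i) (\<psi> (e j) 5)) \<longleftrightarrow> (i, j) \<in> u"
        using h(3)[of u] by blast
      have "sats N (replicate v x @ b i @ c j) \<phi> \<longleftrightarrow> (i, j) \<in> u" if ij: "i < n" "j < n" for i j
      proof -
        let ?ts = "replicate v x @ b i @ c j"
        have val: "?ts ! (v + t) = h i (g (e j) t)" if t: "t \<in> pars \<chi>" for t
        proof (cases "t < ?l")
          case True
          then show ?thesis using g(1) by (simp add: nth_append b_def)
        next
          case False
          moreover have "t < ?l + m" using m t by force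
          ultimately have "g (e j) t \<in> C" using ij by (force simp: C_def)
          then show ?thesis using False \<open>t < ?l + m\<close> h(2) by (simp add: nth_append b_def c_def)
        qed
        have "sats N ?ts \<phi> \<longleftrightarrow> sat N ((!) ?ts) (pmap (\<lambda>t. h i (g (e j) t)) \<chi>)"
          unfolding sats_def \<phi>_def
        proof (rule sat_psubst)
          fix t assume t: "t \<in> pars \<chi>"
          show "eval N ((!) ?ts) (Var (v + t)) = h i (g (e j) t)" using val[OF t] by simp
          show "fv_trm (Var (v + t)) \<inter> bv \<chi> = {}" by (auto simp: v_def dest!: v0)
        qed
        also have "\<dots> \<longleftrightarrow> sats N [?ts ! 0] (pmap (\<lambda>t. h i (g (e j) t)) \<chi>)"
          by (rule sat_sats1) (use fv in simp)
        also have "pmap (\<lambda>t. h i (g (e j) t)) \<chi> = pmap (h i) (\<psi> (e j) 5)"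
          by (simp add: \<psi>5 pmap_pmap)
        also have "?ts ! 0 = x" by (simp add: v_def)
        also have "sats N [x] (pmap (h i) (\<psi> (e j) 5)) \<longleftrightarrow> (i, j) \<in> u"
          using x(2)[OF ij] x(1) by (simp add: W_def)
        finally show ?thesis .
      qed
      then show ?thesis using x(1) carrier_dom by (intro exI[of _ "replicate v x"]) auto
    qed
    then show "\<exists>b c. (\<forall>i<n. length (b i) = ?l \<and> set (b i) \<subseteq> dom N) \<and>
        (\<forall>j<n. length (c j) = m \<and> set (c j) \<subseteq> dom N) \<and>
        (\<forall>u. \<exists>as. length as = v \<and> set as \<subseteq> dom N \<and>
          (\<forall>i<n. \<forall>j<n. sats N (as @ b i @ c j) \<phi> \<longleftrightarrow> (i, j) \<in> u))"
      using b c by (intro exI[of _ b] exI[of _ c]) auto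
  qed
qed

end

section \<open>Counting formulas\<close>

text \<open>\<open>|T|\<close> counts sentences over the empty set, so numbered parameters are
  hidden in odd variables. Genuine variables become even, and bound ones remain separate from the
  parameters.\<close>

primrec enc_trm :: "('f, nat) trm \<Rightarrow> ('f, 'a) trm" where
  "enc_trm (Var i) = Var (2 * i)"
| "enc_trm (Par i) = Var (2 * i + 1)"
| "enc_trm (Fn f ts) = Fn f (map enc_trm ts)"

primrec enc :: "('f, 'r, nat) fm \<Rightarrow> ('f, 'r, 'a) fm" where
  "enc (Eq s t) = Eq (enc_trm s) (enc_trm t)"
| "enc (Rel R ts) = Rel R (map enc_trm ts)"
| "enc (Neg \<phi>) = Neg (enc \<phi>)"
| "enc (Conj \<phi> \<psi>) = Conj (enc \<phi>) (enc \<psi>)"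
| "enc (Ex i \<phi>) = Ex (2 * i) (enc \<phi>)"

primrec dec_trm :: "('f, 'a) trm \<Rightarrow> ('f, nat) trm" where
  "dec_trm (Var i) = (if even i then Var (i div 2) else Par (i div 2))"
| "dec_trm (Par c) = Var 0"
| "dec_trm (Fn f ts) = Fn f (map dec_trm ts)"

primrec dec :: "('f, 'r, 'a) fm \<Rightarrow> ('f, 'r, nat) fm" where
  "dec (Eq s t) = Eq (dec_trm s) (dec_trm t)"
| "dec (Rel R ts) = Rel R (map dec_trm ts)"
| "dec (Neg \<phi>) = Neg (dec \<phi>)"
| "dec (Conj \<phi> \<psi>) = Conj (dec \<phi>) (dec \<psi>)"
| "dec (Ex i \<phi>) = Ex (i div 2) (dec \<phi>)"

lemma dec_enc_trm [simp]: "dec_trm (enc_trm t) = t"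
  by (induction t) (auto simp: map_idI)

lemma dec_enc [simp]: "dec (enc \<phi>) = \<phi>"
  by (induction \<phi>) (auto simp: map_idI)

lemma wf_enc_trm: "wf_trm L UNIV t \<Longrightarrow> wf_trm L {} (enc_trm t)"
  by (induction t) auto

lemma wf_enc: "wf_fm L UNIV \<phi> \<Longrightarrow> wf_fm L {} (enc \<phi>)"
  by (induction \<phi>) (auto intro: wf_enc_trm)

text \<open>
  A formula is read off a quantified conjunction below all quantifiers and negations, so that
  both a sentence and its negation determine it; a complete theory contains one of them.
\<close>

primrec strip :: "('f, 'r, 'a) fm \<Rightarrow> ('f, 'r, nat) fm" where
  "strip (Eq s t) = Eq (Var 0) (Var 0)"
| "strip (Rel R ts) = Eq (Var 0) (Var 0)"
| "strip (Neg \<phi>) = strip \<phi>"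
| "strip (Conj \<phi> \<psi>) = dec \<phi>"
| "strip (Ex i \<phi>) = strip \<phi>"

lemma strip_exs: "strip (exs is \<phi>) = strip \<phi>"
  by (induction "is") auto

lemma card_skeletons:
  fixes T :: "('f, 'r, 'a) fm set"
  assumes "complete_theory L T"
  shows "|{\<chi> :: ('f, 'r, nat) fm. wf_fm L UNIV \<chi>}| \<le>o |T|"
proof -
  have "\<chi> \<in> strip ` T" if \<chi>: "wf_fm L UNIV \<chi>" for \<chi> :: "('f, 'r, nat) fm"
  proof -
    \<comment> \<open>The conjunction marks where \<open>strip\<close> stops and reads off the
      formula; its second half is filler.\<close>
    define \<phi> :: "('f, 'r, 'a) fm" where "\<phi> = Conj (enc \<chi>) (enc \<chi>)"
    obtain js where js: "set js = fv \<phi>" using finite_list[OF finite_fv] by blast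
    have "exs js \<phi> \<in> forms L {} 0"
      using js wf_enc[OF \<chi>] by (auto simp: forms_def \<phi>_def)
    then have "exs js \<phi> \<in> T \<or> Neg (exs js \<phi>) \<in> T" using assms by (simp add: complete_theory_def)
    moreover have "strip (exs js \<phi>) = \<chi>" "strip (Neg (exs js \<phi>)) = \<chi>"
      by (simp_all add: strip_exs \<phi>_def)
    ultimately show ?thesis by (metis imageI)
  qed
  then have "{\<chi> :: ('f, 'r, nat) fm. wf_fm L UNIV \<chi>} \<subseteq> strip ` T" by blast
  then show ?thesis using card_of_mono1 card_of_image ordLeq_transitive by blast
qed

lemma infinite_skeletons: "infinite {\<chi> :: ('f, 'r, nat) fm. wf_fm L UNIV \<chi>}"
proof
  assume "finite {\<chi> :: ('f, 'r, nat) fm. wf_fm L UNIV \<chi>}"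
  moreover have "range (\<lambda>i. Eq (Var i) (Var i)) \<subseteq> {\<chi> :: ('f, 'r, nat) fm. wf_fm L UNIV \<chi>}" by auto
  ultimately have "finite (range (\<lambda>i. Eq (Var i) (Var i) :: ('f, 'r, nat) fm))"
    by (rule finite_subset[rotated])
  moreover have "inj (\<lambda>i. Eq (Var i) (Var i) :: ('f, 'r, nat) fm)" by (auto intro: injI)
  ultimately show False using finite_imageD by blast
qed

section \<open>The base\<close>

text \<open>
  The skeleton makes a sequence of chains of the same shape instances of a single formula; the
  bounds \<open>k\<close> give the uniform number of colours needed for Ramsey's theorem.
\<close>

type_synonym ('f, 'r) shape = "('f, 'r, nat) fm \<times> (nat \<Rightarrow> nat)"

definition shapes :: "('f, 'r) lang \<Rightarrow> ('f, 'r) shape set" where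
  "shapes L = {\<chi>. wf_fm L UNIV \<chi>} \<times> UNIV"

lemma infinite_shapes: "infinite (shapes L)"
  using infinite_skeletons by (auto simp: shapes_def dest: finite_cartesian_productD1)

context bounded_base
begin

text \<open>The whole group is bounded in itself. Hence \<open>p\<close> is part of the type
  \<open>q_set\<close> over \<open>M\<close>, and a realization of that type in the universe lies in
  \<open>G\<close>.\<close>

lemma p_R_set: "p \<in> R_set L \<kappa>b N G (dom M)"
proof -
  have G: "G_of N G p = carrier G" by (auto simp: G_of_def carrier realz_def)
  have "rcosets (carrier G) \<subseteq> {carrier G}"
    using coset_join2[OF _ subgroup_self] by (auto simp: RCOSETS_def)
  then have "finite (rcosets (carrier G))" using finite_subset by blast
  then have "|rcosets (carrier G)| <o \<kappa>b"
    using finite_iff_ordLess_natLeq natLeq_less ordLess_transitive by blast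
  moreover have "one_type L N (dom M) p"
    unfolding one_type_def consistent_in_def
  proof (intro conjI allI impI)
    show "p \<subseteq> forms L (dom M) 1" using p forms_mono[OF _ AM, of _ L 1 1] by auto
    fix F assume "finite F \<and> F \<subseteq> p"
    then show "\<exists>as. length as = 1 \<and> set as \<subseteq> dom N \<and> (\<forall>\<phi>\<in>F. sats N as \<phi>)"
      using one_closed by (intro exI[of _ "[\<one>]"]) (auto simp: carrier realz_def)
  qed
  ultimately show ?thesis using subgroup_self by (simp add: R_set_def G)
qed

text \<open>Level 5 is the formula of the array, so it is the level tied to the skeleton. The other
  levels enter the shape by their covering numbers, which contribute the continuum many
  possibilities.\<close>

definition shaped :: "('f, 'r) shape \<Rightarrow> (nat \<Rightarrow> ('f, 'r, 'a) fm) \<Rightarrow> bool" where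
  "shaped s \<psi> \<longleftrightarrow> chain B \<psi> (snd s) \<and>
     (\<exists>g. (\<forall>t<length bs. g t = bs ! t) \<and> (\<forall>t\<ge>length bs. g t \<in> dom M) \<and> \<psi> 5 = pmap g (fst s))"

lemma chain_shaped:
  assumes ch: "chain B \<psi> k"
  shows "\<exists>s\<in>shapes L. shaped s \<psi>"
proof -
  obtain d where d: "d \<in> dom M" using sub by (auto simp: elem_sub_def is_struct_def)
  have \<psi>5: "\<psi> 5 \<in> forms L B 1" using ch by (simp add: chain_def)
  obtain cs where cs: "set cs = pars (\<psi> 5) \<inter> dom M" using finite_list[of "pars (\<psi> 5) \<inter> dom M"] by auto
  \<comment> \<open>Numbers below \<open>length bs\<close> name \<open>bs\<close>, the next ones
    list the parameters in \<open>M\<close>, and \<open>d\<close> keeps all further values inside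
    \<open>M\<close>.\<close>
  define g where "g t = (if t < length bs then bs ! t
    else if t - length bs < length cs then cs ! (t - length bs) else d)" for t
  have "\<exists>t. g t = c" if c: "c \<in> pars (\<psi> 5)" for c
  proof (cases "c \<in> set bs")
    case True
    then obtain t where "t < length bs" "bs ! t = c" by (metis in_set_conv_nth)
    then show ?thesis by (intro exI[of _ t]) (simp add: g_def)
  next
    case False
    then have "c \<in> set cs" using c pars_forms[OF \<psi>5] cs by auto
    then obtain t where "t < length cs" "cs ! t = c" by (metis in_set_conv_nth)
    then show ?thesis by (intro exI[of _ "length bs + t"]) (simp add: g_def)
  qed
  then obtain ix where ix: "\<And>c. c \<in> pars (\<psi> 5) \<Longrightarrow> g (ix c) = c" by metis
  define \<chi> where "\<chi> = pmap ix (\<psi> 5)"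
  have "pmap g \<chi> = \<psi> 5" unfolding \<chi>_def pmap_pmap using ix by (intro pmap_id) auto
  moreover have "wf_fm L UNIV \<chi>"
    using \<psi>5 wf_fm_mono[OF wf_pmap[of L B "\<psi> 5" ix], of UNIV] by (simp add: forms_def \<chi>_def)
  moreover have "g t \<in> dom M" if "t \<ge> length bs" for t
    using d cs nth_mem[of "t - length bs" cs] that by (auto simp: g_def)
  moreover have "g t = bs ! t" if "t < length bs" for t using that by (simp add: g_def)
  ultimately have "shaped (\<chi>, k) \<psi>" "(\<chi>, k) \<in> shapes L"
    using ch by (auto simp: shaped_def shapes_def intro!: exI[of _ g])
  then show ?thesis by blast
qed

text \<open>If every finite set of chains failed, its counterexample could be added to it again and
  again. This produces elements lying in all earlier groups but violating the first formula of the
  next chain, with one skeleton and the same covering numbers throughout.\<close>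

lemma finite_base_shape:
  assumes mod: "model L T N" and dep: "\<not> two_independent L T" and s: "s \<in> shapes L"
  shows "\<exists>F. finite F \<and> F \<subseteq> Collect (shaped s) \<and>
    (\<forall>\<psi> a. shaped s \<psi> \<longrightarrow> a \<in> GM \<longrightarrow> (\<forall>\<psi>'\<in>F. \<forall>n. a \<in> W (\<psi>' n)) \<longrightarrow> a \<in> W (\<psi> 0))"
proof (rule ccontr)
  assume no: "\<not> ?thesis"
  define good where "good F \<longleftrightarrow> finite F \<and> F \<subseteq> Collect (shaped s)" for F
  have "\<exists>\<psi>a. shaped s (fst \<psi>a) \<and> snd \<psi>a \<in> GM \<and>
      (\<forall>\<psi>'\<in>F. \<forall>n. snd \<psi>a \<in> W (\<psi>' n)) \<and> snd \<psi>a \<notin> W (fst \<psi>a 0)" if "good F" for F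
    using no that unfolding good_def by fastforce
  then obtain X where X: "\<And>F. good F \<Longrightarrow> shaped s (fst (X F)) \<and> snd (X F) \<in> GM \<and>
      (\<forall>\<psi>'\<in>F. \<forall>n. snd (X F) \<in> W (\<psi>' n)) \<and> snd (X F) \<notin> W (fst (X F) 0)" by metis
  define Fs where "Fs = rec_nat {} (\<lambda>_ F. insert (fst (X F)) F)"
  have Fs: "Fs (Suc i) = insert (fst (X (Fs i))) (Fs i)" for i by (simp add: Fs_def)
  have good: "good (Fs i)" for i
  proof (induction i)
    case 0
    show ?case by (simp add: good_def Fs_def)
  next
    case (Suc i)
    then show ?case using X[OF Suc] by (simp add: good_def Fs)
  qed
  have mono: "Fs i \<subseteq> Fs j" if "i \<le> j" for i j
    using that by (rule lift_Suc_mono_le[of Fs, rotated]) (auto simp: Fs)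
  define \<psi> where "\<psi> i = fst (X (Fs i))" for i
  define a where "a i = snd (X (Fs i))" for i
  note Xi = X[OF good, folded \<psi>_def a_def]
  have "\<exists>g. (\<forall>t<length bs. g t = bs ! t) \<and> (\<forall>t\<ge>length bs. g t \<in> dom M) \<and> \<psi> i 5 = pmap g (fst s)" for i
    using Xi[of i] by (auto simp: shaped_def)
  then obtain g where g: "\<And>i. (\<forall>t<length bs. g i t = bs ! t) \<and> (\<forall>t\<ge>length bs. g i t \<in> dom M) \<and>
      \<psi> i 5 = pmap (g i) (fst s)" by metis
  have "two_independent L T"
  proof (rule two_independent_sequence[where \<psi> = \<psi> and a = a and g = g, OF mod])
    show "wf_fm L UNIV (fst s)" using s by (auto simp: shapes_def)
    show "chain B (\<psi> i) (snd s)" for i using Xi[of i] by (simp add: shaped_def)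
    show "a i \<in> W (\<psi> j n)" if "j < i" for i j n
    proof -
      have "\<psi> j \<in> Fs i" using mono[OF Suc_leI[OF that]] by (auto simp: Fs \<psi>_def)
      then show ?thesis using Xi[of i] by blast
    qed
  qed (use g Xi in auto)
  then show False using dep by blast
qed

text \<open>Each shape contributes finitely many countable chains, so \<open>r\<close> has at most
  as many formulas as there are shapes. As a union of chains it satisfies the closure conditions of
  \<open>R_setI\<close>.\<close>

lemma base_exists:
  assumes mod: "model L T N" and dep: "\<not> two_independent L T"
    and S\<kappa>: "|shapes L| <o \<kappa>" and S\<kappa>b: "|shapes L| <o \<kappa>b"
  shows "\<exists>r\<in>R_set L \<kappa>b N G B. |r| <o \<kappa> \<and>
    entails N (q_set L \<kappa>b N G (dom M) \<union> r) (q_set L \<kappa>b N G B)"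
proof -
  obtain F where F: "\<And>s. s \<in> shapes L \<Longrightarrow> finite (F s)"
    "\<And>s \<psi>. s \<in> shapes L \<Longrightarrow> \<psi> \<in> F s \<Longrightarrow> shaped s \<psi>"
    "\<And>s \<psi> a. \<lbrakk>s \<in> shapes L; shaped s \<psi>; a \<in> GM; \<And>\<psi>' n. \<psi>' \<in> F s \<Longrightarrow> a \<in> W (\<psi>' n)\<rbrakk> \<Longrightarrow> a \<in> W (\<psi> 0)"
    using finite_base_shape[OF mod dep] by (simp add: subset_iff) metis
  define r where "r = (\<Union>s\<in>shapes L. \<Union>\<psi>\<in>F s. range \<psi>)"
  have inf: "Cinfinite |shapes L|"
    by (simp add: cinfinite_def Field_card_of infinite_shapes card_of_card_order_on)
  have "|\<Union>\<psi>\<in>F s. range \<psi>| \<le>o |shapes L|" if s: "s \<in> shapes L" for s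
  proof -
    have "|F s| \<le>o natLeq" using F(1)[OF s] finite_iff_ordLess_natLeq ordLess_imp_ordLeq by blast
    moreover have "|range \<psi>| \<le>o natLeq" for \<psi> :: "nat \<Rightarrow> ('f, 'r, 'a) fm"
      using card_of_image card_of_nat ordLeq_ordIso_trans by blast
    ultimately have "|\<Union>\<psi>\<in>F s. range \<psi>| \<le>o natLeq"
      by (intro UNION_Cinfinite_bound natLeq_Cinfinite ballI)
    moreover have "natLeq \<le>o |shapes L|"
      using infinite_shapes infinite_iff_natLeq_ordLeq by blast
    ultimately show ?thesis by (rule ordLeq_transitive)
  qed
  then have "|r| \<le>o |shapes L|"
    unfolding r_def
    by (intro UNION_Cinfinite_bound[OF ordIso_imp_ordLeq[OF card_of_refl] ballI inf])
  then have r\<kappa>: "|r| <o \<kappa>" and r\<kappa>b: "|r| <o \<kappa>b"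
    using S\<kappa> S\<kappa>b ordLeq_ordLess_trans by blast+
  have r_chain: "\<exists>\<psi> k n. chain B \<psi> k \<and> \<phi> = \<psi> n \<and> range \<psi> \<subseteq> r" if r: "\<phi> \<in> r" for \<phi>
  proof -
    obtain s \<psi> n where s: "s \<in> shapes L" "\<psi> \<in> F s" "\<phi> = \<psi> n" using r unfolding r_def by blast
    have "chain B \<psi> (snd s)" using F(2)[OF s(1,2)] by (simp add: shaped_def)
    moreover have "range \<psi> \<subseteq> r" unfolding r_def using s(1,2) by blast
    ultimately show ?thesis using s(3) by blast
  qed
  have rR: "r \<in> R_set L \<kappa>b N G B"
  proof (rule R_setI[OF _ r\<kappa>b])
    show "r \<subseteq> forms L B 1" using r_chain by (force simp: chain_def)
    fix \<phi> assume "\<phi> \<in> r"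
    then obtain \<psi> k n where \<psi>: "chain B \<psi> k" "\<phi> = \<psi> n" "range \<psi> \<subseteq> r" using r_chain by blast
    show "\<one> \<in> W \<phi>" "\<exists>k. covered \<phi> k" using \<psi>(1,2) by (auto simp: chain_def)
    show "\<exists>\<psi>\<in>r. \<forall>x\<in>W \<psi>. \<forall>y\<in>W \<psi>. x \<otimes> inv y \<in> W \<phi>"
      using \<psi> by (intro bexI[of _ "\<psi> (Suc n)"]) (auto simp: chain_def)
  qed
  let ?Q = "q_set L \<kappa>b N G (dom M)"
  have "\<exists>F. finite F \<and> F \<subseteq> ?Q \<union> r \<and> (\<forall>a\<in>realz N F. sats N [a] \<theta>)" if \<theta>: "\<theta> \<in> q_set L \<kappa>b N G B" for \<theta>
  proof -
    obtain q where q: "q \<in> R_set L \<kappa>b N G B" "\<theta> \<in> q" using \<theta> by (auto simp: q_set_def)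
    obtain \<psi> k where \<psi>: "chain B \<psi> k" "\<psi> 0 = \<theta>"
      using chain_exists[OF AB B_dom card_B q] by blast
    obtain s where s: "s \<in> shapes L" "shaped s \<psi>" using chain_shaped[OF \<psi>(1)] by blast
    \<comment> \<open>Entailment asks for finitely many premises. Every realization in
      \<open>N\<close> of the premises satisfies \<open>\<theta>\<close>, and saturation over the
      small set \<open>B\<close> turns this into a finite unrealized subset.\<close>
    have "\<not> (\<exists>x\<in>dom N. \<forall>\<phi>\<in>?Q \<union> r \<union> {Neg \<theta>}. sats N [x] \<phi>)"
    proof
      assume "\<exists>x\<in>dom N. \<forall>\<phi>\<in>?Q \<union> r \<union> {Neg \<theta>}. sats N [x] \<phi>"
      then obtain x where x: "x \<in> dom N" "\<forall>\<phi>\<in>?Q. sats N [x] \<phi>" "\<forall>\<phi>\<in>r. sats N [x] \<phi>" "\<not> sats N [x] \<theta>"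
        by auto
      have "p \<subseteq> ?Q" using p_R_set by (auto simp: q_set_def)
      then have xG: "x \<in> carrier G" using x(1,2) by (auto simp: carrier realz_def)
      then have "x \<in> GM" using x(2) by (simp add: G_of_def)
      moreover have "x \<in> W (\<psi>' n)" if "\<psi>' \<in> F s" for \<psi>' n
        using x(3) xG s(1) that by (auto simp: W_def r_def)
      ultimately have "x \<in> W \<theta>" using F(3)[OF s] \<psi>(2) by blast
      then show False using x(4) by (simp add: W_def)
    qed
    moreover have "?Q \<union> r \<union> {Neg \<theta>} \<subseteq> forms L B 1"
    proof -
      have "?Q \<subseteq> forms L B 1"
        using forms_mono[of _ L "dom M" 1 B 1] by (auto simp: q_set_def R_set_def one_type_def)
      moreover have "\<theta> \<in> forms L B 1" using q by (auto simp: R_set_def one_type_def)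
      moreover have "r \<subseteq> forms L B 1" using rR by (simp add: R_set_def one_type_def)
      ultimately show ?thesis by simp
    qed
    ultimately obtain F' where F': "finite F'" "F' \<subseteq> ?Q \<union> r \<union> {Neg \<theta>}"
      "\<not> (\<exists>x\<in>dom N. \<forall>\<phi>\<in>F'. sats N [x] \<phi>)"
      using saturated_realize[OF saturated B_dom card_B, of "?Q \<union> r \<union> {Neg \<theta>}"] by metis
    have "sats N [a] \<theta>" if a: "a \<in> realz N (F' - {Neg \<theta>})" for a
    proof -
      obtain \<phi> where "\<phi> \<in> F'" "\<not> sats N [a] \<phi>" using F'(3) a unfolding realz_def by blast
      then have "\<phi> = Neg \<theta>" "\<not> sats N [a] (Neg \<theta>)" using a by (auto simp: realz_def)
      then show ?thesis by simp
    qed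
    moreover have "finite (F' - {Neg \<theta>})" "F' - {Neg \<theta>} \<subseteq> ?Q \<union> r" using F'(1,2) by auto
    ultimately show ?thesis by blast
  qed
  then show ?thesis using rR r\<kappa> unfolding entails_def by blast
qed

end

section \<open>Cardinal arithmetic for the choice of \<open>\<kappa>\<close>\<close>

lemma card_le_cexp_natLeq:
  assumes "Cinfinite \<rho>"
  shows "\<rho> \<le>o \<rho> ^c natLeq" "Cinfinite (\<rho> ^c natLeq)" "|UNIV :: (nat \<Rightarrow> nat) set| \<le>o \<rho> ^c natLeq"
proof -
  show "\<rho> \<le>o \<rho> ^c natLeq"
    by (rule ordLeq_cexp1[OF Cinfinite_Cnotzero[OF natLeq_Cinfinite]]) (use assms in simp)
  show "Cinfinite (\<rho> ^c natLeq)"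
    using assms by (intro Cinfinite_cexp ctwo_ordLeq_Cinfinite natLeq_Cinfinite)
  have "|UNIV :: (nat \<Rightarrow> nat) set| = natLeq ^c natLeq"
    by (simp add: cexp_def Field_natLeq Func_def)
  also have "natLeq ^c natLeq \<le>o \<rho> ^c natLeq"
    using assms by (intro cexp_mono1 natLeq_ordLeq_cinfinite natLeq_Card_order)
  finally show "|UNIV :: (nat \<Rightarrow> nat) set| \<le>o \<rho> ^c natLeq" .
qed

text \<open>Enlarging the base to \<open>ctwo ^c \<rho>\<close> absorbs the countable exponent,
  since \<open>\<rho> *c natLeq\<close> equals \<open>\<rho>\<close>. This places the first choice
  of \<open>\<kappa>\<close> above \<open>\<rho> ^c natLeq\<close>.\<close>

lemma cexp_natLeq_le:
  assumes "Cinfinite \<rho>"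
  shows "\<rho> ^c natLeq \<le>o ctwo ^c (ctwo ^c \<rho>)"
proof -
  have n: "natLeq \<le>o \<rho>" using assms by (rule natLeq_ordLeq_cinfinite)
  have "\<rho> \<le>o ctwo ^c \<rho>"
    using assms by (intro ordLess_imp_ordLeq ordLess_ctwo_cexp) auto
  then have "\<rho> ^c natLeq \<le>o (ctwo ^c \<rho>) ^c natLeq"
    by (intro cexp_mono1 natLeq_Card_order)
  also have "(ctwo ^c \<rho>) ^c natLeq =o ctwo ^c (\<rho> *c natLeq)"
    by (intro cexp_cprod Card_order_ctwo)
  also have "ctwo ^c (\<rho> *c natLeq) =o ctwo ^c \<rho>"
    by (intro cexp_cong2 cprod_infinite1' assms n Card_order_ctwo Card_order_cprod
        Cinfinite_Cnotzero[OF natLeq_Cinfinite])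
  also have "ctwo ^c \<rho> \<le>o ctwo ^c (ctwo ^c \<rho>)"
    by (intro ordLess_imp_ordLeq ordLess_ctwo_cexp) (rule Card_order_cexp)
  finally show ?thesis .
qed

theorem theorem2p12:
  fixes L :: "('f, 'r) lang"
    and T :: "('f, 'r, 'a) fm set"
    and \<CC> :: "('f, 'r, 'a) struct"
    and \<kappa>bar :: "'kb rel"
    and \<kappa> :: "'k rel"
    and A :: "'a set"
    and p :: "('f, 'r, 'a) fm set"
    and G :: "'a monoid"
  assumes "complete_theory L T"
    and "two_dependent L T"
    and "strongly_inaccessible \<kappa>bar"
    and "|T| <o \<kappa>bar"
    and "model L T \<CC>"
    and "saturated L \<kappa>bar \<CC>"
    and "A \<subseteq> dom \<CC>"
    and "|A| <o \<kappa>bar"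
    and "type_definable_group L \<CC> A p G"
    and "\<kappa> =o cardSuc (ctwo ^c (ctwo ^c ( |T| +c |p| ))) \<or>
         \<kappa> =o cardSuc (( |T| +c |p| ) ^c natLeq) +c cardSuc (ctwo ^c (ctwo ^c natLeq))"
  shows "has_based_bounded_subgroups L \<kappa>bar \<CC> A G \<kappa>"
proof -
  define \<rho> where "\<rho> = |T| +c |p|"
  \<comment> \<open>This cardinal bounds the number of shapes: at most \<open>\<rho>\<close>
    skeletons, each with continuum many sequences of covering numbers. Both choices of
    \<open>\<kappa>\<close> exceed it.\<close>
  define \<nu> where "\<nu> = \<rho> ^c natLeq"
  have Tinf: "infinite T"
    using card_skeletons[OF assms(1)] infinite_skeletons card_of_ordLeq_infinite by blast
  then have \<rho>: "Cinfinite \<rho>"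
    unfolding \<rho>_def by (intro Cinfinite_csum1) (simp_all add: cinfinite_def Field_card_of card_of_card_order_on)
  note \<nu> = card_le_cexp_natLeq[OF \<rho>, folded \<nu>_def]
  have \<kappa>: "Card_order \<kappa>" "\<nu> <o \<kappa>"
  proof -
    have "Card_order \<kappa> \<and> \<nu> <o \<kappa>"
      using assms(10)[folded \<rho>_def]
    proof
      assume k: "\<kappa> =o cardSuc (ctwo ^c (ctwo ^c \<rho>))"
      have "\<nu> <o cardSuc (ctwo ^c (ctwo ^c \<rho>))"
        using cexp_natLeq_le[OF \<rho>, folded \<nu>_def] cardSuc_greater[OF Card_order_cexp]
          ordLeq_ordLess_trans by blast
      then show ?thesis
        using k Card_order_ordIso[OF cardSuc_Card_order[OF Card_order_cexp] k]
          ordLess_ordIso_trans ordIso_symmetric by blast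
    next
      assume k: "\<kappa> =o cardSuc (\<rho> ^c natLeq) +c cardSuc (ctwo ^c (ctwo ^c natLeq))"
      have "\<nu> <o cardSuc \<nu>" unfolding \<nu>_def by (rule cardSuc_greater[OF Card_order_cexp])
      also have "cardSuc \<nu> \<le>o cardSuc (\<rho> ^c natLeq) +c cardSuc (ctwo ^c (ctwo ^c natLeq))"
        unfolding \<nu>_def by (intro ordLeq_csum1 cardSuc_Card_order Card_order_cexp)
      finally show ?thesis
        using k Card_order_ordIso[OF Card_order_csum k] ordLess_ordIso_trans ordIso_symmetric by blast
    qed
    then show "Card_order \<kappa>" "\<nu> <o \<kappa>" by auto
  qed
  have n\<kappa>: "natLeq <o \<kappa>"
    using natLeq_ordLeq_cinfinite[OF \<nu>(2)] \<kappa>(2) ordLeq_ordLess_trans by blast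
  have T\<rho>: "|T| \<le>o \<rho>" "|p| \<le>o \<rho>"
    unfolding \<rho>_def by (auto intro: ordLeq_csum1 ordLeq_csum2 card_of_Card_order)
  have S\<kappa>: "|shapes L :: ('f, 'r) shape set| <o \<kappa>"
  proof -
    have "|{\<chi> :: ('f, 'r, nat) fm. wf_fm L UNIV \<chi>}| \<le>o \<nu>"
      by (rule ordLeq_transitive[OF ordLeq_transitive[OF card_skeletons[OF assms(1)] T\<rho>(1)] \<nu>(1)])
    then have "|shapes L :: ('f, 'r) shape set| \<le>o \<nu>"
      unfolding shapes_def using \<nu> by (intro card_of_Times_ordLeq_infinite_Field)
        (auto simp: cinfinite_def)
    then show ?thesis using \<kappa>(2) ordLeq_ordLess_trans by blast
  qed
  \<comment> \<open>A separate bound, as \<open>\<kappa>\<close> is not compared with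
    \<open>\<kappa>bar\<close>; it ensures that the index of the group defined by \<open>r\<close>
    is below \<open>\<kappa>bar\<close>.\<close>
  have S\<kappa>b: "|shapes L :: ('f, 'r) shape set| <o \<kappa>bar"
  proof -
    have kb: "Card_order \<kappa>bar" "natLeq <o \<kappa>bar"
      using assms(3) by (auto simp: strongly_inaccessible_def)
    let ?X = "{\<chi> :: ('f, 'r, nat) fm. wf_fm L UNIV \<chi>}" and ?Y = "UNIV :: (nat \<Rightarrow> nat) set"
    have X: "|?X| <o \<kappa>bar" using card_skeletons[OF assms(1)] assms(4) ordLeq_ordLess_trans by blast
    have "inj (\<lambda>f. {(i, f i) | i :: nat. True} :: (nat \<times> nat) set)"
      by (rule injI) (auto simp: set_eq_iff fun_eq_iff)
    then have "|?Y| \<le>o |Pow (UNIV \<times> UNIV :: (nat \<times> nat) set)|"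
      unfolding card_of_ordLeq[symmetric] by blast
    moreover have "|UNIV :: nat set| <o \<kappa>bar"
      using kb(2) card_of_nat ordIso_ordLess_trans by blast
    then have "|Pow (UNIV \<times> UNIV :: (nat \<times> nat) set)| <o \<kappa>bar"
      by (intro inaccessible_Pow[OF assms(3)] card_Times_nat kb(2))
    ultimately have Y: "|?Y| <o \<kappa>bar" using ordLeq_ordLess_trans by blast
    have inf: "infinite (Field \<kappa>bar)"
      using kb by (metis cinfinite_def cinfinite_mono natLeq_cinfinite ordLess_imp_ordLeq)
    have "|?X <+> ?Y| <o \<kappa>bar" by (rule card_of_Plus_ordLess_infinite_Field[OF inf kb(1) X Y])
    moreover have "infinite (?X <+> ?Y)" by (simp add: finite_Plus_iff infinite_skeletons)
    then have "|?X \<times> ?Y| \<le>o |?X <+> ?Y|"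
      by (intro card_of_Times_ordLeq_infinite_Field card_of_Plus1 card_of_Plus2 card_of_Card_order)
        (simp add: Field_card_of)
    ultimately show ?thesis unfolding shapes_def using ordLeq_ordLess_trans by blast
  qed
  have grp: "one_type L \<CC> A p" "group G" "carrier G = realz \<CC> p"
    using assms(9) by (auto simp: type_definable_group_def)
  interpret G: group G by (rule grp(2))
  obtain \<mu> where \<mu>: "\<mu> \<in> forms L A 3" "\<And>x y z. \<lbrakk>x \<in> carrier G; y \<in> carrier G; z \<in> dom \<CC>\<rbrakk> \<Longrightarrow>
      sats \<CC> [x, y, z] \<mu> \<longleftrightarrow> z = x \<otimes>\<^bsub>G\<^esub> y"
    using assms(9) unfolding type_definable_group_def by blast
  obtain \<iota> where \<iota>: "\<iota> \<in> forms L A 2" "\<And>x y. \<lbrakk>x \<in> carrier G; y \<in> dom \<CC>\<rbrakk> \<Longrightarrow>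
      sats \<CC> [x, y] \<iota> \<longleftrightarrow> y = inv\<^bsub>G\<^esub> x"
    using assms(9) unfolding type_definable_group_def by blast
  obtain \<epsilon> where \<epsilon>: "\<epsilon> \<in> forms L A 1" "\<And>x. x \<in> dom \<CC> \<Longrightarrow> sats \<CC> [x] \<epsilon> \<longleftrightarrow> x = \<one>\<^bsub>G\<^esub>"
    using assms(9) unfolding type_definable_group_def by blast
  have pA: "p \<subseteq> forms L A 1" using grp(1) by (simp add: one_type_def)
  \<comment> \<open>\<open>A\<close> is only known to be smaller than \<open>\<kappa>bar\<close>,
    whereas copying into \<open>M\<close> needs a base smaller than \<open>\<kappa>\<close>. The
    parameters that really occur number at most \<open>\<rho>\<close>.\<close>
  define A' where "A' = (\<Union>\<phi>\<in>p. pars \<phi>) \<union> (pars \<mu> \<union> pars \<iota> \<union> pars \<epsilon>)"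
  have "pars \<phi> \<subseteq> A" if "\<phi> \<in> p" for \<phi> using pars_forms[of \<phi> L A 1] that pA by blast
  then have A'A: "A' \<subseteq> A"
    unfolding A'_def using pars_forms[OF \<mu>(1)] pars_forms[OF \<iota>(1)] pars_forms[OF \<epsilon>(1)] by blast
  have fin: "|X| \<le>o \<rho>" if "finite X" for X :: "'a set"
    by (rule ordLeq_transitive[OF ordLess_imp_ordLeq[OF finite_iff_ordLess_natLeq[THEN iffD1, OF that]]
          natLeq_ordLeq_cinfinite[OF \<rho>]])
  have "|A'| \<le>o \<rho>"
    unfolding A'_def by (intro Un_Cinfinite_bound UNION_Cinfinite_bound T\<rho> ballI fin \<rho>) auto
  from ordLeq_ordLess_trans[OF ordLeq_transitive[OF this \<nu>(1)] \<kappa>(2)] have A'\<kappa>: "|A'| <o \<kappa>" .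
  have dg: "definable_group G L \<CC> \<kappa>bar A' p \<mu> \<iota> \<epsilon>"
  proof (intro definable_group.intro definable_group_axioms.intro)
    show "is_struct L \<CC>" using assms(5) by (simp add: model_def)
    show "A' \<subseteq> dom \<CC>" using A'A assms(7) by blast
    show "|A'| <o \<kappa>bar" using card_of_mono1[OF A'A] assms(8) ordLeq_ordLess_trans by blast
    show "p \<subseteq> forms L A' 1" using pA forms_restrict[of _ L A 1 A'] by (auto simp: A'_def)
    show "\<mu> \<in> forms L A' 3" by (rule forms_restrict[OF \<mu>(1)]) (auto simp: A'_def)
    show "\<iota> \<in> forms L A' 2" by (rule forms_restrict[OF \<iota>(1)]) (auto simp: A'_def)
    show "\<epsilon> \<in> forms L A' 1" by (rule forms_restrict[OF \<epsilon>(1)]) (auto simp: A'_def)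
  qed (use assms(3,6) grp \<mu>(2) \<iota>(2) \<epsilon>(2) in auto)
  show ?thesis
    unfolding has_based_bounded_subgroups_def
  proof (intro allI impI)
    fix M bs
    assume *: "elem_sub L M \<CC> \<and> |dom M| <o \<kappa>bar \<and> saturated L \<kappa> M \<and> A \<subseteq> dom M \<and> set bs \<subseteq> dom \<CC>"
    have bb: "bounded_base G L \<CC> \<kappa>bar A' p \<mu> \<iota> \<epsilon> M \<kappa> bs"
      by (intro bounded_base.intro bounded_base_axioms.intro dg) (use * \<kappa>(1) n\<kappa> A'\<kappa> A'A in auto)
    show "\<exists>r\<in>R_set L \<kappa>bar \<CC> G (dom M \<union> set bs). |r| <o \<kappa> \<and>
        entails \<CC> (q_set L \<kappa>bar \<CC> G (dom M) \<union> r) (q_set L \<kappa>bar \<CC> G (dom M \<union> set bs))"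
      using bounded_base.base_exists[OF bb assms(5) _ S\<kappa> S\<kappa>b] assms(2)
      by (simp add: two_dependent_def)
  qed
qed

end
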